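(* As $n\to\infty$, the expected number $\mathbb{E}P_n$ of paths required to construct a uniformly random plane tree of size $n$ satisfies $$\mathbb{E}P_n=(\alpha-1)n+\frac16\log_4 n-\frac{\gamma+4(\alpha-1)\log2+\log2+24\zeta'(-1)+2}{12\log2}+\delta(\log_4n)+O(n^{-1/4}),$$ where $$\delta(x)=\frac1{\log2}\sum_{k\in\mathbb{Z}\setminus\{0\}}(-1+\chi_k)\,\Gamma(\chi_k/2)\,\zeta(-1+\chi_k)\,e^{2k\pi ix},\qquad\chi_k=\frac{2k\pi i}{\log2},$$ is a ($1$-periodic) fluctuation with mean $0$, $\alpha=\sum_{k\ge1}\frac{1}{2^k-1}$, $\gamma$ is the Euler--Mascheroni constant and $\zeta$ is the Riemann zeta function.
   Context: A plane tree is a finite rooted tree in which the children of every node are linearly ordered; its size is its number of nodes; a leaf is a node without children (the single-node tree has one leaf). A path is a plane tree in which every node has at most one child (including the single-node tree). For a plane tree $\tau$ that is not a path, $\rho(\tau)$ is the plane tree obtained by simultaneously deleting every node $v$ such that the subtree of $\tau$ consisting of $v$ and all its descendants is a path; $\rho$ is not defined on paths. Let $\tau$ be chosen uniformly at random among all plane trees of size $n$. $P_{n,r}$ is the number of leaves of $\rho^r(\tau)$ (and $0$ if $\rho^r(\tau)$ is not defined), and $P_n=\sum_{r\ge0}P_{n,r}$. Logarithms without base are natural; $\Gamma$ is the Gamma function. *)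

theory Defs
  imports
    "HOL-Probability.Probability"
    "HOL-Complex_Analysis.Complex_Analysis"
    "HOL-Library.Landau_Symbols"
begin

datatype plane_tree = Node "plane_tree list"

fun nodes :: "plane_tree \<Rightarrow> nat" where
  "nodes (Node ts) = Suc (sum_list (map nodes ts))"

fun leaves :: "plane_tree \<Rightarrow> nat" where
  "leaves (Node ts) = (if ts = [] then 1 else sum_list (map leaves ts))"

fun is_path :: "plane_tree \<Rightarrow> bool" where
  "is_path (Node ts) \<longleftrightarrow> length ts \<le> 1 \<and> (\<forall>t\<in>set ts. is_path t)"

(* Deletes all proper descendants of the root whose subtree is a path. If the whole tree is
   not a path, then the root is to be kept, and this is the simultaneous deletion. A node that
   is kept has only kept ancestors, since every subtree of a path is a path. *)
fun delete_paths :: "plane_tree \<Rightarrow> plane_tree" where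
  "delete_paths (Node ts) = Node (map delete_paths (filter (\<lambda>t. \<not> is_path t) ts))"

definition rho :: "plane_tree \<Rightarrow> plane_tree option" where
  "rho t = (if is_path t then None else Some (delete_paths t))"

fun rho_iter :: "nat \<Rightarrow> plane_tree \<Rightarrow> plane_tree option" where
  "rho_iter 0 t = Some t"
| "rho_iter (Suc r) t = Option.bind (rho_iter r t) rho"

definition leaves_after :: "nat \<Rightarrow> plane_tree \<Rightarrow> nat" where
  "leaves_after r t = (case rho_iter r t of None \<Rightarrow> 0 | Some t' \<Rightarrow> leaves t')"

(* Only finitely many terms of the series are nonzero, because rho decreases the size. *)
definition num_paths :: "plane_tree \<Rightarrow> nat" where
  "num_paths t = (\<Sum>r. leaves_after r t)"

definition expected_paths :: "nat \<Rightarrow> real" where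
  "expected_paths n =
     measure_pmf.expectation (pmf_of_set {t. nodes t = n}) (\<lambda>t. real (num_paths t))"

(* The Riemann zeta function, as the analytic continuation of its Dirichlet series to the
   plane without 1. By the identity theorem, this determines its values except at the pole 1. *)
definition zeta :: "complex \<Rightarrow> complex" where
  "zeta = (SOME f. f holomorphic_on - {1} \<and>
     (\<forall>s. Re s > 1 \<longrightarrow> (\<lambda>n. of_nat (Suc n) powr (- s)) sums f s))"

definition alpha :: real where
  "alpha = (\<Sum>k. 1 / (2 ^ Suc k - 1))"

definition chi :: "int \<Rightarrow> complex" where
  "chi k = 2 * of_int k * of_real pi * \<i> / of_real (ln 2)"

definition delta_term :: "real \<Rightarrow> int \<Rightarrow> complex" where
  "delta_term x k = (- 1 + chi k) * Gamma (chi k / 2) * zeta (- 1 + chi k) *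
     exp (2 * of_int k * of_real pi * \<i> * of_real x)"

definition delta :: "real \<Rightarrow> complex" where
  "delta x = 1 / of_real (ln 2) * (\<Sum>\<^sub>\<infinity>k\<in>UNIV - {0}. delta_term x k)"

end

theory Submission
  imports Defs
begin

text \<open>
  Leaves of \<open>rho\<^sup>r t\<close> correspond to those nodes of \<open>t\<close> all of whose child subtrees, but not the node
  itself, disappear within \<open>r\<close> rounds. In the variable \<open>u\<close> with \<open>X (1 + u)\<^sup>2 = u\<close> the generating
  functions become rational, and the expectation becomes a sum over the levels \<open>r\<close> of differences of
  ballot numbers, summed over the multiples of \<open>2 ^ (r + 1) - 1\<close> and of \<open>2 ^ (r + 1)\<close>.
  On the scale \<open>\<surd>n\<close> the ballot numbers follow the density \<open>2 u exp (- u\<^sup>2)\<close>, and Euler--Maclaurin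
  summation turns level \<open>r\<close> into a linear term in \<open>n\<close> plus \<open>H (2 ^ (r + 1) / \<surd>n)\<close>, where
  \<open>H x = (\<Sum>k. k (4 k\<^sup>2 x\<^sup>2 - 2) exp (- k\<^sup>2 x\<^sup>2)) - 1 / x\<^sup>2\<close> tends to \<open>1 / 6\<close> at \<open>0\<close>. Abel summation bounds the
  total error by \<open>O(n powr (- 1 / 4))\<close>. The sum of the \<open>H\<close>-terms is \<open>log 4 n / 6\<close> plus a
  continuously differentiable periodic function of \<open>log 4 n\<close>, up to \<open>O(1 / \<surd>n)\<close>. Its Fourier
  coefficients are values of the Mellin transform of \<open>H\<close>, which analytic continuation identifies with
  \<open>2 (2 z - 1) \<Gamma>(z) \<zeta>(2 z - 1)\<close>; the mean is read off from the derivative of this function, multiplied by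
  \<open>z\<close>, at \<open>z = 0\<close>.
\<close>

text \<open>Level r contributes n (S(m) - S(m + 1)) with m = 2^(r + 1) - 1, where S(m) sums the
  normalised ballot numbers over the multiples of m, so any error in S is multiplied by n. Abel
  summation therefore splits off the trend S(1) / m, which is exact because S(1) = 1 and gives
  (alpha - 1) n; what remains pairs consecutive differences of ballot numbers with the difference of
  two sawtooth functions that nearly agree. The Gaussian approximant has total mass 1 + 1 / (3 n) up
  to lower order instead of 1, and this is where (alpha - 1) / 3 in the constant comes from. The
  fluctuation needs a Mellin transform on the imaginary axis, whereas the Dirichlet series that
  evaluates it converges only for Re z > 1. Hence the integral is cut at w = 1 and each half is
  treated by itself, with 1 / w and the limit 1 / 6 split off. As \<open>zeta\<close> is a choice
  among analytic continuations, one continuation has to be constructed as well.\<close>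

no_notation vec_nth (infixl "$" 90)

section \<open>Iterated deletion expressed on the original tree\<close>

text \<open>\<open>erased r t\<close> says that a subtree \<open>t\<close> hanging below a surviving root is deleted within \<open>r\<close>
  applications of \<open>rho\<close>, and \<open>pruned r t\<close> is what they leave of a tree \<open>t\<close> that survives.\<close>

fun erased :: "nat \<Rightarrow> plane_tree \<Rightarrow> bool" where
  "erased 0 t = False"
| "erased (Suc r) (Node ts) \<longleftrightarrow>
     (\<forall>t\<in>set ts. erased (Suc r) t) \<and> length (filter (\<lambda>t. \<not> erased r t) ts) \<le> 1"

fun pruned :: "nat \<Rightarrow> plane_tree \<Rightarrow> plane_tree" where
  "pruned r (Node ts) = Node (map (pruned r) (filter (\<lambda>t. \<not> erased r t) ts))"

lemma erased_Suc: "erased r t \<Longrightarrow> erased (Suc r) t"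
proof (induction r t rule: erased.induct)
  case (2 r ts)
  have a: "\<forall>t\<in>set ts. erased (Suc r) t" using 2 by auto
  hence e: "filter (\<lambda>t. \<not> erased (Suc r) t) ts = []" by (auto simp: filter_empty_conv)
  have "\<forall>t\<in>set ts. erased (Suc (Suc r)) t" using 2 a by auto
  then show ?case using e by simp
qed auto

text \<open>Children dropped from \<open>pruned r t\<close> are erased at stage \<open>Suc r\<close>
  by \<open>erased_Suc\<close>, so the recursion of \<open>erased\<close> and that of
  \<open>is_path\<close> ask the same of the remaining children.\<close>

lemma is_path_pruned: "\<not> erased r t \<Longrightarrow> is_path (pruned r t) \<longleftrightarrow> erased (Suc r) t"
proof (induction r t rule: pruned.induct)
  case (1 r ts)
  have "erased (Suc r) x" if "x \<in> set ts" "erased r x" for x using that erased_Suc by blast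
  moreover have "is_path (pruned r x) \<longleftrightarrow> erased (Suc r) x" if "x \<in> set ts" "\<not> erased r x" for x
    using 1(1) that by auto
  ultimately have "(\<forall>x\<in>set ts. erased r x \<or> is_path (pruned r x)) \<longleftrightarrow> (\<forall>x\<in>set ts. erased (Suc r) x)"
    by blast
  then show ?case by (simp, blast)
qed

lemma delete_paths_pruned: "delete_paths (pruned r t) = pruned (Suc r) t"
proof (induction r t rule: pruned.induct)
  case (1 r ts)
  have f: "filter (\<lambda>t. \<not> is_path (pruned r t)) (filter (\<lambda>t. \<not> erased r t) ts)
     = filter (\<lambda>t. \<not> erased (Suc r) t) ts"
    unfolding filter_filter by (rule filter_cong[OF refl]) (use is_path_pruned erased_Suc in blast)
  have "delete_paths (pruned r (Node ts)) =
    Node (map (\<lambda>t. delete_paths (pruned r t)) (filter (\<lambda>t. \<not> is_path (pruned r t)) (filter (\<lambda>t. \<not> erased r t) ts)))"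
    by (simp add: filter_map comp_def)
  also have "\<dots> = pruned (Suc r) (Node ts)"
  proof -
    have "delete_paths (pruned r x) = pruned (Suc r) x" if "x \<in> set ts" "\<not> erased (Suc r) x" for x
      using 1 that erased_Suc[of r x] by auto
    then show ?thesis unfolding f by simp
  qed
  finally show ?case .
qed

lemma pruned_0: "pruned 0 t = t"
proof (induction "0::nat" t rule: pruned.induct)
  case (1 ts)
  then show ?case by (simp add: map_idI)
qed

text \<open>Replaces the iteration by a property of the original tree, so that a recursion over
  forests is available for every fixed \<open>r\<close>.\<close>

lemma rho_iter_pruned: "rho_iter r t = (if erased r t then None else Some (pruned r t))"
proof (induction r)
  case 0
  then show ?case by (simp add: pruned_0)
next
  case (Suc r)
  then show ?case using erased_Suc[of r t]
    by (auto simp: rho_def is_path_pruned delete_paths_pruned)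
qed

definition tip :: "nat \<Rightarrow> plane_tree \<Rightarrow> bool" where
  "tip r t \<longleftrightarrow> \<not> erased r t \<and> (\<forall>s. t = Node s \<longrightarrow> (\<forall>c\<in>set s. erased r c))"

fun tips :: "nat \<Rightarrow> plane_tree \<Rightarrow> nat" where
  "tips r (Node ts) = of_bool (tip r (Node ts)) + sum_list (map (tips r) ts)"

lemma erased_children: "erased r (Node ts) \<Longrightarrow> c \<in> set ts \<Longrightarrow> erased r c"
  by (cases r) auto

lemma tips_erased: "erased r t \<Longrightarrow> tips r t = 0"
proof (induction r t rule: tips.induct)
  case (1 r ts)
  then show ?case using erased_children[of r ts] by (auto simp: tip_def)
qed

lemma leaves_pruned: "\<not> erased r t \<Longrightarrow> leaves (pruned r t) = tips r t"
proof (induction r t rule: tips.induct)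
  case (1 r ts)
  have s: "(\<Sum>t\<leftarrow>filter (\<lambda>t. \<not> erased r t) ts. leaves (pruned r t)) = (\<Sum>t\<leftarrow>ts. tips r t)"
    using 1(1) by (induction ts) (auto simp: tips_erased)
  show ?case
  proof (cases "\<forall>c\<in>set ts. erased r c")
    case True
    hence "filter (\<lambda>t. \<not> erased r t) ts = []" by (auto simp: filter_empty_conv)
    moreover have "tip r (Node ts)" using True 1(2) by (auto simp: tip_def)
    moreover have "(\<Sum>t\<leftarrow>ts. tips r t) = 0" using True tips_erased by auto
    ultimately show ?thesis by simp
  next
    case False
    hence "filter (\<lambda>t. \<not> erased r t) ts \<noteq> []" by (auto simp: filter_empty_conv)
    moreover have "\<not> tip r (Node ts)" using False by (auto simp: tip_def)
    ultimately show ?thesis using s by (simp add: comp_def)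
  qed
qed

lemma leaves_after_eq: "leaves_after r t = tips r t"
  by (simp add: leaves_after_def rho_iter_pruned tips_erased leaves_pruned)

lemma nodes_pos: "nodes t > 0" by (cases t) auto

text \<open>A tree with at most \<open>r\<close> nodes has children with at most
  \<open>r - 1\<close> nodes, all erased one round earlier. This cuts the series
  \<open>num_paths\<close> off at the size of the tree.\<close>

lemma erased_nodes: "nodes t \<le> r \<Longrightarrow> erased r t"
proof (induction t arbitrary: r rule: nodes.induct)
  case (1 ts)
  then obtain k where k: "r = Suc k" by (cases r) auto
  have le: "(\<Sum>t\<leftarrow>ts. nodes t) \<le> k" using 1(2) k by simp
  have c: "nodes x \<le> k" if "x \<in> set ts" for x
    using le member_le_sum_list[of "nodes x" "map nodes ts"] that by auto
  have "erased k x" "erased (Suc k) x" if "x \<in> set ts" for x using 1(1)[OF that] c[OF that] by auto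
  then show ?case using k by (simp add: filter_empty_conv)
qed

lemma num_paths_eq: "nodes t \<le> R \<Longrightarrow> num_paths t = (\<Sum>r<R. tips r t)"
  unfolding num_paths_def leaves_after_eq
  by (rule suminf_finite) (auto intro!: tips_erased erased_nodes)


section \<open>Generating functions\<close>

definition forests :: "nat \<Rightarrow> plane_tree list set" where
  "forests n = {ts. sum_list (map nodes ts) = n}"

abbreviation trees :: "nat \<Rightarrow> plane_tree set" where
  "trees n \<equiv> {t. nodes t = n}"

lemma trees_0: "trees 0 = {}"
proof -
  have "nodes t \<noteq> 0" for t using nodes_pos[of t] by simp
  then show ?thesis by auto
qed

lemma trees_Suc: "trees (Suc n) = Node ` forests n"
proof -
  have "t \<in> Node ` forests n" if "nodes t = Suc n" for t
    using that by (cases t) (auto simp: forests_def)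
  then show ?thesis by (auto simp: forests_def)
qed

lemma forests_Cons:
  "forests n = (if n = 0 then {[]} else {}) \<union>
     (\<lambda>(i, t, ts). t # ts) ` (SIGMA i:{0..n}. trees i \<times> forests (n - i))"
proof -
  have "ts \<in> (\<lambda>(i, t, ts). t # ts) ` (SIGMA i:{0..n}. trees i \<times> forests (n - i))"
    if A: "ts \<in> forests n" and B: "ts \<noteq> []" for ts
  proof -
    obtain t us where "ts = t # us" using B by (cases ts) auto
    then show ?thesis using A
      by (intro image_eqI[of _ _ "(nodes t, t, us)"]) (auto simp: forests_def)
  qed
  moreover have "[] \<in> forests n \<longleftrightarrow> n = 0" by (auto simp: forests_def)
  ultimately have "ts \<in> (if n = 0 then {[]} else {}) \<union>
     (\<lambda>(i, t, ts). t # ts) ` (SIGMA i:{0..n}. trees i \<times> forests (n - i))" if "ts \<in> forests n" for ts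
    using that by (cases "ts = []") simp_all
  hence "forests n \<subseteq> (if n = 0 then {[]} else {}) \<union>
     (\<lambda>(i, t, ts). t # ts) ` (SIGMA i:{0..n}. trees i \<times> forests (n - i))"
    by (rule subsetI)
  moreover have "(if n = 0 then {[]} else {}) \<union>
     (\<lambda>(i, t, ts). t # ts) ` (SIGMA i:{0..n}. trees i \<times> forests (n - i)) \<subseteq> forests n"
    by (auto simp: forests_def split: if_splits)
  ultimately show ?thesis by (rule subset_antisym)
qed

lemma finite_forests: "finite (forests n)"
proof (induction n rule: less_induct)
  case (less n)
  have t: "finite (trees i)" if "i \<le> n" for i
    using that less by (cases i) (simp_all only: trees_0 trees_Suc finite.emptyI finite_imageI less Suc_le_eq)
  have "finite (trees i \<times> forests (n - i))" if "i \<in> {0..n}" for i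
  proof (cases "i = 0")
    case True
    then show ?thesis by (simp only: trees_0) simp
  next
    case False
    then show ?thesis using that t[of i] less[of "n - i"] by auto
  qed
  hence "finite (SIGMA i:{0..n}. trees i \<times> forests (n - i))"
    by (intro finite_SigmaI[OF finite_atLeastAtMost])
  then show ?case unfolding forests_Cons[of n] by simp
qed

lemma finite_trees: "finite (trees n)"
  by (cases n) (simp_all only: trees_0 trees_Suc finite.emptyI finite_imageI finite_forests)

definition tree_fps :: "(plane_tree \<Rightarrow> real) \<Rightarrow> real fps" where
  "tree_fps w = Abs_fps (\<lambda>n. \<Sum>t\<in>trees n. w t)"

definition forest_fps :: "(plane_tree list \<Rightarrow> real) \<Rightarrow> real fps" where
  "forest_fps w = Abs_fps (\<lambda>n. \<Sum>ts\<in>forests n. w ts)"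

lemma tree_fps_add: "tree_fps (\<lambda>t. v t + w t) = tree_fps v + tree_fps w"
  by (rule fps_ext) (simp add: tree_fps_def sum.distrib)

lemma tree_fps_diff: "tree_fps (\<lambda>t. v t - w t) = tree_fps v - tree_fps w"
  by (rule fps_ext) (simp add: tree_fps_def sum_subtractf)

lemma tree_fps_Node:
  assumes "\<And>ts. w (Node ts) = v ts"
  shows "tree_fps w = fps_X * forest_fps v"
proof (rule fps_ext)
  fix n
  show "tree_fps w $ n = (fps_X * forest_fps v) $ n"
  proof (cases n)
    case 0
    show ?thesis unfolding 0 tree_fps_def fps_nth_Abs_fps trees_0 by simp
  next
    case (Suc k)
    have "inj_on Node (forests k)" by (auto simp: inj_on_def)
    then show ?thesis unfolding tree_fps_def forest_fps_def Suc
      by (simp only: trees_Suc fps_nth_Abs_fps) (simp add: sum.reindex assms)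
  qed
qed

text \<open>Two products serve all weights that occur: multiplicative weights use one of them, while
  additive parameters and the condition of at most one exceptional tree split according to whether
  the first tree carries the contribution.\<close>

lemma forest_fps_Cons:
  assumes "\<And>t ts. w (t # ts) = a t * v ts + b t * z ts"
  shows "forest_fps w = fps_const (w []) + tree_fps a * forest_fps v + tree_fps b * forest_fps z"
proof (rule fps_ext)
  fix n
  let ?S = "SIGMA i:{0..n}. trees i \<times> forests (n - i)"
  have inj: "inj_on (\<lambda>(i, t, ts). t # ts) ?S" by (auto simp: inj_on_def)
  have fin: "finite ?S" by (auto intro!: finite_SigmaI finite_trees finite_forests)
  have prod: "(\<Sum>(i, t, ts)\<in>?S. a t * v ts) = (tree_fps a * forest_fps v) $ n" for a v
    unfolding fps_mult_nth tree_fps_def forest_fps_def fps_nth_Abs_fps sum_product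
    by (subst sum.Sigma[symmetric])
      (auto simp: finite_trees finite_forests sum.cartesian_product split_def)
  have "forest_fps w $ n = (\<Sum>ts\<in>(if n = 0 then {[]} else {}). w ts) +
      (\<Sum>ts\<in>(\<lambda>(i, t, ts). t # ts) ` ?S. w ts)"
    unfolding forest_fps_def fps_nth_Abs_fps
    by (subst forests_Cons, rule sum.union_disjoint) (use fin in auto)
  also have "(\<Sum>ts\<in>(\<lambda>(i, t, ts). t # ts) ` ?S. w ts) =
      (\<Sum>(i, t, ts)\<in>?S. a t * v ts) + (\<Sum>(i, t, ts)\<in>?S. b t * z ts)"
    unfolding sum.reindex[OF inj] sum.distrib[symmetric]
    by (rule sum.cong) (auto simp: assms)
  finally show "forest_fps w $ n = (fps_const (w []) + tree_fps a * forest_fps v +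
      tree_fps b * forest_fps z) $ n"
    unfolding prod by simp
qed

abbreviation erased_fps :: "nat \<Rightarrow> real fps" where
  "erased_fps r \<equiv> tree_fps (\<lambda>t. of_bool (erased r t))"

lemma forest_erased:
  "forest_fps (\<lambda>ts. of_bool (\<forall>t\<in>set ts. erased r t)) * (1 - erased_fps r) = 1"
  using forest_fps_Cons[of "\<lambda>ts. of_bool (\<forall>t\<in>set ts. erased r t)" "\<lambda>t. of_bool (erased r t)"
      "\<lambda>ts. of_bool (\<forall>t\<in>set ts. erased r t)" "\<lambda>_. 0" "\<lambda>_. 0"]
  by (simp add: algebra_simps of_bool_conj tree_fps_def fps_zero_def[symmetric])

text \<open>Among the children, at most one may be newly erased: with V and V' the series for
  \<open>r\<close> and \<open>Suc r\<close>, V' = X (1 / (1 - V) + (V' - V) / (1 - V)^2). The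
  equation is multiplied out to avoid division of power series.\<close>

lemma erased_fps_Suc:
  "(1 - erased_fps (Suc r)) * ((1 - erased_fps r)\<^sup>2 - fps_X) =
     (1 - erased_fps r)\<^sup>2 - 2 * fps_X * (1 - erased_fps r)"
proof -
  define W where "W = (\<lambda>ts. of_bool ((\<forall>t\<in>set ts. erased (Suc r) t) \<and>
      length (filter (\<lambda>t. \<not> erased r t) ts) \<le> 1) :: real)"
  define U where "U = (\<lambda>ts. of_bool (\<forall>t\<in>set ts. erased r t) :: real)"
  have "erased_fps (Suc r) = fps_X * forest_fps W"
    by (rule tree_fps_Node) (simp add: W_def)
  moreover have "forest_fps W = fps_const (W []) + erased_fps r * forest_fps W +
      tree_fps (\<lambda>t. of_bool (erased (Suc r) t) - of_bool (erased r t)) * forest_fps U"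
  proof (rule forest_fps_Cons)
    fix t ts
    have "(length (filter (\<lambda>t. \<not> erased r t) ts) = 0) = (\<forall>t\<in>set ts. erased r t)"
      by (simp add: filter_empty_conv)
    then show "W (t # ts) = of_bool (erased r t) * W ts +
        (of_bool (erased (Suc r) t) - of_bool (erased r t)) * U ts"
      using erased_Suc by (auto simp: W_def U_def)
  qed
  moreover have "W [] = 1" by (simp add: W_def)
  moreover have "forest_fps U * (1 - erased_fps r) = 1" unfolding U_def by (rule forest_erased)
  ultimately have *: "erased_fps (Suc r) = fps_X * F" "F = 1 + erased_fps r * F + (erased_fps (Suc r) - erased_fps r) * G"
     "G * (1 - erased_fps r) = 1" if "F = forest_fps W" "G = forest_fps U" for F G
    using that by (simp_all add: tree_fps_diff)
  define F where "F = forest_fps W"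
  define G where "G = forest_fps U"
  note * = *[OF F_def G_def]
  define V where "V = erased_fps r"
  define V' where "V' = erased_fps (Suc r)"
  note * = *[folded V_def V'_def]
  have "F * (1 - V) = 1 + (V' - V) * G" using *(2) by (simp add: algebra_simps)
  hence "F * (1 - V) * (1 - V) = (1 + (V' - V) * G) * (1 - V)" by simp
  hence "F * (1 - V) * (1 - V) = (1 - V) + (V' - V) * (G * (1 - V))" by (simp add: distrib_right mult.assoc)
  hence "F * (1 - V) * (1 - V) = 1 - V + V' - V" using *(3) by simp
  hence "fps_X * F * (1 - V) * (1 - V) = fps_X * (1 - V + V' - V)" by (simp add: mult.assoc)
  hence "V' * (1 - V)\<^sup>2 = fps_X * (1 - V + V' - V)" using *(1) by (simp add: power2_eq_square mult.assoc)
  then show ?thesis unfolding V_def[symmetric] V'_def[symmetric] by (simp add: algebra_simps)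
qed


lemma fps_pow_mult_nth_0:
  fixes u :: "real fps"
  assumes "u $ 0 = 0" "n < k"
  shows "(u ^ k * f) $ n = 0"
  using assms by (auto simp: fps_mult_nth intro!: sum.neutral startsby_zero_power_prefix[rule_format])

abbreviation tree_gf :: "real fps" where
  "tree_gf \<equiv> tree_fps (\<lambda>_. 1)"

lemma tree_gf_eq: "tree_gf * (1 - tree_gf) = fps_X"
proof -
  have "tree_gf = fps_X * forest_fps (\<lambda>_. 1)" by (rule tree_fps_Node) simp
  moreover have "forest_fps (\<lambda>_. 1) = fps_const 1 + tree_gf * forest_fps (\<lambda>_. 1) + tree_fps (\<lambda>_. 0) * forest_fps (\<lambda>_. 1)"
    by (rule forest_fps_Cons) simp
  hence "forest_fps (\<lambda>_. 1) * (1 - tree_gf) = 1"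
    by (simp add: tree_fps_def fps_zero_def[symmetric] algebra_simps)
  ultimately show ?thesis by (metis mult.assoc mult.right_neutral)
qed

lemma tree_gf_0: "tree_gf $ 0 = 0"
  unfolding tree_fps_def fps_nth_Abs_fps trees_0 by simp

text \<open>The series of nonempty plane forests, since \<open>inverse (1 - tree_gf)\<close> counts
  all forests.\<close>

definition u_fps :: "real fps" where
  "u_fps = tree_gf * inverse (1 - tree_gf)"

lemma u_fps: "(1 + u_fps) * (1 - tree_gf) = 1" "fps_X * (1 + u_fps)\<^sup>2 = u_fps" "u_fps $ 0 = 0"
proof -
  have inv: "inverse (1 - tree_gf) * (1 - tree_gf) = 1"
    by (rule inverse_mult_eq_1) (simp add: tree_gf_0)
  show *: "(1 + u_fps) * (1 - tree_gf) = 1"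
    using inv unfolding u_fps_def by (simp add: algebra_simps)
  have "u_fps = tree_gf * (1 + u_fps)"
    using inv unfolding u_fps_def by algebra
  also have "\<dots> = tree_gf * ((1 + u_fps) * (1 - tree_gf)) * (1 + u_fps)"
    unfolding * by simp
  also have "\<dots> = (tree_gf * (1 - tree_gf)) * (1 + u_fps)\<^sup>2" by (simp add: power2_eq_square mult_ac)
  finally show "fps_X * (1 + u_fps)\<^sup>2 = u_fps" unfolding tree_gf_eq ..
  show "u_fps $ 0 = 0" by (simp add: u_fps_def tree_gf_0)
qed

text \<open>In \<open>u\<close> the quadratic recursion \<open>erased_fps_Suc\<close> amounts to squaring a power of \<open>u\<close>, which is why
  the exponents are \<open>2 ^ (r + 1)\<close> and \<open>2 ^ (r + 1) - 1\<close>.\<close>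

lemma erased_fps_closed:
  defines "u \<equiv> u_fps"
  shows "(1 - erased_fps r) * ((1 + u) * (1 - u ^ (2 ^ Suc r - 1))) = 1 - u ^ 2 ^ Suc r"
proof (induction r)
  case 0
  have "erased_fps 0 = 0" by (simp add: tree_fps_def fps_zero_def)
  then show ?case by (simp add: algebra_simps power2_eq_square)
next
  case (Suc r)
  define x where "x = u ^ (2 ^ Suc r - 1)"
  define Y where "Y = 1 - erased_fps r"
  define Y' where "Y' = 1 - erased_fps (Suc r)"
  have e: "2 ^ Suc r = Suc (2 ^ Suc r - 1)" "2 ^ Suc (Suc r) - 1 = Suc (2 * (2 ^ Suc r - 1))"
    "2 ^ Suc (Suc r) = Suc (Suc (2 * (2 ^ Suc r - 1)))" for r :: nat
    by (cases "2 ^ r :: nat"; simp)+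
  have x1: "u ^ 2 ^ Suc r = u * x" unfolding x_def by (subst e(1)) (rule power_Suc)
  have x2: "u ^ (2 ^ Suc (Suc r) - 1) = u * x\<^sup>2" unfolding x_def
    by (subst e(2)) (simp only: power_Suc power_even_eq)
  have x3: "u ^ 2 ^ Suc (Suc r) = u\<^sup>2 * x\<^sup>2" unfolding x_def
    by (subst e(3)) (simp only: power_Suc power_even_eq power2_eq_square mult.assoc)
  have IH: "Y * ((1 + u) * (1 - x)) = 1 - u * x" using Suc unfolding x1 x_def[symmetric] Y_def .
  have rec: "Y' * (Y\<^sup>2 - fps_X) = Y\<^sup>2 - 2 * fps_X * Y" unfolding Y_def Y'_def by (rule erased_fps_Suc)
  have X: "fps_X * (1 + u)\<^sup>2 = u" unfolding u_def by (rule u_fps)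
  have "Y' * ((1 + u) * (1 - u * x\<^sup>2)) * (1 - u) = (1 - u\<^sup>2 * x\<^sup>2) * (1 - u)"
    using IH rec X by algebra
  moreover have "1 - u \<noteq> 0"
  proof
    assume "1 - u = 0"
    hence "(1 - u) $ 0 = 0" by simp
    then show False using u_fps(3) by (simp add: u_def)
  qed
  ultimately show ?case unfolding x2 x3 Y'_def[symmetric] by simp
qed

text \<open>The trees whose root is a tip have the series B = X / (1 - V) - V: all child subtrees
  are erased, but the tree is not. A tip is either the root or lies in one child subtree between two
  arbitrary forests, so L = B + X L / (1 - T)^2 = B + u L, that is L (1 - u) = B.\<close>

lemma tip_fps:
  defines "u \<equiv> u_fps"
  defines "x \<equiv> \<lambda>r. u ^ (2 ^ Suc r - 1)"
  shows "tree_fps (\<lambda>t. real (tips r t)) * ((1 - x r) * (1 - u * x r)) = x r * (1 - u) * (1 - tree_gf)"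
proof -
  define V where "V = erased_fps r"
  define B where "B = tree_fps (\<lambda>t. of_bool (tip r t))"
  define L where "L = tree_fps (\<lambda>t. real (tips r t))"
  define G where "G = forest_fps (\<lambda>ts. of_bool (\<forall>t\<in>set ts. erased r t))"
  define F where "F = forest_fps (\<lambda>ts. real (\<Sum>t\<leftarrow>ts. tips r t))"
  define E where "E = forest_fps (\<lambda>_. 1)"
  define T where "T = tree_gf"
  define X :: "real fps" where "X = fps_X"
  have E: "E * (1 - T) = 1"
  proof -
    have "E = fps_const 1 + T * E + tree_fps (\<lambda>_. 0) * E"
      unfolding E_def T_def by (rule forest_fps_Cons) simp
    then show ?thesis by (simp add: tree_fps_def fps_zero_def[symmetric] algebra_simps)
  qed
  have "F = fps_const (real (\<Sum>t\<leftarrow>[]. tips r t)) + L * E + T * F"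
    unfolding E_def T_def F_def L_def by (rule forest_fps_Cons) simp
  hence F: "F = L * E + T * F" by simp
  have "L = tree_fps (\<lambda>t. of_bool (tip r t)) + tree_fps (\<lambda>t. real (tips r t) - of_bool (tip r t))"
    unfolding L_def tree_fps_add[symmetric] by simp
  also have "tree_fps (\<lambda>t. real (tips r t) - of_bool (tip r t)) = X * F"
    unfolding F_def X_def by (rule tree_fps_Node) simp
  finally have L: "L = B + X * F" unfolding B_def .
  have "V + B = tree_fps (\<lambda>t. of_bool (erased r t) + of_bool (tip r t))"
    unfolding V_def B_def tree_fps_add ..
  also have "\<dots> = X * G" unfolding G_def X_def
    by (rule tree_fps_Node) (auto simp: tip_def dest: erased_children)
  finally have B: "V + B = X * G" .
  have G: "G * (1 - V) = 1" unfolding G_def V_def by (rule forest_erased)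
  have e: "2 ^ Suc r = Suc (2 ^ Suc r - 1)"
    by (cases "2 ^ r :: nat"; simp)
  define x' where "x' = x r"
  have "u ^ 2 ^ Suc r = u * x'" unfolding x'_def x_def by (subst e(1)) (rule power_Suc)
  with erased_fps_closed[of r] have V: "(1 - V) * ((1 + u) * (1 - x')) = 1 - u * x'"
    unfolding u_def[symmetric] V_def x'_def x_def by simp
  have u: "(1 + u) * (1 - T) = 1" "X * (1 + u)\<^sup>2 = u" "T * (1 - T) = X" unfolding T_def u_def X_def by (rule u_fps tree_gf_eq)+
  have BV: "B * (1 - V) = X - V * (1 - V)" using B G by algebra
  have "B * (1 - u * x') * ((1 + u) * (1 - x')) = x' * (1 - u)\<^sup>2"
    using BV V u(2) by algebra
  moreover have "L * (1 - T) * (1 - T) = B * (1 - T) * (1 - T) + X * L"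
    using F L E by algebra
  hence "L * (1 - u) = B" using u(1,2) by algebra
  ultimately have "(1 - u) * (L * ((1 - x') * (1 - u * x'))) = (1 - u) * (x' * (1 - u) * (1 - T))"
    using u(1) by algebra
  moreover have "1 - u \<noteq> 0"
  proof
    assume "1 - u = 0"
    hence "(1 - u) $ 0 = 0" by simp
    then show False using u_fps(3) by (simp add: u_def)
  qed
  ultimately show ?thesis unfolding L_def x'_def T_def by simp
qed

section \<open>Ballot numbers as coefficients, and the exact expectation\<close>

definition ballot :: "nat \<Rightarrow> nat \<Rightarrow> real" where
  "ballot N k = real ((2 * N) choose (N + k - 1)) - real ((2 * N) choose (N + k))"

lemma choose_Suc_Suc: "Suc (Suc n) choose Suc (Suc k) = (n choose k) + 2 * (n choose Suc k) + (n choose Suc (Suc k))"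
  by simp

lemma u_fps_rec: "fps_X * (u_fps ^ k + 2 * u_fps ^ Suc k + u_fps ^ Suc (Suc k)) = u_fps ^ Suc k"
proof -
  have "u_fps ^ Suc k = (fps_X * (1 + u_fps)\<^sup>2) * u_fps ^ k" unfolding u_fps by simp
  then show ?thesis by (simp add: algebra_simps power2_eq_square)
qed

text \<open>By \<open>u_fps_rec\<close> a coefficient arises from three coefficients of the previous
  index with the weights 1, 2, 1, and Pascal's rule applied twice gives binomial coefficients the
  same recursion.\<close>

lemma u_fps_coeff: "(u_fps ^ Suc k * (1 - tree_gf)) $ Suc N = ballot N (Suc k)"
proof (induction N arbitrary: k)
  case 0
  have "(u_fps ^ Suc k * (1 - tree_gf)) $ Suc 0 =
     ((u_fps ^ k + 2 * u_fps ^ Suc k + u_fps ^ Suc (Suc k)) * (1 - tree_gf)) $ 0"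
    by (subst u_fps_rec[of k, symmetric]) (simp add: mult.assoc del: power_Suc)
  also have "\<dots> = of_bool (k = 0)"
    by (cases k) (simp_all add: u_fps tree_gf_0 fps_mult_nth_0)
  finally show ?case by (auto simp: ballot_def)
next
  case (Suc N)
  let ?g = "\<lambda>k n. (u_fps ^ k * (1 - tree_gf)) $ n"
  have "?g (Suc k) (Suc (Suc N)) =
     ((u_fps ^ k + 2 * u_fps ^ Suc k + u_fps ^ Suc (Suc k)) * (1 - tree_gf)) $ Suc N"
    by (subst u_fps_rec[of k, symmetric]) (simp add: mult.assoc del: power_Suc)
  also have "\<dots> = ?g k (Suc N) + 2 * ?g (Suc k) (Suc N) + ?g (Suc (Suc k)) (Suc N)"
    by (simp only: mult_2 distrib_right fps_add_nth)
  also have "\<dots> = ballot (Suc N) (Suc k)"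
  proof (cases k)
    case 0
    \<comment> \<open>At exponent 0 the series is \<open>1 - u_fps * (1 - tree_gf)\<close>, so its
      coefficient is minus that of exponent 1. On the binomial side the same reflection is the
      symmetry of the two middle coefficients.\<close>
    have "(1 - tree_gf) + u_fps * (1 - tree_gf) = 1" using u_fps(1) by (simp add: algebra_simps)
    hence "((1 - tree_gf) + u_fps * (1 - tree_gf)) $ Suc N = (1 :: real fps) $ Suc N" by (rule arg_cong)
    hence "?g 0 (Suc N) = - ?g (Suc 0) (Suc N)" by simp
    moreover have "Suc (2 * N) - N = Suc N" by simp
    hence "Suc (2 * N) choose N = Suc (2 * N) choose Suc N"
      using binomial_symmetric[of N "Suc (2 * N)"] by simp
    ultimately show ?thesis unfolding Suc 0
      by (simp add: ballot_def choose_Suc_Suc)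
  next
    case (Suc j)
    show ?thesis unfolding Suc Suc.IH
      by (simp add: ballot_def choose_Suc_Suc)
  qed
  finally show ?case .
qed

text \<open>Partial fractions: with x = u^m, x (1 - u) / ((1 - x) (1 - u x)) = 1 / (1 - x) - 1 / (1
  - u x), so \<open>tip_fps\<close> amounts to a difference of two geometric series in powers of
  \<open>u\<close>. Cutting them after \<open>J\<close> terms changes only multiples of
  \<open>u ^ Suc J\<close>, which do not reach the coefficient of index
  \<open>Suc N\<close>.\<close>

lemma tips_sum:
  assumes "Suc N \<le> J"
  shows "(\<Sum>t\<in>trees (Suc N). real (tips r t)) =
    (\<Sum>j=1..J. ballot N (j * (2 ^ Suc r - 1)) - ballot N (j * 2 ^ Suc r))"
proof -
  define m :: nat where "m = 2 ^ Suc r - 1"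
  have m: "2 ^ Suc r = Suc m" "m \<ge> 1" unfolding m_def by (cases "2 ^ r :: nat"; simp)+
  define u where "u = u_fps"
  define x where "x = u ^ m"
  define L where "L = tree_fps (\<lambda>t. real (tips r t))"
  define M where "M = (\<Sum>j=1..J. x ^ j - (u * x) ^ j)"
  define D where "D = (1 - x) * (1 - u * x)"
  have u0: "u $ 0 = 0" unfolding u_def by (rule u_fps)
  have x0: "x $ 0 = 0" unfolding x_def using u0 m by simp
  have g: "(1 - y) * (\<Sum>j=1..J. y ^ j) = y - y ^ Suc J" for y :: "real fps"
    by (induction J) (simp_all add: distrib_left, simp_all add: left_diff_distrib)
  have "M * D = (1 - u * x) * ((1 - x) * (\<Sum>j=1..J. x ^ j))
     - (1 - x) * ((1 - u * x) * (\<Sum>j=1..J. (u * x) ^ j))"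
    unfolding M_def D_def sum_subtractf by (simp add: algebra_simps)
  also have "\<dots> = x * (1 - u) - u ^ Suc J * (u ^ (m - 1)) ^ Suc J * ((1 - u * x) - u ^ Suc J * (1 - x))"
  proof -
    have "x ^ Suc J = u ^ Suc J * (u ^ (m - 1)) ^ Suc J"
      unfolding x_def power_mult_distrib[symmetric] using m(2)
      by (metis power_Suc Suc_diff_le diff_Suc_1 One_nat_def)
    moreover from this have "(u * x) ^ Suc J = u ^ Suc J * (u ^ Suc J * (u ^ (m - 1)) ^ Suc J)"
      by (simp only: power_mult_distrib)
    moreover have "(1 - u * x) * (x - a * p) - (1 - x) * (u * x - a * (a * p)) =
        x * (1 - u) - a * p * ((1 - u * x) - a * (1 - x))" for a p
      by (simp add: algebra_simps)
    ultimately show ?thesis unfolding g by (simp only:)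
  qed
  finally have MD: "M * D = x * (1 - u) - u ^ Suc J * ((u ^ (m - 1)) ^ Suc J * ((1 - u * x) - u ^ Suc J * (1 - x)))"
    by (simp only: mult.assoc)
  have LD: "L * D = x * (1 - u) * (1 - tree_gf)"
    using tip_fps[of r] unfolding L_def D_def x_def m_def u_def .
  have "(L - M * (1 - tree_gf)) * D =
    u ^ Suc J * ((u ^ (m - 1)) ^ Suc J * ((1 - u * x) - u ^ Suc J * (1 - x)) * (1 - tree_gf))"
  proof -
    have "(L - M * (1 - tree_gf)) * D = L * D - (M * D) * (1 - tree_gf)"
      by (simp only: algebra_simps)
    moreover have "a * c - (a - p * q) * c = p * (q * c)" for a c p q :: "real fps"
      by (simp add: algebra_simps)
    ultimately show ?thesis unfolding LD MD by (simp only:)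
  qed
  moreover have "D * inverse D = 1" unfolding D_def
    by (rule inverse_mult_eq_1') (simp add: x0)
  moreover have "A * D * inverse D = A" if "D * inverse D = 1" for A
    using that by (simp only: mult.assoc mult.right_neutral)
  ultimately have "L - M * (1 - tree_gf) =
    u ^ Suc J * ((u ^ (m - 1)) ^ Suc J * ((1 - u * x) - u ^ Suc J * (1 - x)) * (1 - tree_gf)) * inverse D"
    by metis
  hence "L - M * (1 - tree_gf) =
    u ^ Suc J * ((u ^ (m - 1)) ^ Suc J * ((1 - u * x) - u ^ Suc J * (1 - x)) * (1 - tree_gf) * inverse D)"
    by (simp only: mult.assoc)
  hence "(L - M * (1 - tree_gf)) $ Suc N = 0"
    using fps_pow_mult_nth_0[OF u0, of "Suc N" "Suc J"] assms by simp
  moreover have "M * (1 - tree_gf) = (\<Sum>j=1..J. u ^ (j * m) * (1 - tree_gf) - u ^ (j * Suc m) * (1 - tree_gf))"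
  proof -
    have "(x ^ j - (u * x) ^ j) * (1 - tree_gf) = u ^ (j * m) * (1 - tree_gf) - u ^ (j * Suc m) * (1 - tree_gf)" for j
    proof -
      have "u * x = u ^ Suc m" by (simp add: x_def)
      hence "(u * x) ^ j = u ^ (j * Suc m)" by (simp only: power_mult[symmetric] mult.commute)
      moreover have "x ^ j = u ^ (j * m)" by (simp only: x_def power_mult[symmetric] mult.commute)
      ultimately show ?thesis by (simp only: left_diff_distrib)
    qed
    then show ?thesis unfolding M_def sum_distrib_right by (simp only:)
  qed
  ultimately have "L $ Suc N = (\<Sum>j=1..J. (u ^ (j * m) * (1 - tree_gf)) $ Suc N - (u ^ (j * Suc m) * (1 - tree_gf)) $ Suc N)"
    by (simp only: fps_sub_nth fps_sum_nth eq_iff_diff_eq_0[symmetric])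
  also have "\<dots> = (\<Sum>j=1..J. ballot N (j * m) - ballot N (j * Suc m))"
  proof -
    have "(u ^ k * (1 - tree_gf)) $ Suc N = ballot N k" if "k \<ge> 1" for k
      using that u_fps_coeff[of "k - 1" N] unfolding u_def by (cases k) simp_all
    then show ?thesis using m(2) by (intro sum.cong) auto
  qed
  finally show ?thesis unfolding m(1) by (simp add: L_def tree_fps_def)
qed

lemma ballot_1: "ballot N 1 = real ((2 * N) choose N) / real (Suc N)"
proof -
  have "Suc N * ((2 * N) choose Suc N) = N * ((2 * N) choose N)"
    using binomial_absorption[of N "2 * N"] binomial_absorb_comp[of "2 * N" N]
    by (cases N) (simp_all add: mult_2 del: mult_Suc mult_Suc_right)
  hence "real (Suc N) * real ((2 * N) choose Suc N) = real N * real ((2 * N) choose N)"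
    unfolding of_nat_mult[symmetric] by (rule arg_cong)
  then show ?thesis by (simp add: ballot_def field_simps)
qed

lemma card_trees: "real (card (trees (Suc N))) = real ((2 * N) choose N) / real (Suc N)"
proof -
  have "u_fps * (1 - tree_gf) = tree_gf" using u_fps(1) by algebra
  hence "tree_gf $ Suc N = ballot N 1" using u_fps_coeff[of 0 N] by simp
  then show ?thesis unfolding ballot_1 by (simp add: tree_fps_def)
qed

text \<open>The divisor is the central binomial coefficient, which is \<open>n\<close> times the
  number of trees of size \<open>n\<close>. Hence the factor \<open>real n\<close> in
  \<open>expected_paths_sums\<close> and the total mass 1 in
  \<open>ballot_ratio_sum\<close>.\<close>

definition ballot_ratio :: "nat \<Rightarrow> nat \<Rightarrow> real" where
  "ballot_ratio n k = ballot (n - 1) k / real ((2 * (n - 1)) choose (n - 1))"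

lemma ballot_eq_0: "k > Suc N \<Longrightarrow> ballot N k = 0"
  by (simp add: ballot_def binomial_eq_0)

lemma ballot_ratio_eq_0: "k > n \<Longrightarrow> n > 0 \<Longrightarrow> ballot_ratio n k = 0"
  by (simp add: ballot_ratio_def ballot_eq_0)

lemma expected_paths_sums:
  assumes n: "n > 0"
  shows "(\<lambda>r. real n * ((\<Sum>j. ballot_ratio n (Suc j * (2 ^ Suc r - 1))) - (\<Sum>j. ballot_ratio n (Suc j * 2 ^ Suc r))))
     sums expected_paths n"
proof -
  obtain N where N: "n = Suc N" using n by (cases n) auto
  define C where "C = real ((2 * N) choose N)"
  have C: "C > 0" unfolding C_def by simp
  have card: "real (card (trees n)) = C / real n" unfolding C_def N by (rule card_trees)
  hence "card (trees n) \<noteq> 0" using C n by (intro notI) simp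
  hence ne: "trees n \<noteq> {}" by (metis card.empty)
  have s: "(\<Sum>j. ballot_ratio n (Suc j * m)) = (\<Sum>j=1..n. ballot N (j * m)) / C" if "m \<ge> 1" for m
  proof -
    have "(\<Sum>j. ballot_ratio n (Suc j * m)) = (\<Sum>j<n. ballot_ratio n (Suc j * m))"
    proof (rule suminf_finite)
      fix j assume "j \<notin> {..<n}"
      hence "Suc j * m \<ge> Suc n * 1" using that by (intro mult_le_mono) auto
      then show "ballot_ratio n (Suc j * m) = 0" using n by (intro ballot_ratio_eq_0) auto
    qed simp
    also have "\<dots> = (\<Sum>j=1..n. ballot_ratio n (j * m))"
      by (rule sum.reindex_bij_witness[of _ "\<lambda>j. j - 1" Suc]) auto
    finally show ?thesis by (simp only: ballot_ratio_def N C_def diff_Suc_1 sum_divide_distrib)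
  qed
  have t: "real n * ((\<Sum>j. ballot_ratio n (Suc j * (2 ^ Suc r - 1))) - (\<Sum>j. ballot_ratio n (Suc j * 2 ^ Suc r)))
     = (\<Sum>t\<in>trees n. real (tips r t)) / (C / real n)" for r
  proof -
    have "(1::nat) \<le> 2 ^ Suc r - 1" by (cases "2 ^ r :: nat"; simp)
    note s1 = s[OF this]
    have s2: "(\<Sum>j. ballot_ratio n (Suc j * 2 ^ Suc r)) = (\<Sum>j=1..n. ballot N (j * 2 ^ Suc r)) / C"
      by (rule s) simp
    have "(\<Sum>j. ballot_ratio n (Suc j * (2 ^ Suc r - 1))) - (\<Sum>j. ballot_ratio n (Suc j * 2 ^ Suc r)) =
       (\<Sum>j=1..n. ballot N (j * (2 ^ Suc r - 1)) - ballot N (j * 2 ^ Suc r)) / C"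
      by (simp only: s1 s2 sum_subtractf diff_divide_distrib)
    also have "\<dots> = (\<Sum>t\<in>trees n. real (tips r t)) / C"
      using tips_sum[of N n r] N by simp
    finally show ?thesis by simp
  qed
  have z: "(\<Sum>t\<in>trees n. real (tips r t)) = 0" if "r \<ge> n" for r
    using that by (intro sum.neutral) (auto intro!: tips_erased erased_nodes)
  have "expected_paths n = (\<Sum>t\<in>trees n. real (num_paths t)) / (C / real n)"
    unfolding expected_paths_def card[symmetric]
    by (rule integral_pmf_of_set[OF ne finite_trees])
  also have "(\<Sum>t\<in>trees n. real (num_paths t)) = (\<Sum>t\<in>trees n. \<Sum>r<n. real (tips r t))"
    by (rule sum.cong) (auto simp: num_paths_eq[of _ n])
  also have "\<dots> = (\<Sum>r<n. \<Sum>t\<in>trees n. real (tips r t))" by (rule sum.swap)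
  also have "\<dots> / (C / real n) = (\<Sum>r<n. (\<Sum>t\<in>trees n. real (tips r t)) / (C / real n))"
    by (rule sum_divide_distrib)
  finally have e: "expected_paths n = (\<Sum>r<n. (\<Sum>t\<in>trees n. real (tips r t)) / (C / real n))" .
  show ?thesis unfolding t e by (rule sums_finite) (auto simp: z)
qed

section \<open>Gaussian sums\<close>

text \<open>All functions to be summed have this form. It is preserved by differentiation and by
  multiplication with powers of \<open>u\<close>, so one decay bound and one summation formula cover
  them.\<close>

definition poly_gauss :: "real poly \<Rightarrow> real \<Rightarrow> real" where
  "poly_gauss p u = poly p u * exp (- u\<^sup>2)"

definition gauss_dpoly :: "real poly \<Rightarrow> real poly" where
  "gauss_dpoly p = pderiv p - [:0, 2:] * p"

lemma poly_gauss_deriv: "(poly_gauss p has_real_derivative poly_gauss (gauss_dpoly p) u) (at u)"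
  unfolding poly_gauss_def[abs_def] gauss_dpoly_def
  by (auto intro!: derivative_eq_intros poly_DERIV simp: algebra_simps)

lemma poly_gauss_deriv' [derivative_intros]:
  "(f has_real_derivative f') (at x within A) \<Longrightarrow>
    ((\<lambda>x. poly_gauss p (f x)) has_real_derivative poly_gauss (gauss_dpoly p) (f x) * f') (at x within A)"
  by (rule DERIV_chain2[OF poly_gauss_deriv])

lemma poly_gauss_bounded:
  shows "\<exists>C\<ge>0. \<forall>u\<ge>0. \<bar>poly_gauss p u\<bar> \<le> C"
proof -
  have mono: "u ^ k * exp (- u\<^sup>2) \<le> 1 + fact k" if u: "u \<ge> 0" for u :: real and k
  proof -
    \<comment> \<open>With the even power on the right, a single term of the series of
      \<open>exp (u\<^sup>2)\<close> suffices; this is where the factorial comes from.\<close>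
    have "u ^ k \<le> 1 + (u\<^sup>2) ^ k"
    proof (cases "u \<le> 1")
      case True
      then show ?thesis using u by (simp add: add_increasing2 power_le_one)
    next
      case False
      then have "u ^ k \<le> u ^ (2 * k)" by (intro power_increasing) auto
      then show ?thesis by (simp add: power_mult)
    qed
    also have "(u\<^sup>2) ^ k / fact k \<le> exp (u\<^sup>2)"
    proof -
      have "(\<Sum>i\<in>{k}. inverse (fact i) * (u\<^sup>2) ^ i) \<le> (\<Sum>i. inverse (fact i) * (u\<^sup>2) ^ i)"
        by (rule sum_le_suminf) (auto intro: summable_exp)
      then show ?thesis by (simp add: exp_def scaleR_conv_of_real divide_inverse mult.commute)
    qed
    hence "1 + (u\<^sup>2) ^ k \<le> 1 + fact k * exp (u\<^sup>2)" by (simp add: field_simps)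
    also have "\<dots> \<le> (1 + fact k) * exp (u\<^sup>2)" by (simp add: distrib_right)
    finally show ?thesis by (simp add: exp_minus field_simps)
  qed
  let ?C = "\<Sum>i\<le>degree p. \<bar>coeff p i\<bar> * (1 + fact i)"
  have "\<bar>poly_gauss p u\<bar> \<le> ?C" if "u \<ge> 0" for u
  proof -
    have "\<bar>poly_gauss p u\<bar> = \<bar>\<Sum>i\<le>degree p. coeff p i * (u ^ i * exp (- u\<^sup>2))\<bar>"
      by (simp add: poly_gauss_def poly_altdef sum_distrib_right mult.assoc)
    also have "\<dots> \<le> (\<Sum>i\<le>degree p. \<bar>coeff p i * (u ^ i * exp (- u\<^sup>2))\<bar>)" by (rule sum_abs)
    also have "\<dots> \<le> ?C"
      using that mono by (intro sum_mono) (auto simp: abs_mult intro!: mult_left_mono)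
    finally show ?thesis .
  qed
  moreover have "?C \<ge> 0" by (intro sum_nonneg) simp
  ultimately show ?thesis by blast
qed

text \<open>The factor \<open>(1 + u) ^ q\<close> is absorbed into the polynomial, so boundedness
  already yields decay of any order.\<close>

lemma poly_gauss_bound:
  shows "\<exists>C\<ge>0. \<forall>u\<ge>0. \<bar>poly_gauss p u\<bar> \<le> C / (1 + u) ^ q"
proof -
  obtain C where C: "C \<ge> 0" "\<And>u. u \<ge> 0 \<Longrightarrow> \<bar>poly_gauss ([:1, 1:] ^ q * p) u\<bar> \<le> C"
    using poly_gauss_bounded[of "[:1, 1:] ^ q * p"] by auto
  have "\<bar>poly_gauss p u\<bar> \<le> C / (1 + u) ^ q" if "u \<ge> 0" for u
    using C(2)[OF that] that by (simp add: poly_gauss_def field_simps poly_power abs_mult)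
  with C(1) show ?thesis by blast
qed

text \<open>Taylor expansions of orders 4, 3 and 2 for the antiderivative and its first two
  derivatives: everything below fourth order cancels, and the remainders carry the coefficients
  1/24, 1/12 and 1/24, which add up to 1/6. Phrased with an antiderivative \<open>P\<close>, the
  formula contains no integral.\<close>

lemma euler_maclaurin_interval:
  fixes s a :: real
  assumes s: "s > 0"
  assumes M: "\<And>t. a \<le> t \<Longrightarrow> t \<le> a + s \<Longrightarrow> \<bar>poly_gauss (gauss_dpoly (gauss_dpoly (gauss_dpoly (gauss_dpoly P)))) t\<bar> \<le> M"
  shows "\<bar>s / 2 * (poly_gauss (gauss_dpoly P) a + poly_gauss (gauss_dpoly P) (a + s)) - (poly_gauss P (a + s) - poly_gauss P a)
     - s\<^sup>2 / 12 * (poly_gauss (gauss_dpoly (gauss_dpoly P)) (a + s) - poly_gauss (gauss_dpoly (gauss_dpoly P)) a)\<bar> \<le> M * s ^ 4 / 6"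
proof -
  define d where "d = (\<lambda>m. poly_gauss ((gauss_dpoly ^^ m) P))"
  have d: "d 0 = poly_gauss P" "d 1 = poly_gauss (gauss_dpoly P)" "d 2 = poly_gauss (gauss_dpoly (gauss_dpoly P))" "d 4 = poly_gauss (gauss_dpoly (gauss_dpoly (gauss_dpoly (gauss_dpoly P))))"
    unfolding d_def by (simp_all add: eval_nat_numeral)
  have der: "(d m has_real_derivative d (Suc m) t) (at t)" for m t
    unfolding d_def by (simp add: poly_gauss_deriv)
  have tay: "\<exists>t. a < t \<and> t < a + s \<and> d i (a + s) = (\<Sum>m<n. d (i + m) a / fact m * s ^ m) + d (i + n) t / fact n * s ^ n"
    if "n > 0" for i n
  proof -
    have "\<exists>t>a. t < a + s \<and> d i (a + s) = (\<Sum>m<n. d (i + m) a / fact m * (a + s - a) ^ m) + d (i + n) t / fact n * (a + s - a) ^ n"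
      by (rule Taylor_up[where a = a]) (use that s der in auto)
    then show ?thesis by simp
  qed
  obtain t0 where t0: "a < t0" "t0 < a + s" "d 0 (a + s) = d 0 a + d 1 a * s + d 2 a * s\<^sup>2 / 2 + d 3 a * s ^ 3 / 6 + d 4 t0 * s ^ 4 / 24"
    using tay[of 4 0] by (auto simp: eval_nat_numeral)
  obtain t1 where t1: "a < t1" "t1 < a + s" "d 1 (a + s) = d 1 a + d 2 a * s + d 3 a * s\<^sup>2 / 2 + d 4 t1 * s ^ 3 / 6"
    using tay[of 3 1] by (auto simp: eval_nat_numeral)
  obtain t2 where t2: "a < t2" "t2 < a + s" "d 2 (a + s) = d 2 a + d 3 a * s + d 4 t2 * s\<^sup>2 / 2"
    using tay[of 2 2] by (auto simp: eval_nat_numeral)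
  have b: "\<bar>d 4 t0\<bar> \<le> M" "\<bar>d 4 t1\<bar> \<le> M" "\<bar>d 4 t2\<bar> \<le> M"
    unfolding d by (rule M; use t0 t1 t2 in simp)+
  have "s / 2 * (d 1 a + d 1 (a + s)) - (d 0 (a + s) - d 0 a) - s\<^sup>2 / 12 * (d 2 (a + s) - d 2 a)
    = (d 4 t1 / 12 - d 4 t0 / 24 - d 4 t2 / 24) * s ^ 4"
    unfolding t0(3) t1(3) t2(3) by (simp add: field_simps eval_nat_numeral)
  also have "\<bar>\<dots>\<bar> \<le> (M / 6) * s ^ 4"
  proof -
    have "\<bar>d 4 t1 / 12 - d 4 t0 / 24 - d 4 t2 / 24\<bar> \<le> M / 6"
      using b unfolding abs_le_iff by linarith
    then show ?thesis unfolding abs_mult using s by (simp add: mult_right_mono)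
  qed
  finally show ?thesis unfolding d by simp
qed

lemma inverse_squares_summable: "summable (\<lambda>j. inverse (real (Suc j) ^ 2))"
  using inverse_power_summable[of 2, where 'a = real]
  by (subst summable_Suc_iff[of "\<lambda>j. inverse (real j ^ 2)"]) simp

text \<open>The power \<open>i\<close> records how often a sum over the multiples of
  \<open>x\<close> has been differentiated in \<open>x\<close>: each derivative brings a factor
  \<open>Suc j\<close> by the chain rule.\<close>

definition gsum :: "nat \<Rightarrow> real poly \<Rightarrow> real \<Rightarrow> real" where
  "gsum i p x = (\<Sum>j. real (Suc j) ^ i * poly_gauss p (real (Suc j) * x))"

lemma gsum_term_bound:
  assumes "q \<ge> i + 2"
  shows "\<exists>C\<ge>0. \<forall>x>0. \<forall>j. \<bar>real (Suc j) ^ i * poly_gauss p (real (Suc j) * x)\<bar> \<le> C / x ^ q * inverse (real (Suc j) ^ 2)"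
proof -
  obtain C where C: "C \<ge> 0" "\<And>u. u \<ge> 0 \<Longrightarrow> \<bar>poly_gauss p u\<bar> \<le> C / (1 + u) ^ q"
    using poly_gauss_bound[of p q] by auto
  have "\<bar>real (Suc j) ^ i * poly_gauss p (real (Suc j) * x)\<bar> \<le> C / x ^ q * inverse (real (Suc j) ^ 2)"
    if x: "x > 0" for x j
  proof -
    define k where "k = real (Suc j)"
    have k: "k \<ge> 1" unfolding k_def by simp
    have "\<bar>poly_gauss p (k * x)\<bar> \<le> C / (1 + k * x) ^ q" using C(2)[of "k * x"] x k by simp
    also have "\<dots> \<le> C / (k * x) ^ q"
      using x k C(1) by (intro divide_left_mono power_mono mult_pos_pos) (auto intro!: zero_less_power add_pos_pos)
    finally have "k ^ i * \<bar>poly_gauss p (k * x)\<bar> \<le> k ^ i * (C / (k * x) ^ q)"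
      using k by (intro mult_left_mono) auto
    hence "\<bar>k ^ i * poly_gauss p (k * x)\<bar> \<le> k ^ i * (C / (k * x) ^ q)"
      using k by (simp only: abs_mult) simp
    also have "\<dots> = C / x ^ q * (k ^ i / k ^ q)" using x k by (simp add: power_mult_distrib field_simps)
    also have "\<dots> \<le> C / x ^ q * inverse (k ^ 2)"
    proof (intro mult_left_mono)
      have "k ^ i * k ^ 2 \<le> k ^ q" unfolding power_add[symmetric] using assms k by (intro power_increasing) auto
      then show "k ^ i / k ^ q \<le> inverse (k ^ 2)" using k by (simp add: field_simps)
    qed (use C(1) x in auto)
    finally show ?thesis unfolding k_def .
  qed
  with C(1) show ?thesis by blast
qed

lemma gsum_summable:
  assumes "x > 0"
  shows "summable (\<lambda>j. real (Suc j) ^ i * poly_gauss p (real (Suc j) * x))"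
proof -
  obtain C where "\<forall>x>0. \<forall>j. \<bar>real (Suc j) ^ i * poly_gauss p (real (Suc j) * x)\<bar> \<le> C / x ^ (i + 2) * inverse (real (Suc j) ^ 2)"
    using gsum_term_bound[of i "i + 2" p] by auto
  then show ?thesis using assms
    by (intro summable_comparison_test'[OF summable_mult[OF inverse_squares_summable], of 0 _ "C / x ^ (i + 2)"])
      (unfold real_norm_def, blast)
qed

lemma gsum_bound:
  assumes "q \<ge> i + 2"
  shows "\<exists>C\<ge>0. \<forall>x>0. \<bar>gsum i p x\<bar> \<le> C / x ^ q"
proof -
  obtain C where C: "C \<ge> 0" "\<forall>x>0. \<forall>j. \<bar>real (Suc j) ^ i * poly_gauss p (real (Suc j) * x)\<bar> \<le> C / x ^ q * inverse (real (Suc j) ^ 2)"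
    using gsum_term_bound[OF assms, of p] by auto
  let ?Z = "\<Sum>j. inverse (real (Suc j) ^ 2)"
  have Z: "?Z \<ge> 0" by (rule suminf_nonneg[OF inverse_squares_summable]) simp
  have "\<bar>gsum i p x\<bar> \<le> C * ?Z / x ^ q" if x: "x > 0" for x
  proof -
    have "\<bar>gsum i p x\<bar> \<le> (\<Sum>j. C / x ^ q * inverse (real (Suc j) ^ 2))"
      unfolding gsum_def using C(2) x inverse_squares_summable
      by (intro norm_suminf_le[where 'a = real, unfolded real_norm_def]) (auto intro!: summable_mult)
    also have "\<dots> = C / x ^ q * ?Z" by (rule suminf_mult[OF inverse_squares_summable])
    finally show ?thesis by simp
  qed
  with C(1) Z show ?thesis by (intro exI[of _ "C * ?Z"]) auto
qed

lemma gsum_deriv: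
  assumes x: "x > 0"
  shows "(gsum i p has_real_derivative gsum (Suc i) (gauss_dpoly p) x) (at x)"
proof -
  obtain C where C: "\<forall>x>0. \<forall>j. \<bar>real (Suc j) ^ Suc i * poly_gauss (gauss_dpoly p) (real (Suc j) * x)\<bar> \<le> C / x ^ (Suc i + 2) * inverse (real (Suc j) ^ 2)"
    "C \<ge> 0"
    using gsum_term_bound[of "Suc i" "Suc i + 2" "gauss_dpoly p"] by auto
  have u: "uniformly_convergent_on {x/2<..} (\<lambda>n y. \<Sum>j<n. real (Suc j) ^ Suc i * poly_gauss (gauss_dpoly p) (real (Suc j) * y))"
  proof (rule Weierstrass_m_test')
    fix j y assume y: "y \<in> {x/2<..}"
    have "\<bar>real (Suc j) ^ Suc i * poly_gauss (gauss_dpoly p) (real (Suc j) * y)\<bar> \<le> C / y ^ (Suc i + 2) * inverse (real (Suc j) ^ 2)"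
      using C x y by auto
    also have "\<dots> \<le> C / (x/2) ^ (Suc i + 2) * inverse (real (Suc j) ^ 2)"
      using C(2) x y by (intro mult_right_mono divide_left_mono power_mono mult_pos_pos) (auto intro!: zero_less_power)
    finally show "norm (real (Suc j) ^ Suc i * poly_gauss (gauss_dpoly p) (real (Suc j) * y)) \<le> C / (x/2) ^ (Suc i + 2) * inverse (real (Suc j) ^ 2)"
      by simp
  qed (intro summable_mult inverse_squares_summable)
  have "((\<lambda>y. \<Sum>j. real (Suc j) ^ i * poly_gauss p (real (Suc j) * y)) has_field_derivative
      (\<Sum>j. real (Suc j) ^ Suc i * poly_gauss (gauss_dpoly p) (real (Suc j) * x))) (at x)"
  proof (rule has_field_derivative_series'(2)[OF _ _ u])
    show "summable (\<lambda>j. real (Suc j) ^ i * poly_gauss p (real (Suc j) * x))" by (rule gsum_summable[OF x])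
    show "x \<in> {x/2<..}" "x \<in> interior {x/2<..}" using x by (auto simp: interior_open)
    fix j y assume "y \<in> {x/2<..}"
    show "((\<lambda>y. real (Suc j) ^ i * poly_gauss p (real (Suc j) * y)) has_field_derivative
       real (Suc j) ^ Suc i * poly_gauss (gauss_dpoly p) (real (Suc j) * y)) (at y within {x/2<..})"
      by (auto intro!: derivative_eq_intros)
  qed simp
  then show ?thesis unfolding gsum_def[abs_def] .
qed

lemma gsum_shift: "x ^ i * gsum i p x = gsum 0 ([:0, 1:] ^ i * p) x" if "x > 0"
  unfolding gsum_def suminf_mult[OF gsum_summable[OF that], symmetric]
  by (intro suminf_cong) (simp add: poly_gauss_def poly_power power_mult_distrib)

text \<open>Summed over the intervals from j x to (j + 1) x, the increments of the antiderivative
  and those of its second derivative telescope, and the trapezoids count the point 0 with weight one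
  half. The remainders, of order x^4 / (1 + j x)^2, add up to O(x^3).\<close>

lemma gsum_euler_maclaurin:
  "\<exists>C\<ge>0. \<forall>x>0. x \<le> 1 \<longrightarrow> \<bar>x * gsum 0 (gauss_dpoly P) x + poly_gauss P 0 + x / 2 * poly_gauss (gauss_dpoly P) 0 + x\<^sup>2 / 12 * poly_gauss (gauss_dpoly (gauss_dpoly P)) 0\<bar> \<le> C * x ^ 3"
proof -
  obtain C where C: "C \<ge> 0" "\<And>u. u \<ge> 0 \<Longrightarrow> \<bar>poly_gauss (gauss_dpoly (gauss_dpoly (gauss_dpoly (gauss_dpoly P)))) u\<bar> \<le> C / (1 + u) ^ 2"
    using poly_gauss_bound[of "gauss_dpoly (gauss_dpoly (gauss_dpoly (gauss_dpoly P)))" 2] by auto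
  have "\<bar>x * gsum 0 (gauss_dpoly P) x + poly_gauss P 0 + x / 2 * poly_gauss (gauss_dpoly P) 0 + x\<^sup>2 / 12 * poly_gauss (gauss_dpoly (gauss_dpoly P)) 0\<bar> \<le> C * x ^ 3"
    if x: "x > 0" "x \<le> 1" for x
  proof -
    define T where "T = (\<lambda>j. x / 2 * (poly_gauss (gauss_dpoly P) (real j * x) + poly_gauss (gauss_dpoly P) (real (Suc j) * x))
      - (poly_gauss P (real (Suc j) * x) - poly_gauss P (real j * x))
      - x\<^sup>2 / 12 * (poly_gauss (gauss_dpoly (gauss_dpoly P)) (real (Suc j) * x) - poly_gauss (gauss_dpoly (gauss_dpoly P)) (real j * x)))"
    have lim: "(\<lambda>j. poly_gauss p (real j * x)) \<longlonglongrightarrow> 0" for p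
      by (subst filterlim_sequentially_Suc[symmetric])
         (use summable_LIMSEQ_zero[OF gsum_summable[OF x(1), of 0 p]] in simp)
    have s1: "(\<lambda>j. poly_gauss p (real (Suc j) * x)) sums gsum 0 p x" for p
      using summable_sums[OF gsum_summable[OF x(1), of 0 p]] by (simp add: gsum_def)
    have tel: "(\<lambda>j. poly_gauss p (real (Suc j) * x) - poly_gauss p (real j * x)) sums (0 - poly_gauss p (real 0 * x))" for p
      by (rule telescope_sums[OF lim])
    have s0: "(\<lambda>j. poly_gauss p (real j * x)) sums (gsum 0 p x + poly_gauss p 0)" for p
      using sums_diff[OF s1[of p] tel[of p]] by simp
    have "T sums (x / 2 * ((gsum 0 (gauss_dpoly P) x + poly_gauss (gauss_dpoly P) 0) + gsum 0 (gauss_dpoly P) x) - (0 - poly_gauss P (real 0 * x))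
       - x\<^sup>2 / 12 * (0 - poly_gauss (gauss_dpoly (gauss_dpoly P)) (real 0 * x)))"
      unfolding T_def by (intro sums_diff sums_mult sums_add s0 s1 tel)
    hence T: "T sums (x * gsum 0 (gauss_dpoly P) x + poly_gauss P 0 + x / 2 * poly_gauss (gauss_dpoly P) 0 + x\<^sup>2 / 12 * poly_gauss (gauss_dpoly (gauss_dpoly P)) 0)"
      by (simp add: algebra_simps)
    define c where "c = (\<lambda>j. inverse (1 + real j * x))"
    have c_lim: "c \<longlonglongrightarrow> 0"
      unfolding c_def
      by (intro tendsto_inverse_0_at_top filterlim_tendsto_add_at_top[OF tendsto_const]
          filterlim_at_top_mult_tendsto_pos[OF tendsto_const x(1) filterlim_real_sequentially])
    \<comment> \<open>Comparison of 1 / (1 + j x)^2 with a telescoping sum. As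
      \<open>x \<le> 1\<close>, consecutive values of \<open>c\<close> differ at most by a factor
      2.\<close>
    have c: "x * (c j)\<^sup>2 \<le> 2 * (c j - c (Suc j))" for j
    proof -
      have p: "1 + real j * x > 0" "1 + real (Suc j) * x > 0" using x by (auto intro!: add_pos_nonneg)
      have "c j - c (Suc j) = x * (c j * c (Suc j))"
        using p unfolding c_def by (simp add: field_simps)
      moreover have "c j \<le> 2 * c (Suc j)"
      proof -
        have a: "real j * x \<ge> 0" and e: "real (Suc j) * x = real j * x + x" using x by (simp_all add: algebra_simps)
        have "1 + real (Suc j) * x \<le> 2 * (1 + real j * x)" unfolding e
        proof -
          have "1 + (b + x) \<le> 2 * (1 + b)" if "b \<ge> 0" for b :: real using that x by simp
          then show "1 + (real j * x + x) \<le> 2 * (1 + real j * x)" using a by blast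
        qed
        then show ?thesis using p unfolding c_def by (simp add: field_simps)
      qed
      hence "x * (c j * c j) \<le> x * (c j * (2 * c (Suc j)))"
        using x p by (intro mult_left_mono) (auto simp: c_def)
      ultimately show ?thesis by (simp add: power2_eq_square)
    qed
    define B where "B = (\<lambda>j. C * x ^ 3 / 3 * (c j - c (Suc j)))"
    have TB: "\<bar>T j\<bar> \<le> B j" for j
    proof -
      have em: "\<bar>x / 2 * (poly_gauss (gauss_dpoly P) (real j * x) + poly_gauss (gauss_dpoly P) (real j * x + x))
        - (poly_gauss P (real j * x + x) - poly_gauss P (real j * x))
        - x\<^sup>2 / 12 * (poly_gauss (gauss_dpoly (gauss_dpoly P)) (real j * x + x) - poly_gauss (gauss_dpoly (gauss_dpoly P)) (real j * x))\<bar>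
        \<le> C / (1 + real j * x) ^ 2 * x ^ 4 / 6"
      proof (rule euler_maclaurin_interval[OF x(1)])
        fix t assume t: "real j * x \<le> t"
        have t0: "0 \<le> real j * x" using x by simp
        have "\<bar>poly_gauss (gauss_dpoly (gauss_dpoly (gauss_dpoly (gauss_dpoly P)))) t\<bar> \<le> C / (1 + t) ^ 2" using C t t0 by simp
        also have "\<dots> \<le> C / (1 + real j * x) ^ 2" using t t0 C(1)
          by (intro divide_left_mono power_mono mult_pos_pos zero_less_power) auto
        finally show "\<bar>poly_gauss (gauss_dpoly (gauss_dpoly (gauss_dpoly (gauss_dpoly P)))) t\<bar> \<le> C / (1 + real j * x) ^ 2" .
      qed
      have e: "real (Suc j) * x = real j * x + x" by (simp add: algebra_simps)
      have "\<bar>T j\<bar> \<le> C / (1 + real j * x) ^ 2 * x ^ 4 / 6" using em unfolding T_def e .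
      also have "\<dots> = C * x ^ 3 / 6 * (x * (c j)\<^sup>2)"
      proof -
        have "(c j)\<^sup>2 = 1 / (1 + real j * x) ^ 2" by (simp add: c_def inverse_eq_divide power_divide)
        moreover have "a / d * x ^ 4 / 6 = a * x ^ 3 / 6 * (x * (1 / d))" for a d
          by (simp add: eval_nat_numeral)
        ultimately show ?thesis by metis
      qed
      also have "\<dots> \<le> C * x ^ 3 / 6 * (2 * (c j - c (Suc j)))"
        using C(1) x by (intro mult_left_mono c) auto
      also have "\<dots> = B j" unfolding B_def by (simp add: algebra_simps)
      finally show ?thesis .
    qed
    have B: "B sums (C * x ^ 3 / 3 * (c 0 - 0))"
      unfolding B_def by (intro sums_mult telescope_sums' c_lim)
    have "\<bar>suminf T\<bar> \<le> suminf B"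
      using TB sums_summable[OF B] by (intro norm_suminf_le[where 'a = real, unfolded real_norm_def])
    also have "suminf B = C * x ^ 3 / 3" using sums_unique[OF B] by (simp add: c_def)
    also have "\<dots> \<le> C * x ^ 3" using C(1) x by simp
    finally show ?thesis using sums_unique[OF T] by simp
  qed
  with C(1) show ?thesis by blast
qed


text \<open>\<open>rayleigh\<close> is the limiting density of the rescaled ballot ratios and \<open>rayleigh_drop\<close> minus its
  derivative. For the sum of \<open>rayleigh\<close> over the multiples of \<open>x\<close>, \<open>rayleigh_error\<close> is the deviation from the
  integral divided by \<open>x\<close>, and \<open>level_fun\<close> is the first-order change of that deviation when \<open>x\<close> decreases.\<close>

definition rayleigh :: "real \<Rightarrow> real" where "rayleigh = poly_gauss [:0, 2:]"
definition rayleigh_drop :: "real \<Rightarrow> real" where "rayleigh_drop = poly_gauss [:-2, 0, 4:]"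
definition rayleigh_error :: "real \<Rightarrow> real" where "rayleigh_error x = gsum 0 [:0, 2:] x - 1 / x"
definition level_fun :: "real \<Rightarrow> real" where "level_fun x = gsum 1 [:-2, 0, 4:] x - 1 / x\<^sup>2"
definition level_fun' :: "real \<Rightarrow> real" where "level_fun' x = gsum 2 [:0, 12, 0, -8:] x + 2 / x ^ 3"
text \<open>The contribution of the half-step correction in \<open>ballot_approx\<close>. Its limit
  at 0 is 1: \<open>rayleigh_drop\<close> has integral 0 over the half-line, so minus half of its
  value -2 at 0 is what remains.\<close>

definition drop_series :: "real \<Rightarrow> real" where "drop_series = gsum 0 [:-2, 0, 4:]"
definition drop_series' :: "real \<Rightarrow> real" where "drop_series' = gsum 1 [:0, 12, 0, -8:]"

lemma gauss_dpoly_simps: "gauss_dpoly [:0, 2:] = - [:-2, 0, 4:]" "gauss_dpoly [:-2, 0, 4:] = [:0, 12, 0, -8:]"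
  by (simp_all add: gauss_dpoly_def pderiv_pCons)

lemma gsum_uminus: "x > 0 \<Longrightarrow> gsum i (- p) x = - gsum i p x"
  using suminf_minus[OF gsum_summable, of x i p] by (simp add: gsum_def poly_gauss_def)

lemma rayleigh_error_deriv: "x > 0 \<Longrightarrow> (rayleigh_error has_real_derivative - level_fun x) (at x)"
  unfolding rayleigh_error_def[abs_def]
  by (rule derivative_eq_intros gsum_deriv refl | simp)+
    (simp only: gauss_dpoly_simps gsum_uminus level_fun_def, simp add: power2_eq_square)

lemma level_fun_deriv: "x > 0 \<Longrightarrow> (level_fun has_real_derivative level_fun' x) (at x)"
  unfolding level_fun_def[abs_def] level_fun'_def
  by (rule derivative_eq_intros gsum_deriv refl | simp)+
    (simp add: gauss_dpoly_simps eval_nat_numeral)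

lemma drop_series_deriv: "x > 0 \<Longrightarrow> (drop_series has_real_derivative drop_series' x) (at x)"
  unfolding drop_series_def drop_series'_def
  using gsum_deriv[of x 0 "[:-2, 0, 4:]"] by (simp add: gauss_dpoly_simps)

text \<open>Multiplied by \<open>x ^ Suc i\<close> the sum becomes a Riemann sum of
  \<open>u ^ i * poly_gauss p u\<close>, and \<open>P\<close> encodes an antiderivative of that
  function vanishing at infinity. The uses below supply explicit choices of \<open>P\<close>, whose
  value at 0 is minus the integral over the half-line.\<close>

lemma gsum_expansion:
  assumes "gauss_dpoly P = [:0, 1:] ^ i * p"
  shows "\<exists>C\<ge>0. \<forall>x>0. x \<le> 1 \<longrightarrow> \<bar>x ^ Suc i * gsum i p x + poly P 0 + x / 2 * poly (gauss_dpoly P) 0 + x\<^sup>2 / 12 * poly (gauss_dpoly (gauss_dpoly P)) 0\<bar> \<le> C * x ^ 3"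
proof -
  have e: "x ^ Suc i * gsum i p x = x * gsum 0 (gauss_dpoly P) x" if "x > 0" for x
    using gsum_shift[OF that, of i p] assms by simp
  have pg0: "poly_gauss p 0 = poly p 0" for p by (simp add: poly_gauss_def)
  from gsum_euler_maclaurin[of P] obtain C where "C \<ge> 0" "\<And>x. x > 0 \<Longrightarrow> x \<le> 1 \<Longrightarrow>
    \<bar>x * gsum 0 (gauss_dpoly P) x + poly P 0 + x / 2 * poly (gauss_dpoly P) 0 + x\<^sup>2 / 12 * poly (gauss_dpoly (gauss_dpoly P)) 0\<bar> \<le> C * x ^ 3"
    unfolding pg0 by blast
  then show ?thesis using e by (intro exI[of _ C]) (simp del: power_Suc)
qed

lemma rayleigh_error_near_0: "\<exists>C\<ge>0. \<forall>x>0. x \<le> 1 \<longrightarrow> \<bar>rayleigh_error x + x / 6\<bar> \<le> C * x ^ 2"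
proof -
  obtain C where C: "C \<ge> 0" "\<And>x. x > 0 \<Longrightarrow> x \<le> 1 \<Longrightarrow> \<bar>x * gsum 0 [:0, 2:] x - 1 + x\<^sup>2 / 6\<bar> \<le> C * x ^ 3"
    \<comment> \<open>\<open>- exp (- u\<^sup>2)\<close> is an antiderivative of
      \<open>rayleigh\<close>. Its value -1 at 0 accounts for 1 / x, and the slope 2 of
      \<open>rayleigh\<close> at 0 for x / 6.\<close>
    using gsum_expansion[of "[:-1:]" 0 "[:0, 2:]"] by (auto simp: gauss_dpoly_def pderiv_pCons)
  have "\<bar>rayleigh_error x + x / 6\<bar> \<le> C * x ^ 2" if "x > 0" "x \<le> 1" for x
  proof -
    have "x * (rayleigh_error x + x / 6) = x * gsum 0 [:0, 2:] x - 1 + x\<^sup>2 / 6"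
      using that by (simp add: rayleigh_error_def field_simps power2_eq_square)
    hence "\<bar>x * (rayleigh_error x + x / 6)\<bar> \<le> C * x ^ 3" using C(2)[OF that] by simp
    hence "x * \<bar>rayleigh_error x + x / 6\<bar> \<le> x * (C * x ^ 2)"
      using that by (simp only: abs_mult) (simp add: eval_nat_numeral mult_ac)
    then show ?thesis using that by simp
  qed
  with C(1) show ?thesis by blast
qed

lemma level_fun_near_0: "\<exists>C\<ge>0. \<forall>x>0. x \<le> 1 \<longrightarrow> \<bar>level_fun x - 1 / 6\<bar> \<le> C * x"
proof -
  obtain C where C: "C \<ge> 0" "\<And>x. x > 0 \<Longrightarrow> x \<le> 1 \<Longrightarrow> \<bar>x\<^sup>2 * gsum 1 [:-2, 0, 4:] x - 1 - x\<^sup>2 / 6\<bar> \<le> C * x ^ 3"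
    \<comment> \<open>The antiderivative is - (1 + 2 u^2) exp (- u^2). Its value -1 at 0 cancels 1 /
      x^2, and the slope -2 of u (4 u^2 - 2) exp (- u^2) at 0 produces the limit 1/6.\<close>
    using gsum_expansion[of "[:-1, 0, -2:]" 1 "[:-2, 0, 4:]"] by (auto simp: gauss_dpoly_def pderiv_pCons numeral_2_eq_2)
  have "\<bar>level_fun x - 1 / 6\<bar> \<le> C * x" if "x > 0" "x \<le> 1" for x
  proof -
    have "x\<^sup>2 * (level_fun x - 1 / 6) = x\<^sup>2 * gsum 1 [:-2, 0, 4:] x - 1 - x\<^sup>2 / 6"
      using that by (simp add: level_fun_def field_simps)
    hence "\<bar>x\<^sup>2 * (level_fun x - 1 / 6)\<bar> \<le> C * x ^ 3" using C(2)[OF that] by simp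
    hence "x\<^sup>2 * \<bar>level_fun x - 1 / 6\<bar> \<le> x\<^sup>2 * (C * x)" by (simp add: abs_mult eval_nat_numeral mult_ac)
    then show ?thesis using that by simp
  qed
  with C(1) show ?thesis by blast
qed

lemma level_fun'_near_0: "\<exists>C\<ge>0. \<forall>x>0. x \<le> 1 \<longrightarrow> \<bar>level_fun' x\<bar> \<le> C"
proof -
  obtain C where C: "C \<ge> 0" "\<And>x. x > 0 \<Longrightarrow> x \<le> 1 \<Longrightarrow> \<bar>x ^ 3 * gsum 2 [:0, 12, 0, -8:] x + 2\<bar> \<le> C * x ^ 3"
    using gsum_expansion[of "[:2, 0, 2, 0, 4:]" 2 "[:0, 12, 0, -8:]"] by (auto simp: gauss_dpoly_def pderiv_pCons eval_nat_numeral)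
  have "\<bar>level_fun' x\<bar> \<le> C" if "x > 0" "x \<le> 1" for x
  proof -
    have "x ^ 3 * level_fun' x = x ^ 3 * gsum 2 [:0, 12, 0, -8:] x + 2"
      using that by (simp add: level_fun'_def field_simps)
    hence "\<bar>x ^ 3 * level_fun' x\<bar> \<le> C * x ^ 3" using C(2)[OF that] by simp
    hence "x ^ 3 * \<bar>level_fun' x\<bar> \<le> x ^ 3 * C" using that by (simp add: abs_mult mult_ac)
    then show ?thesis using that by simp
  qed
  with C(1) show ?thesis by blast
qed

lemma drop_series_near_0: "\<exists>C\<ge>0. \<forall>x>0. x \<le> 1 \<longrightarrow> \<bar>drop_series x - 1\<bar> \<le> C * x\<^sup>2"
proof -
  obtain C where C: "C \<ge> 0" "\<And>x. x > 0 \<Longrightarrow> x \<le> 1 \<Longrightarrow> \<bar>x * gsum 0 [:-2, 0, 4:] x - x\<bar> \<le> C * x ^ 3"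
    using gsum_expansion[of "[:0, -2:]" 0 "[:-2, 0, 4:]"] by (auto simp: gauss_dpoly_def pderiv_pCons)
  have "\<bar>drop_series x - 1\<bar> \<le> C * x\<^sup>2" if "x > 0" "x \<le> 1" for x
  proof -
    have "\<bar>x * (drop_series x - 1)\<bar> \<le> C * x ^ 3" using C(2)[OF that] by (simp add: drop_series_def algebra_simps)
    hence "x * \<bar>drop_series x - 1\<bar> \<le> x * (C * x\<^sup>2)" using that by (simp add: abs_mult eval_nat_numeral mult_ac)
    then show ?thesis using that by simp
  qed
  with C(1) show ?thesis by blast
qed

lemma drop_series'_near_0: "\<exists>C\<ge>0. \<forall>x>0. x \<le> 1 \<longrightarrow> \<bar>drop_series' x\<bar> \<le> C"
proof -
  obtain C where C: "C \<ge> 0" "\<And>x. x > 0 \<Longrightarrow> x \<le> 1 \<Longrightarrow> \<bar>x\<^sup>2 * gsum 1 [:0, 12, 0, -8:] x\<bar> \<le> C * x ^ 3"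
    using gsum_expansion[of "[:0, 0, 0, 4:]" 1 "[:0, 12, 0, -8:]"] by (auto simp: gauss_dpoly_def pderiv_pCons numeral_2_eq_2)
  have "\<bar>drop_series' x\<bar> \<le> C" if "x > 0" "x \<le> 1" for x
  proof -
    have "x\<^sup>2 * \<bar>drop_series' x\<bar> \<le> x\<^sup>2 * (C * x)" using C(2)[OF that] by (simp add: drop_series'_def abs_mult eval_nat_numeral mult_ac)
    hence "\<bar>drop_series' x\<bar> \<le> C * x" using that by simp
    also have "\<dots> \<le> C * 1" using that C(1) by (intro mult_left_mono) auto
    finally show ?thesis by simp
  qed
  with C(1) show ?thesis by blast
qed

lemma combine_bounds:
  fixes f :: "real \<Rightarrow> real"
  assumes "\<exists>C\<ge>0. \<forall>x>0. x \<le> 1 \<longrightarrow> \<bar>f x\<bar> \<le> C" "\<exists>D\<ge>0. \<forall>x\<ge>1. \<bar>f x\<bar> \<le> D / x ^ q"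
  shows "\<exists>C\<ge>0. \<forall>x>0. \<bar>f x\<bar> \<le> C \<and> \<bar>f x\<bar> \<le> C / x ^ q"
proof -
  from assms(1) obtain C where C: "C \<ge> 0" "\<And>x. x > 0 \<Longrightarrow> x \<le> 1 \<Longrightarrow> \<bar>f x\<bar> \<le> C" by blast
  from assms(2) obtain D where D: "D \<ge> 0" "\<And>x. x \<ge> 1 \<Longrightarrow> \<bar>f x\<bar> \<le> D / x ^ q" by blast
  have "\<bar>f x\<bar> \<le> C + D \<and> \<bar>f x\<bar> \<le> (C + D) / x ^ q" if x: "x > 0" for x
  proof (cases "x \<le> 1")
    case True
    have "\<bar>f x\<bar> \<le> C + D" using C(2)[OF x True] D(1) by simp
    moreover have "C + D \<le> (C + D) / x ^ q"
      using C(1) D(1) x True by (simp add: pos_le_divide_eq mult_left_le power_le_one)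
    ultimately show ?thesis by linarith
  next
    case False
    have 1: "\<bar>f x\<bar> \<le> D / x ^ q" using D(2)[of x] False by simp
    moreover have "D / x ^ q \<le> (C + D) / x ^ q" using C(1) x by (intro divide_right_mono) auto
    moreover have "(C + D) / x ^ q \<le> (C + D) / 1" using C(1) D(1) False by (intro divide_left_mono) auto
    ultimately show ?thesis by simp
  qed
  then show ?thesis using C(1) D(1) by (intro exI[of _ "C + D"]) auto
qed

lemma gsum_bound_ge1:
  assumes "r \<le> q" "i + 2 \<le> q"
  shows "\<exists>C\<ge>0. \<forall>x\<ge>1. \<bar>gsum i p x + c / x ^ r\<bar> \<le> C / x ^ r"
proof -
  obtain C where C: "C \<ge> 0" "\<And>x. x > 0 \<Longrightarrow> \<bar>gsum i p x\<bar> \<le> C / x ^ q" using gsum_bound[OF assms(2), of p] by blast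
  have "\<bar>gsum i p x + c / x ^ r\<bar> \<le> (C + \<bar>c\<bar>) / x ^ r" if x: "x \<ge> 1" for x
  proof -
    have "\<bar>gsum i p x\<bar> \<le> C / x ^ q" using C(2)[of x] x by simp
    also have "\<dots> \<le> C / x ^ r" using x C(1) assms(1) by (intro divide_left_mono power_increasing) auto
    finally have "\<bar>gsum i p x\<bar> \<le> C / x ^ r" .
    moreover have "\<bar>c / x ^ r\<bar> = \<bar>c\<bar> / x ^ r" using x by (simp add: abs_divide)
    ultimately show ?thesis unfolding add_divide_distrib by linarith
  qed
  then show ?thesis using C(1) by (intro exI[of _ "C + \<bar>c\<bar>"]) auto
qed

lemma level_fun_bound: "\<exists>C\<ge>0. \<forall>x>0. \<bar>level_fun x\<bar> \<le> C \<and> \<bar>level_fun x\<bar> \<le> C / x ^ 2"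
proof (rule combine_bounds)
  obtain C where C: "C \<ge> 0" "\<And>x. x > 0 \<Longrightarrow> x \<le> 1 \<Longrightarrow> \<bar>level_fun x - 1 / 6\<bar> \<le> C * x" using level_fun_near_0 by blast
  have "\<bar>level_fun x\<bar> \<le> C + 1" if "x > 0" "x \<le> 1" for x
  proof -
    have "C * x \<le> C" using that C(1) by (simp add: mult_left_le)
    then show ?thesis using C(2)[OF that] by (simp add: abs_le_iff)
  qed
  then show "\<exists>C\<ge>0. \<forall>x>0. x \<le> 1 \<longrightarrow> \<bar>level_fun x\<bar> \<le> C" using C(1) by (intro exI[of _ "C + 1"]) auto
  show "\<exists>C\<ge>0. \<forall>x\<ge>1. \<bar>level_fun x\<bar> \<le> C / x ^ 2"
    using gsum_bound_ge1[of 2 3 1 "[:-2, 0, 4:]" "-1"] by (simp add: level_fun_def)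
qed

lemma level_fun'_bound: "\<exists>C\<ge>0. \<forall>x>0. \<bar>level_fun' x\<bar> \<le> C \<and> \<bar>level_fun' x\<bar> \<le> C / x ^ 3"
  using gsum_bound_ge1[of 3 4 2 "[:0, 12, 0, -8:]" 2]
  by (intro combine_bounds level_fun'_near_0) (simp add: level_fun'_def)

lemma drop_series'_bound: "\<exists>C\<ge>0. \<forall>x>0. \<bar>drop_series' x\<bar> \<le> C \<and> \<bar>drop_series' x\<bar> \<le> C / x ^ 3"
  using gsum_bound_ge1[of 3 3 1 "[:0, 12, 0, -8:]" 0]
  by (intro combine_bounds drop_series'_near_0) (simp add: drop_series'_def)

section \<open>Gaussian approximation of the ballot numbers\<close>

text \<open>The common factor of the two binomial coefficients in \<open>ballot (n - 1) k\<close>: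
  divided by the central coefficient they are this product times (n + k - 1) / n and (n - k) / n. It
  carries the Gaussian behaviour.\<close>

definition central_ratio :: "nat \<Rightarrow> nat \<Rightarrow> real" where
  "central_ratio n k = (\<Prod>i=1..<k. (real n - real i) / (real n + real i))"

lemma choose_step: "real ((2 * N) choose (N + Suc k)) * (real (Suc N) + real k) =
   real ((2 * N) choose (N + k)) * (real N - real k)"
proof (cases "k \<le> N")
  case True
  have "Suc (N + k) * ((2 * N) choose Suc (N + k)) = (2 * N - (N + k)) * ((2 * N) choose (N + k))"
    using binomial_absorption[of "N + k" "2 * N"] binomial_absorb_comp[of "2 * N" "N + k"]
    by (cases N) simp_all
  hence "real (Suc (N + k)) * real ((2 * N) choose Suc (N + k)) = real (2 * N - (N + k)) * real ((2 * N) choose (N + k))"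
    unfolding of_nat_mult[symmetric] by (rule arg_cong)
  then show ?thesis using True by (simp add: of_nat_diff algebra_simps)
next
  case False
  then show ?thesis by (simp add: binomial_eq_0)
qed

lemma central_ratio_Suc: "k \<ge> 1 \<Longrightarrow> central_ratio n (Suc k) = central_ratio n k * ((real n - real k) / (real n + real k))"
  by (simp add: central_ratio_def)

lemma choose_central_ratio: "k \<ge> 1 \<Longrightarrow> real ((2 * N) choose (N + k)) =
   real ((2 * N) choose N) * central_ratio (Suc N) k * (real (Suc N) - real k) / real (Suc N)"
proof (induction k rule: nat_induct_at_least)
  case base
  show ?case using choose_step[of N 0] by (simp add: central_ratio_def field_simps)
next
  case (Suc k)
  have p: "real (Suc N) + real k > 0" by simp
  have "real ((2 * N) choose (N + Suc k)) = real ((2 * N) choose (N + k)) * (real N - real k) / (real (Suc N) + real k)"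
    using choose_step[of N k] p by (simp add: field_simps)
  also have "\<dots> = real ((2 * N) choose N) * (central_ratio (Suc N) k * ((real (Suc N) - real k) / (real (Suc N) + real k))) * (real (Suc N) - real (Suc k)) / real (Suc N)"
    unfolding Suc.IH by (simp add: mult_ac)
  finally show ?case unfolding central_ratio_Suc[OF Suc.hyps] .
qed

lemma ballot_ratio_central_ratio:
  assumes n: "n > 0" and k: "k \<ge> 1"
  shows "ballot_ratio n k = central_ratio n k * (2 * real k - 1) / real n"
proof -
  obtain N where N: "n = Suc N" using n by (cases n) auto
  define C where "C = real ((2 * N) choose N)"
  have C: "C > 0" unfolding C_def by simp
  have 1: "real ((2 * N) choose (N + k)) = C * central_ratio n k * (real n - real k) / real n"
    unfolding C_def N by (rule choose_central_ratio[OF k])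
  have 2: "real ((2 * N) choose (N + k - 1)) = C * central_ratio n k * (real n + real k - 1) / real n"
  proof (cases "k = 1")
    case True
    then show ?thesis using n by (simp add: central_ratio_def C_def)
  next
    case False
    then obtain j where j: "k = Suc j" "j \<ge> 1" using k by (cases k) auto
    have "real ((2 * N) choose (N + j)) = C * central_ratio n j * (real n - real j) / real n"
      unfolding C_def N by (rule choose_central_ratio[OF j(2)])
    moreover have "central_ratio n (Suc j) * (real n + real j) = central_ratio n j * (real n - real j)"
      unfolding central_ratio_Suc[OF j(2)] using n by simp
    ultimately show ?thesis unfolding j by (simp add: mult.assoc)
  qed
  have "ballot N k / C = central_ratio n k * (2 * real k - 1) / real n"
    unfolding ballot_def 1 2 using C n by (simp add: field_simps)
  then show ?thesis by (simp add: ballot_ratio_def N C_def)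
qed

text \<open>Telescopes to the central binomial coefficient. That this total mass is exact keeps the
  linear term of the expectation free of error.\<close>

lemma ballot_ratio_sum:
  assumes n: "n > 0"
  shows "(\<lambda>k. ballot_ratio n (Suc k)) sums 1"
proof -
  obtain N where N: "n = Suc N" using n by (cases n) auto
  have "(\<Sum>k<K. ballot N (Suc k)) = real ((2 * N) choose N) - real ((2 * N) choose (N + K))" for K
    by (induction K) (simp_all add: ballot_def)
  hence "(\<Sum>k<n. ballot N (Suc k)) = real ((2 * N) choose N)"
    by (simp add: N binomial_eq_0)
  hence "(\<Sum>k<n. ballot_ratio n (Suc k)) = 1"
    by (simp add: ballot_ratio_def N sum_divide_distrib[symmetric])
  moreover have "(\<lambda>k. ballot_ratio n (Suc k)) sums (\<Sum>k<n. ballot_ratio n (Suc k))"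
    by (rule sums_finite) (use n in \<open>auto intro!: ballot_ratio_eq_0\<close>)
  ultimately show ?thesis by simp
qed

lemma exp_upper: "1 - t \<le> (1 + t) * exp (- 2 * t)" if "0 \<le> t" for t :: real
proof -
  have "(1 + 0 - (1 - 0) * exp (2 * 0) :: real) \<le> 1 + t - (1 - t) * exp (2 * t)"
  proof (rule DERIV_nonneg_imp_nondecreasing[OF that])
    fix x :: real assume "0 \<le> x"
    have "((\<lambda>t. 1 + t - (1 - t) * exp (2 * t)) has_real_derivative 1 - exp (2 * x) * (1 - 2 * x)) (at x)"
      by (auto intro!: derivative_eq_intros simp: algebra_simps)
    moreover have "exp (2 * x) * (1 - 2 * x) \<le> exp (2 * x) * exp (- (2 * x))"
      using exp_ge_add_one_self[of "- (2 * x)"] by (intro mult_left_mono) auto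
    hence "1 - exp (2 * x) * (1 - 2 * x) \<ge> 0" by (simp add: exp_minus)
    ultimately show "\<exists>y. ((\<lambda>t. 1 + t - (1 - t) * exp (2 * t)) has_real_derivative y) (at x) \<and> 0 \<le> y" by blast
  qed
  then show ?thesis by (simp add: exp_minus field_simps)
qed

text \<open>ln ((1 - t) / (1 + t)) is - 2 t - 2 t^3 / 3 and so on; for t up to 1/2 the coefficient 2
  of the cube covers the whole tail.\<close>

lemma exp_lower: "(1 + t) * exp (- 2 * t - 2 * t ^ 3) \<le> 1 - t" if t: "0 \<le> t" "t \<le> 1 / 2" for t :: real
proof -
  define f where "f = (\<lambda>t::real. 2 * t + 2 * t ^ 3 - ln (1 + t) + ln (1 - t))"
  have "f 0 \<le> f t"
  proof (rule DERIV_nonneg_imp_nondecreasing[OF t(1)])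
    fix x :: real assume x: "0 \<le> x" "x \<le> t"
    have d: "(f has_real_derivative 2 + 6 * x\<^sup>2 - 1 / (1 + x) - 1 / (1 - x)) (at x)"
      unfolding f_def using x t by (auto intro!: derivative_eq_intros simp: field_simps)
    have "x\<^sup>2 \<le> (1/2)\<^sup>2" using x t by (intro power_mono) auto
    hence x2: "x\<^sup>2 \<le> 1 / 4" by (simp add: power2_eq_square)
    have "1 / (1 + x) + 1 / (1 - x) = 2 / (1 - x\<^sup>2)"
      using x t by (simp add: field_simps power2_eq_square)
    also have "2 / (1 - x\<^sup>2) \<le> 2 + 6 * x\<^sup>2"
    proof -
      have "0 \<le> x\<^sup>2 * (4 - 6 * x\<^sup>2)" using x2 by (intro mult_nonneg_nonneg) auto
      hence "2 \<le> (2 + 6 * x\<^sup>2) * (1 - x\<^sup>2)" by (simp add: algebra_simps)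
      then show ?thesis using x2 by (simp add: divide_le_eq)
    qed
    finally have "2 + 6 * x\<^sup>2 - 1 / (1 + x) - 1 / (1 - x) \<ge> 0" by simp
    with d show "\<exists>y. (f has_real_derivative y) (at x) \<and> 0 \<le> y" by blast
  qed
  hence "ln (1 + t) - 2 * t - 2 * t ^ 3 \<le> ln (1 - t)" by (simp add: f_def)
  hence "exp (ln (1 + t) + (- 2 * t - 2 * t ^ 3)) \<le> exp (ln (1 - t))" by simp
  then show ?thesis using t by (simp only: exp_add) simp
qed

lemma central_ratio_upper:
  assumes "k \<ge> 1" "k \<le> n"
  shows "0 \<le> central_ratio n k \<and> central_ratio n k \<le> exp (- real k * (real k - 1) / real n)"
  using assms
proof (induction k rule: nat_induct_at_least)
  case base
  then show ?case by (simp add: central_ratio_def)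
next
  case (Suc k)
  define t where "t = real k / real n"
  have n: "real n > 0" using Suc by simp
  have f: "(real n - real k) / (real n + real k) = (1 - t) / (1 + t)"
  proof -
    have "1 - t = (real n - real k) / real n" "1 + t = (real n + real k) / real n"
      using n by (simp_all add: t_def field_simps)
    then show ?thesis using n by simp
  qed
  have t: "0 \<le> t" "t \<le> 1" using Suc n by (auto simp: t_def)
  have "(1 - t) / (1 + t) \<le> exp (- 2 * t)" using exp_upper[OF t(1)] t by (simp add: field_simps)
  hence "central_ratio n k * ((1 - t) / (1 + t)) \<le> exp (- real k * (real k - 1) / real n) * exp (- 2 * t)"
    using Suc t by (intro mult_mono) auto
  also have "\<dots> = exp (- real (Suc k) * (real (Suc k) - 1) / real n)"
    unfolding exp_add[symmetric] t_def using n by (simp add: field_simps)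
  finally show ?case unfolding central_ratio_Suc[OF Suc.hyps] f using Suc t by simp
qed

text \<open>The exponents - 2 i / n add up to - k (k - 1) / n, and the cubic terms 2 i^3 / n^3 to at
  most 2 k^4 / n^3. The restriction to 2 k below n keeps every i / n in the range of
  \<open>exp_lower\<close>.\<close>

lemma central_ratio_lower:
  assumes "k \<ge> 1" "2 * k \<le> n"
  shows "exp (- real k * (real k - 1) / real n - 2 * real k ^ 4 / real n ^ 3) \<le> central_ratio n k"
  using assms
proof (induction k rule: nat_induct_at_least)
  case base
  then show ?case by (simp add: central_ratio_def)
next
  case (Suc k)
  define t where "t = real k / real n"
  have n: "real n > 0" using Suc by simp
  have f: "(real n - real k) / (real n + real k) = (1 - t) / (1 + t)"
  proof -
    have "1 - t = (real n - real k) / real n" "1 + t = (real n + real k) / real n"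
      using n by (simp_all add: t_def field_simps)
    then show ?thesis using n by simp
  qed
  have t: "0 \<le> t" "t \<le> 1 / 2" using Suc n by (auto simp: t_def field_simps)
  have "exp (- real (Suc k) * (real (Suc k) - 1) / real n - 2 * real (Suc k) ^ 4 / real n ^ 3)
     \<le> exp ((- real k * (real k - 1) / real n - 2 * real k ^ 4 / real n ^ 3) + (- 2 * t - 2 * t ^ 3))"
  proof -
    have "real k ^ 4 + real k ^ 3 \<le> real (Suc k) ^ 4"
    proof -
      have "real k ^ 4 + real k ^ 3 \<le> real k ^ 4 + 4 * real k ^ 3 + 6 * real k ^ 2 + 4 * real k + 1" by simp
      also have "\<dots> = real (Suc k) ^ 4" by (simp add: eval_nat_numeral algebra_simps)
      finally show ?thesis .
    qed
    hence "2 * (real k ^ 4 + real k ^ 3) / real n ^ 3 \<le> 2 * real (Suc k) ^ 4 / real n ^ 3"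
      using n by (intro divide_right_mono) auto
    moreover have "- real (Suc k) * (real (Suc k) - 1) / real n = - real k * (real k - 1) / real n - 2 * t"
      using n by (simp add: t_def field_simps)
    moreover have "2 * (real k ^ 4 + real k ^ 3) / real n ^ 3 = 2 * real k ^ 4 / real n ^ 3 + 2 * t ^ 3"
      by (simp add: t_def power_divide add_divide_distrib)
    ultimately show ?thesis by simp
  qed
  also have "\<dots> \<le> central_ratio n k * ((1 - t) / (1 + t))"
  proof -
    have "exp (- 2 * t - 2 * t ^ 3) \<le> (1 - t) / (1 + t)" using exp_lower[OF t] t by (simp add: field_simps)
    then show ?thesis unfolding exp_add using Suc t central_ratio_upper[of k n] by (intro mult_mono) auto
  qed
  finally show ?case unfolding central_ratio_Suc[OF Suc.hyps] f .
qed

lemma central_ratio_0: "k > n \<Longrightarrow> n > 0 \<Longrightarrow> central_ratio n k = 0"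
  by (auto simp: central_ratio_def intro!: bexI[of _ n])

text \<open>For n > 0 this is the quotient of \<open>(2 * n) choose (n + k)\<close> and
  \<open>(2 * n) choose n\<close>, the ratio of the classical local limit theorem.\<close>

definition weighted_ratio :: "nat \<Rightarrow> nat \<Rightarrow> real" where
  "weighted_ratio n k = central_ratio n k * (real n / (real n + real k))"

text \<open>The polynomial 4 u^2 - 2 of \<open>rayleigh_drop\<close> at u = k / sqrt n appears here
  without error. For differences, only \<open>weighted_ratio\<close> is left to be compared with the
  Gaussian.\<close>

lemma ballot_ratio_diff:
  assumes n: "n > 0" and k: "k \<ge> 1"
  shows "ballot_ratio n k - ballot_ratio n (Suc k) = weighted_ratio n k * (4 * (real k)\<^sup>2 / real n - 2) / real n"
proof -
  have "ballot_ratio n k - ballot_ratio n (Suc k) = central_ratio n k * ((2 * real k - 1) - (real n - real k) / (real n + real k) * (2 * real k + 1)) / real n"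
  proof -
    have "ballot_ratio n (Suc k) = central_ratio n k * ((real n - real k) / (real n + real k) * (2 * real k + 1)) / real n"
      using n k by (simp add: ballot_ratio_central_ratio central_ratio_Suc)
    moreover have "ballot_ratio n k = central_ratio n k * (2 * real k - 1) / real n" using n k by (rule ballot_ratio_central_ratio)
    ultimately show ?thesis by (simp only: diff_divide_distrib[symmetric] right_diff_distrib[symmetric])
  qed
  also have "(2 * real k - 1) - (real n - real k) / (real n + real k) * (2 * real k + 1) =
     real n / (real n + real k) * (4 * (real k)\<^sup>2 / real n - 2)"
  proof -
    have "real n > 0" "real n + real k > 0" using n by simp_all
    then show ?thesis by (simp add: divide_simps) (simp add: algebra_simps power2_eq_square)
  qed
  finally show ?thesis by (simp add: weighted_ratio_def)
qed

text \<open>The errors are u^2 / n from the factor n / (n + k) and 2 u^4 / n from the cubic terms in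
  \<open>central_ratio_lower\<close>, at the price of half the Gaussian exponent. The coefficient 4
  of u^2 makes the factor in front at least 1 when 2 k > n, where the crude bound by exp (- u^2 / 2)
  is then enough.\<close>

lemma weighted_ratio_gauss:
  assumes n: "n \<ge> 2" and k: "k \<ge> 1"
  defines "u \<equiv> real k / sqrt (real n)"
  shows "\<bar>weighted_ratio n k - exp (- u\<^sup>2)\<bar> \<le> (4 * u\<^sup>2 + 2 * u ^ 4) / real n * exp (- u\<^sup>2 / 2)"
proof -
  define s where "s = real k / real n"
  have n0: "real n > 0" "real n \<ge> 2" using n by auto
  have u2: "u\<^sup>2 = (real k)\<^sup>2 / real n" by (simp add: u_def power_divide)
  have u4: "u ^ 4 = real k ^ 4 / (real n)\<^sup>2"
  proof -
    have "u ^ 4 = (u\<^sup>2)\<^sup>2" by simp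
    then show ?thesis unfolding u2 by (simp add: power_divide)
  qed
  have s2: "s\<^sup>2 = u\<^sup>2 / real n" unfolding u2 by (simp add: s_def power_divide power2_eq_square)
  have s0: "s > 0" using n k by (simp add: s_def)
  have kk: "real k * (real k - 1) / real n = u\<^sup>2 - s"
    unfolding u2 s_def by (simp add: power2_eq_square algebra_simps diff_divide_distrib)
  have weighted_ratio: "weighted_ratio n k = central_ratio n k * (1 / (1 + s))" using n0 by (simp add: weighted_ratio_def s_def field_simps)
  have upper: "weighted_ratio n k \<le> exp (- u\<^sup>2 + u\<^sup>2 / real n) \<and> 0 \<le> weighted_ratio n k" if kn: "k \<le> n"
  proof -
    have s1: "s \<le> 1" using kn n by (simp add: s_def)
    \<comment> \<open>The factor \<open>1 / (1 + s)\<close> has to cancel \<open>exp s\<close>, by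
      which the Gaussian with exponent - k (k - 1) / n exceeds \<open>exp (- u\<^sup>2)\<close>. The
      loss \<open>s\<^sup>2\<close> equals \<open>u\<^sup>2 / real n\<close>.\<close>
    have "s - s\<^sup>2 \<le> ln (1 + s)" using ln_one_plus_pos_lower_bound[of s] s0 s1 by simp
    hence "exp (s - s\<^sup>2) \<le> exp (ln (1 + s))" by simp
    hence "exp (s - s\<^sup>2) \<le> 1 + s" using s0 by simp
    hence "1 / (1 + s) \<le> 1 / exp (s - s\<^sup>2)" using s0 by (intro divide_left_mono) auto
    also have "1 / exp (s - s\<^sup>2) = exp (- s + s\<^sup>2)" by (simp add: exp_minus[symmetric] inverse_eq_divide[symmetric])
    finally have "weighted_ratio n k \<le> exp (- real k * (real k - 1) / real n) * exp (- s + s\<^sup>2)"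
      unfolding weighted_ratio using central_ratio_upper[OF k kn] s0 by (intro mult_mono) auto
    also have "\<dots> = exp (- u\<^sup>2 + u\<^sup>2 / real n)"
      unfolding exp_add[symmetric] using kk s2 by simp
    finally show ?thesis using central_ratio_upper[OF k kn] s0 by (simp add: weighted_ratio)
  qed
  have half: "- u\<^sup>2 + u\<^sup>2 / real n \<le> - u\<^sup>2 / 2"
  proof -
    have "u\<^sup>2 / real n \<le> u\<^sup>2 / 2" using n0 by (intro divide_left_mono) auto
    moreover have "- b + a \<le> - b / 2" if "a \<le> b / 2" for a b :: real using that by simp
    ultimately show ?thesis by blast
  qed
  show ?thesis
  proof (cases "2 * k \<le> n")
    case True
    have "exp (- u\<^sup>2 - 2 * u ^ 4 / real n) \<le> weighted_ratio n k"
    proof -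
      have "- u\<^sup>2 - 2 * u ^ 4 / real n = (- real k * (real k - 1) / real n - 2 * real k ^ 4 / real n ^ 3) + - s"
      proof -
        have "- real k * (real k - 1) / real n = s - u\<^sup>2" using kk by simp
        moreover have "2 * u ^ 4 / real n = 2 * real k ^ 4 / real n ^ 3"
          unfolding u4 by (simp add: power2_eq_square power3_eq_cube)
        ultimately show ?thesis by simp
      qed
      moreover have "exp (- s) \<le> 1 / (1 + s)"
        using exp_ge_add_one_self[of s] s0 by (simp add: exp_minus field_simps)
      hence "exp (- real k * (real k - 1) / real n - 2 * real k ^ 4 / real n ^ 3) * exp (- s) \<le> weighted_ratio n k"
        unfolding weighted_ratio using central_ratio_lower[OF k True] central_ratio_upper[OF k] True by (intro mult_mono) auto
      ultimately show ?thesis by (simp add: exp_add[symmetric])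
    qed
    moreover have "exp (- u\<^sup>2) - exp (- u\<^sup>2 - 2 * u ^ 4 / real n) \<le> 2 * u ^ 4 / real n * exp (- u\<^sup>2 / 2)"
    proof -
      have "exp (- u\<^sup>2) - exp (- u\<^sup>2 - 2 * u ^ 4 / real n) = (1 - exp (- (2 * u ^ 4 / real n))) * exp (- u\<^sup>2)"
        by (simp add: exp_diff exp_minus field_simps)
      also have "\<dots> \<le> 2 * u ^ 4 / real n * exp (- u\<^sup>2 / 2)"
        using exp_ge_add_one_self[of "- (2 * u ^ 4 / real n)"] n0
        by (intro mult_mono) auto
      finally show ?thesis .
    qed
    moreover have "exp (- u\<^sup>2 + u\<^sup>2 / real n) - exp (- u\<^sup>2) \<le> u\<^sup>2 / real n * exp (- u\<^sup>2 / 2)"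
    proof -
      have "exp (- u\<^sup>2 + u\<^sup>2 / real n) - exp (- u\<^sup>2) = (1 - exp (- (u\<^sup>2 / real n))) * exp (- u\<^sup>2 + u\<^sup>2 / real n)"
      proof -
        have "exp (- u\<^sup>2) = exp (- (u\<^sup>2 / real n)) * exp (- u\<^sup>2 + u\<^sup>2 / real n)"
          unfolding exp_add[symmetric] by simp
        moreover have "a - b = (1 - c) * a" if "b = c * a" for a b c :: real using that by (simp add: left_diff_distrib)
        ultimately show ?thesis by blast
      qed
      also have "\<dots> \<le> u\<^sup>2 / real n * exp (- u\<^sup>2 / 2)"
        using exp_ge_add_one_self[of "- (u\<^sup>2 / real n)"] n0 half
        by (intro mult_mono) auto
      finally show ?thesis .
    qed
    moreover have "u\<^sup>2 / real n * exp (- u\<^sup>2 / 2) \<le> (4 * u\<^sup>2 + 2 * u ^ 4) / real n * exp (- u\<^sup>2 / 2)"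
      "2 * u ^ 4 / real n * exp (- u\<^sup>2 / 2) \<le> (4 * u\<^sup>2 + 2 * u ^ 4) / real n * exp (- u\<^sup>2 / 2)"
      using n0 by (intro mult_right_mono divide_right_mono; simp)+
    moreover have "\<bar>B - E\<bar> \<le> R" if "L \<le> B" "E - L \<le> p" "U - E \<le> q" "q \<le> R" "p \<le> R" "B \<le> U"
      for B E R L p U q :: real using that by (simp only: abs_le_iff) auto
    moreover have "weighted_ratio n k \<le> exp (- u\<^sup>2 + u\<^sup>2 / real n)" using upper True by simp
    ultimately show ?thesis by blast
  next
    case False
    have b: "0 \<le> weighted_ratio n k" "weighted_ratio n k \<le> exp (- u\<^sup>2 / 2)"
    proof -
      have "0 \<le> weighted_ratio n k \<and> weighted_ratio n k \<le> exp (- u\<^sup>2 / 2)"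
      proof (cases "k \<le> n")
        case True
        have "exp (- u\<^sup>2 + u\<^sup>2 / real n) \<le> exp (- u\<^sup>2 / 2)" using half by simp
        then show ?thesis using upper[OF True] by (meson order_trans)
      next
        case False
        then show ?thesis using n by (simp add: weighted_ratio_def central_ratio_0)
      qed
      then show "0 \<le> weighted_ratio n k" "weighted_ratio n k \<le> exp (- u\<^sup>2 / 2)" by auto
    qed
    have "exp (- u\<^sup>2) \<le> exp (- u\<^sup>2 / 2)" by simp
    moreover have "\<bar>B - E\<bar> \<le> 1 * R" if "0 \<le> B" "B \<le> R" "0 \<le> E" "E \<le> R" for B E R :: real
      using that by (simp only: abs_le_iff mult_1) auto
    ultimately have "\<bar>weighted_ratio n k - exp (- u\<^sup>2)\<bar> \<le> 1 * exp (- u\<^sup>2 / 2)" using b exp_ge_zero by blast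
    also have "\<dots> \<le> (4 * u\<^sup>2 + 2 * u ^ 4) / real n * exp (- u\<^sup>2 / 2)"
    proof (intro mult_right_mono)
      have "real n \<le> 2 * real k" using False by simp
      hence "(real n)\<^sup>2 \<le> (2 * real k)\<^sup>2" by (intro power_mono) auto
      hence "real n \<le> 4 * u\<^sup>2" using n0 unfolding u2 by (simp add: field_simps power2_eq_square)
      moreover have "0 \<le> 2 * u ^ 4" by simp
      ultimately have "real n \<le> 4 * u\<^sup>2 + 2 * u ^ 4" by (intro add_increasing2)
      then show "1 \<le> (4 * u\<^sup>2 + 2 * u ^ 4) / real n" using n0 by simp
    qed simp
    finally show ?thesis .
  qed
qed

section \<open>Abel summation over the multiples of an integer\<close>

definition msum :: "(nat \<Rightarrow> real) \<Rightarrow> nat \<Rightarrow> real" where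
  "msum f m = (\<Sum>j. f (Suc j * m))"

lemma msum_summable:
  assumes "summable (\<lambda>k. \<bar>f (Suc k)\<bar>)" "m \<ge> 1"
  shows "summable (\<lambda>j. f (Suc j * m))" "(\<lambda>k. if m dvd Suc k then f (Suc k) else 0) sums msum f m"
proof -
  let ?F = "\<lambda>k. if m dvd Suc k then f (Suc k) else 0"
  let ?g = "\<lambda>j. Suc j * m - 1"
  have sF: "summable ?F"
    by (rule summable_comparison_test'[OF assms(1), of 0]) auto
  have mono: "strict_mono ?g"
    using assms(2) by (intro strict_monoI_Suc) (simp add: less_diff_conv)
  have z: "?F k = 0" if "k \<notin> range ?g" for k
  proof -
    have "\<not> m dvd Suc k"
    proof
      assume "m dvd Suc k"
      then obtain i where i: "Suc k = m * i" by (elim dvdE)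
      then obtain j where "i = Suc j" by (cases i) auto
      hence "k = ?g j" using i by (simp add: mult.commute)
      then show False using that by blast
    qed
    then show ?thesis by simp
  qed
  have e: "?F (?g j) = f (Suc j * m)" for j using assms(2) by (simp add: Suc_diff_Suc)
  have "summable (\<lambda>j. ?F (?g j)) = summable ?F"
    by (rule summable_mono_reindex[OF mono z])
  then show s: "summable (\<lambda>j. f (Suc j * m))" unfolding e using sF by simp
  have "(\<lambda>j. ?F (?g j)) sums msum f m = (?F sums msum f m)"
    by (rule sums_mono_reindex[OF mono z])
  then show "?F sums msum f m" unfolding e using summable_sums[OF s] by (simp add: msum_def)
qed

text \<open>The weight \<open>real (k mod m) / real m\<close> rises by 1 / m at every step and falls
  by 1 at each multiple of \<open>m\<close>, so summation by parts produces the trend minus the sum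
  over multiples. The boundary term vanishes since the weight is bounded and \<open>f\<close> tends
  to 0.\<close>

lemma msum_abel:
  assumes sm: "summable (\<lambda>k. \<bar>f (Suc k)\<bar>)" and m: "m \<ge> 1"
  shows "(\<lambda>k. real (Suc k mod m) / real m * (f (Suc k) - f (Suc (Suc k)))) sums
    (msum f 1 / real m - msum f m)"
proof -
  define \<phi> where "\<phi> = (\<lambda>k. real (k mod m) / real m)"
  have step: "\<phi> (Suc k) = \<phi> k + 1 / real m - of_bool (m dvd Suc k)" for k
  proof (cases "Suc (k mod m) = m")
    case True
    hence "real m = real (k mod m) + 1" by simp
    moreover have "Suc k mod m = 0" "m dvd Suc k" using True by (auto simp: mod_Suc mod_eq_0_iff_dvd[symmetric])
    ultimately show ?thesis using m by (simp add: \<phi>_def field_simps)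
  next
    case False
    then have "Suc k mod m = Suc (k mod m)" by (simp add: mod_Suc)
    moreover from this have "\<not> m dvd Suc k" by (simp add: mod_eq_0_iff_dvd[symmetric])
    ultimately show ?thesis by (simp add: \<phi>_def add_divide_distrib)
  qed
  have fin: "(\<Sum>k<K. \<phi> (Suc k) * (f (Suc k) - f (Suc (Suc k)))) =
     (\<Sum>k<K. 1 / real m * f (Suc k) - (if m dvd Suc k then f (Suc k) else 0)) - \<phi> K * f (Suc K)" for K
  proof (induction K)
    case 0
    then show ?case by (simp add: \<phi>_def)
  next
    case (Suc K)
    show ?case unfolding sum.lessThan_Suc Suc.IH
      by (cases "m dvd Suc K") (simp_all add: step[of K] algebra_simps)
  qed
  have bounded: "\<bar>\<phi> K * f (Suc K)\<bar> \<le> \<bar>f (Suc K)\<bar>" for K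
  proof -
    have "\<phi> K \<le> 1" "0 \<le> \<phi> K" using m by (auto simp: \<phi>_def intro: less_imp_le mod_less_divisor)
    then show ?thesis by (simp add: abs_mult mult_left_le_one_le)
  qed
  have lim: "(\<lambda>K. \<phi> K * f (Suc K)) \<longlonglongrightarrow> 0"
    by (rule Lim_null_comparison[OF _ summable_LIMSEQ_zero[OF sm]]) (use bounded in auto)
  have "(\<lambda>k. f (Suc k)) sums msum f 1"
    using msum_summable(2)[OF sm, of 1] by simp
  hence "(\<lambda>k. 1 / real m * f (Suc k) - (if m dvd Suc k then f (Suc k) else 0)) sums
     (1 / real m * msum f 1 - msum f m)"
    by (intro sums_diff sums_mult msum_summable(2)[OF sm m])
  hence "(\<lambda>K. \<Sum>k<K. \<phi> (Suc k) * (f (Suc k) - f (Suc (Suc k)))) \<longlonglongrightarrow> (1 / real m * msum f 1 - msum f m) - 0"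
    unfolding fin sums_def by (intro tendsto_diff lim)
  then show ?thesis by (simp add: sums_def \<phi>_def)
qed

text \<open>The difference is bounded both by \<open>1\<close> and linearly in \<open>k / M\<close>. Interpolating with a square root
  gives a factor that is still summable over \<open>M = 2 ^ (r + 1)\<close>; this is the source of the error \<open>n powr (- 1 / 4)\<close>.\<close>

lemma mod_diff_bound:
  assumes k: "k \<ge> 1" and m: "m \<ge> 1" "M = Suc m"
  shows "\<bar>real (k mod m) / real m - real (k mod M) / real M\<bar> \<le> sqrt (2 * real k / real M)"
proof (cases "k < m")
  case True
  have "real (k mod m) / real m - real (k mod M) / real M = real k / (real m * real M)"
    using True m by (simp add: field_simps)
  also have "\<bar>\<dots>\<bar> \<le> 1 / real M"
    using True m by (simp add: divide_simps)
  also have "\<dots> = sqrt ((1 / real M)\<^sup>2)" by simp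
  also have "\<dots> \<le> sqrt (2 * real k / real M)"
  proof (rule real_sqrt_le_mono)
    have "(1 / real M)\<^sup>2 = 1 / (real M * real M)" by (simp add: power2_eq_square)
    also have "\<dots> \<le> 1 / (1 * real M)" using m by (intro divide_left_mono mult_right_mono) auto
    also have "\<dots> \<le> 2 * real k / real M" using k m by (simp add: field_simps)
    finally show "(1 / real M)\<^sup>2 \<le> 2 * real k / real M" .
  qed
  finally show ?thesis .
next
  case False
  have "k mod m < m" "k mod M < M" using m by simp_all
  hence "real (k mod m) / real m \<le> 1" "real (k mod M) / real M \<le> 1"
    by (simp_all only: divide_le_eq_1 of_nat_le_iff of_nat_0_less_iff) auto
  moreover have "0 \<le> real (k mod m) / real m" "0 \<le> real (k mod M) / real M" by auto
  moreover have "\<bar>a - b\<bar> \<le> 1" if "a \<le> 1" "b \<le> 1" "0 \<le> a" "0 \<le> b" for a b :: real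
    using that by (simp add: abs_le_iff)
  ultimately have "\<bar>real (k mod m) / real m - real (k mod M) / real M\<bar> \<le> 1" by blast
  also have "1 \<le> sqrt (2 * real k / real M)" using False m by simp
  finally show ?thesis .
qed

text \<open>The second term is a half-step correction: with it, consecutive differences agree with
  \<open>y\<^sup>2 * rayleigh_drop (k * y)\<close> up to fourth order in \<open>y\<close>.\<close>

definition ballot_approx :: "real \<Rightarrow> nat \<Rightarrow> real" where
  "ballot_approx y k = y * rayleigh (real k * y) + y\<^sup>2 / 2 * rayleigh_drop (real k * y)"

lemma rayleigh_deriv: "(rayleigh has_real_derivative - rayleigh_drop u) (at u)"
proof -
  have "poly_gauss (gauss_dpoly [:0, 2:]) u = - rayleigh_drop u"
    unfolding gauss_dpoly_simps(1) rayleigh_drop_def by (simp add: poly_gauss_def algebra_simps)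
  then show ?thesis using poly_gauss_deriv[of "[:0, 2:]" u] by (simp only: rayleigh_def)
qed

lemma ballot_approx_diff:
  "\<exists>C\<ge>0. \<forall>y>0. \<forall>k. \<bar>ballot_approx y k - ballot_approx y (Suc k) - y\<^sup>2 * rayleigh_drop (real k * y)\<bar> \<le> C * y ^ 4 / (1 + real k * y) ^ 3"
proof -
  define p where "p = ([:-2, 0, 4:] :: real poly)"
  have e: "rayleigh_drop = poly_gauss p" by (simp add: rayleigh_drop_def p_def)
  obtain C where C: "C \<ge> 0" "\<And>u. u \<ge> 0 \<Longrightarrow> \<bar>poly_gauss (gauss_dpoly (gauss_dpoly p)) u\<bar> \<le> C / (1 + u) ^ 3"
    using poly_gauss_bound[of "gauss_dpoly (gauss_dpoly p)" 3] by blast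
  have "\<bar>ballot_approx y k - ballot_approx y (Suc k) - y\<^sup>2 * rayleigh_drop (real k * y)\<bar> \<le> C * y ^ 4 / (1 + real k * y) ^ 3" if y: "y > 0" for y k
  proof -
    define u where "u = real k * y"
    have u: "u \<ge> 0" using y by (simp add: u_def)
    have uy: "real (Suc k) * y = u + y" by (simp add: u_def algebra_simps)
    \<comment> \<open>The derivatives of \<open>rayleigh\<close>; from the first one on they are
      minus the derivatives of \<open>rayleigh_drop\<close>, whence the sign and the shifted
      index.\<close>
    define d where "d = (\<lambda>m. if m = 0 then rayleigh else (\<lambda>x. - poly_gauss ((gauss_dpoly ^^ (m - 1)) p) x))"
    have der: "(d m has_real_derivative d (Suc m) t) (at t)" for m t
    proof (cases m)
      case 0
      then show ?thesis using rayleigh_deriv[of t] by (simp add: d_def e)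
    next
      case (Suc j)
      then show ?thesis by (auto simp: d_def intro!: derivative_eq_intros poly_gauss_deriv)
    qed
    have d: "d 0 = rayleigh" "d 1 t = - rayleigh_drop t" "d 2 t = - poly_gauss (gauss_dpoly p) t" "d 3 t = - poly_gauss (gauss_dpoly (gauss_dpoly p)) t" for t
      by (simp_all add: d_def e eval_nat_numeral)
    have tay: "\<exists>t. u < t \<and> t < u + y \<and> d i (u + y) = (\<Sum>m<n. d (i + m) u / fact m * y ^ m) + d (i + n) t / fact n * y ^ n"
      if "n > 0" for i n
    proof -
      have "\<exists>t>u. t < u + y \<and> d i (u + y) = (\<Sum>m<n. d (i + m) u / fact m * (u + y - u) ^ m) + d (i + n) t / fact n * (u + y - u) ^ n"
        by (rule Taylor_up[where a = u]) (use that y der in auto)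
      then show ?thesis by simp
    qed
    obtain t0 where t0: "u < t0" "d 0 (u + y) = d 0 u + d 1 u * y + d 2 u * y\<^sup>2 / 2 + d 3 t0 * y ^ 3 / 6"
      using tay[of 3 0] by (auto simp: eval_nat_numeral)
    obtain t1 where t1: "u < t1" "d 1 (u + y) = d 1 u + d 2 u * y + d 3 t1 * y\<^sup>2 / 2"
      using tay[of 2 1] by (auto simp: eval_nat_numeral)
    have b: "\<bar>d 3 t\<bar> \<le> C / (1 + u) ^ 3" if "u < t" for t
    proof -
      have "\<bar>d 3 t\<bar> \<le> C / (1 + t) ^ 3" using C(2)[of t] that u by (simp add: d)
      also have "\<dots> \<le> C / (1 + u) ^ 3" using that u C(1) by (intro divide_left_mono power_mono mult_pos_pos zero_less_power) auto
      finally show ?thesis .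
    qed
    have "ballot_approx y k - ballot_approx y (Suc k) - y\<^sup>2 * rayleigh_drop (real k * y) = (d 3 t1 / 4 - d 3 t0 / 6) * y ^ 4"
    proof -
      have "rayleigh (u + y) = d 0 u + d 1 u * y + d 2 u * y\<^sup>2 / 2 + d 3 t0 * y ^ 3 / 6" using t0(2) by (simp only: d)
      moreover have "rayleigh_drop (u + y) = - (d 1 u + d 2 u * y + d 3 t1 * y\<^sup>2 / 2)" using t1(2) d(2)[of "u + y"] by simp
      moreover have "rayleigh u = d 0 u" "rayleigh_drop u = - d 1 u" using d(2)[of u] by (simp_all add: d(1))
      moreover have "y * a + y\<^sup>2 / 2 * (- b) - (y * (a + b * y + c * y\<^sup>2 / 2 + p * y ^ 3 / 6)
          + y\<^sup>2 / 2 * (- (b + c * y + q * y\<^sup>2 / 2))) - y\<^sup>2 * (- b) = (q / 4 - p / 6) * y ^ 4" for a b c p q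
        by (simp add: field_simps power2_eq_square power3_eq_cube power4_eq_xxxx)
      ultimately show ?thesis unfolding ballot_approx_def uy u_def[symmetric] by (simp only:)
    qed
    also have "\<bar>\<dots>\<bar> \<le> (C / (1 + u) ^ 3) * y ^ 4"
    proof -
      have "\<bar>d 3 t1 / 4 - d 3 t0 / 6\<bar> \<le> C / (1 + u) ^ 3" using b[OF t0(1)] b[OF t1(1)] by (simp only: abs_le_iff) auto
      hence "\<bar>d 3 t1 / 4 - d 3 t0 / 6\<bar> * y ^ 4 \<le> C / (1 + u) ^ 3 * y ^ 4"
        using y by (intro mult_right_mono) auto
      moreover have "\<bar>y ^ 4\<bar> = y ^ 4" by simp
      ultimately show ?thesis unfolding abs_mult by (simp only:)
    qed
    finally show ?thesis unfolding u_def by simp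
  qed
  with C(1) show ?thesis by blast
qed

text \<open>\<open>weighted_ratio_gauss\<close> leaves the decay exp (- u^2 / 2), which in w = u /
  sqrt 2 has the form \<open>poly_gauss q w\<close>. The factor 8 is the cube of the 2 in (1 + u) /
  2, a lower bound of 1 + w.\<close>

lemma ballot_ratio_approx:
  "\<exists>C\<ge>0. \<forall>n\<ge>2. \<forall>k\<ge>1. \<bar>ballot_ratio n k - ballot_ratio n (Suc k) - (1 / sqrt (real n))\<^sup>2 * rayleigh_drop (real k * (1 / sqrt (real n)))\<bar>
     \<le> C * (1 / sqrt (real n)) ^ 4 / (1 + real k * (1 / sqrt (real n))) ^ 3"
proof -
  define q where "q = ([:0, 0, 8, 0, 8:] * [:2, 0, 8:] :: real poly)"
  obtain C where C: "C \<ge> 0" "\<And>u. u \<ge> 0 \<Longrightarrow> \<bar>poly_gauss q u\<bar> \<le> C / (1 + u) ^ 3"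
    using poly_gauss_bound[of q 3] by blast
  have "\<bar>ballot_ratio n k - ballot_ratio n (Suc k) - (1 / sqrt (real n))\<^sup>2 * rayleigh_drop (real k * (1 / sqrt (real n)))\<bar>
     \<le> (8 * C) * (1 / sqrt (real n)) ^ 4 / (1 + real k * (1 / sqrt (real n))) ^ 3"
    if n: "n \<ge> 2" and k: "k \<ge> 1" for n k
  proof -
    define u where "u = real k / sqrt (real n)"
    define w where "w = u / sqrt 2"
    have n0: "real n > 0" using n by simp
    have u0: "u \<ge> 0" by (simp add: u_def)
    have w0: "w \<ge> 0" using u0 by (simp add: w_def)
    have u2: "u\<^sup>2 = (real k)\<^sup>2 / real n" by (simp add: u_def power_divide)
    have w2: "u\<^sup>2 = 2 * w\<^sup>2" by (simp add: w_def power_divide)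
    have w4: "u ^ 4 = 4 * w ^ 4"
    proof -
      have "u ^ 4 = (u\<^sup>2)\<^sup>2" by simp
      also have "\<dots> = 4 * w ^ 4" unfolding w2 by (simp add: power_mult_distrib)
      finally show ?thesis .
    qed
    have "ballot_ratio n k - ballot_ratio n (Suc k) - (1 / sqrt (real n))\<^sup>2 * rayleigh_drop u = (weighted_ratio n k - exp (- u\<^sup>2)) * (4 * u\<^sup>2 - 2) / real n"
    proof -
      have "ballot_ratio n k - ballot_ratio n (Suc k) = weighted_ratio n k * (4 * u\<^sup>2 - 2) / real n"
        using ballot_ratio_diff[of n k] n k unfolding u2 by simp
      moreover have "(1 / sqrt (real n))\<^sup>2 * rayleigh_drop u = exp (- u\<^sup>2) * (4 * u\<^sup>2 - 2) / real n"
        by (simp add: rayleigh_drop_def poly_gauss_def power_divide) (simp add: power2_eq_square algebra_simps)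
      ultimately show ?thesis by (simp only: left_diff_distrib diff_divide_distrib)
    qed
    also have "\<bar>\<dots>\<bar> \<le> (4 * u\<^sup>2 + 2 * u ^ 4) / real n * exp (- u\<^sup>2 / 2) * (4 * u\<^sup>2 + 2) / real n"
    proof -
      have "\<bar>4 * a - 2\<bar> \<le> 4 * a + 2" if "a \<ge> 0" for a :: real using that by (simp add: abs_le_iff)
      hence "\<bar>weighted_ratio n k - exp (- u\<^sup>2)\<bar> * \<bar>4 * u\<^sup>2 - 2\<bar> \<le> (4 * u\<^sup>2 + 2 * u ^ 4) / real n * exp (- u\<^sup>2 / 2) * (4 * u\<^sup>2 + 2)"
        using weighted_ratio_gauss[OF n k, folded u_def] by (intro mult_mono) auto
      then show ?thesis unfolding abs_mult abs_divide using n0 by (intro divide_mono) auto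
    qed
    also have "\<dots> = poly_gauss q w / (real n)\<^sup>2"
      unfolding w2 w4 by (simp add: poly_gauss_def q_def power2_eq_square power4_eq_xxxx algebra_simps)
    also have "\<dots> \<le> 8 * C / (1 + u) ^ 3 / (real n)\<^sup>2"
    proof (rule divide_right_mono)
      have "poly_gauss q w \<le> C / (1 + w) ^ 3" using C(2)[OF w0] by simp
      also have "\<dots> \<le> C / ((1 + u) / 2) ^ 3"
      proof (intro divide_left_mono power_mono)
        have "u / 2 \<le> w" unfolding w_def using u0 by (intro divide_left_mono) (auto intro: less_imp_le sqrt2_less_2)
        then show "(1 + u) / 2 \<le> 1 + w" by simp
      qed (use C(1) u0 w0 in auto)
      also have "\<dots> = 8 * C / (1 + u) ^ 3" by (simp add: power_divide)
      finally show "poly_gauss q w \<le> 8 * C / (1 + u) ^ 3" .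
    qed simp
    also have "\<dots> = (8 * C) * (1 / sqrt (real n)) ^ 4 / (1 + u) ^ 3"
    proof -
      have "sqrt (real n) ^ 4 = ((sqrt (real n))\<^sup>2)\<^sup>2" by (simp only: power_mult[symmetric]) simp
      also have "\<dots> = (real n)\<^sup>2" by simp
      finally show ?thesis by (simp add: power_divide)
    qed
    finally show ?thesis by (simp add: u_def)
  qed
  with C(1) show ?thesis by (intro exI[of _ "8 * C"]) auto
qed

lemma sum_inverse_squares_multiples:
  assumes y: "y > (0::real)"
  shows "summable (\<lambda>k. 1 / (1 + real (Suc k) * y)\<^sup>2)" "(\<Sum>k. 1 / (1 + real (Suc k) * y)\<^sup>2) \<le> 1 / y"
proof -
  define c where "c = (\<lambda>j. inverse (1 + real j * y))"
  have c_lim: "c \<longlonglongrightarrow> 0"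
    unfolding c_def
    by (intro tendsto_inverse_0_at_top filterlim_tendsto_add_at_top[OF tendsto_const]
        filterlim_at_top_mult_tendsto_pos[OF tendsto_const y filterlim_real_sequentially])
  have c: "1 / (1 + real (Suc j) * y)\<^sup>2 \<le> (c j - c (Suc j)) / y" for j
  proof -
    have p: "1 + real j * y > 0" "1 + real (Suc j) * y > 0" using y by (auto intro!: add_pos_nonneg)
    have "(c j - c (Suc j)) / y = c j * c (Suc j)"
    proof -
      have "1 + real (Suc j) * y = (1 + real j * y) + y" by (simp add: algebra_simps)
      moreover have "(inverse a - inverse (a + y)) / y = inverse a * inverse (a + y)" if "a > 0" for a :: real
      proof -
        have "a + y > 0" using that y by simp
        then show ?thesis using that y by (simp add: divide_simps)
      qed
      ultimately show ?thesis unfolding c_def using p by (simp only:)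
    qed
    moreover have "c (Suc j) \<le> c j"
      using p y unfolding c_def by (intro le_imp_inverse_le) (auto simp: algebra_simps)
    hence "c (Suc j) * c (Suc j) \<le> c j * c (Suc j)"
      using p by (intro mult_right_mono) (auto simp: c_def)
    moreover have "1 / (1 + real (Suc j) * y)\<^sup>2 = c (Suc j) * c (Suc j)"
      by (simp add: c_def power2_eq_square inverse_eq_divide)
    ultimately show ?thesis by simp
  qed
  have t: "(\<lambda>j. (c j - c (Suc j)) / y) sums ((c 0 - 0) / y)"
    by (intro sums_divide telescope_sums' c_lim)
  show s: "summable (\<lambda>k. 1 / (1 + real (Suc k) * y)\<^sup>2)"
    by (rule summable_comparison_test'[OF sums_summable[OF t], of 0]) (use c in auto)
  have "(\<Sum>k. 1 / (1 + real (Suc k) * y)\<^sup>2) \<le> (\<Sum>j. (c j - c (Suc j)) / y)"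
    by (rule suminf_le[OF c s sums_summable[OF t]])
  also have "\<dots> = 1 / y" using sums_unique[OF t] by (simp add: c_def)
  finally show "(\<Sum>k. 1 / (1 + real (Suc k) * y)\<^sup>2) \<le> 1 / y" .
qed

lemma poly_gauss_summable_abs:
  assumes "x > 0"
  shows "summable (\<lambda>j. \<bar>poly_gauss p (real (Suc j) * x)\<bar>)"
proof -
  obtain C where "\<forall>x>0. \<forall>j. \<bar>real (Suc j) ^ 0 * poly_gauss p (real (Suc j) * x)\<bar> \<le> C / x ^ 2 * inverse (real (Suc j) ^ 2)"
    using gsum_term_bound[of 0 2 p] by auto
  then show ?thesis using assms
    by (intro summable_comparison_test'[OF summable_mult[OF inverse_squares_summable], of 0 _ "C / x ^ 2"])
      (unfold real_norm_def, auto)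
qed

lemma ballot_approx_summable: "y > 0 \<Longrightarrow> summable (\<lambda>k. \<bar>ballot_approx y (Suc k)\<bar>)"
proof -
  assume y: "y > 0"
  show ?thesis
  proof (rule summable_comparison_test'[of "\<lambda>k. y * \<bar>rayleigh (real (Suc k) * y)\<bar> + y\<^sup>2 / 2 * \<bar>rayleigh_drop (real (Suc k) * y)\<bar>" 0])
    show "summable (\<lambda>k. y * \<bar>rayleigh (real (Suc k) * y)\<bar> + y\<^sup>2 / 2 * \<bar>rayleigh_drop (real (Suc k) * y)\<bar>)"
      unfolding rayleigh_def rayleigh_drop_def by (intro summable_add summable_mult poly_gauss_summable_abs y)
    fix k
    have "\<bar>ballot_approx y (Suc k)\<bar> \<le> \<bar>y * rayleigh (real (Suc k) * y)\<bar> + \<bar>y\<^sup>2 / 2 * rayleigh_drop (real (Suc k) * y)\<bar>"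
      unfolding ballot_approx_def by (rule abs_triangle_ineq)
    then show "norm \<bar>ballot_approx y (Suc k)\<bar> \<le> y * \<bar>rayleigh (real (Suc k) * y)\<bar> + y\<^sup>2 / 2 * \<bar>rayleigh_drop (real (Suc k) * y)\<bar>"
      using y by (simp add: abs_mult)
  qed
qed

text \<open>The integral of \<open>rayleigh\<close> over the half-line is 1, so the leading term y /
  (m y) is exactly 1 / m, matching the trend in \<open>msum_abel\<close>.\<close>

lemma msum_ballot_approx:
  assumes y: "y > 0" and m: "m \<ge> 1"
  shows "msum (ballot_approx y) m = 1 / real m + y * rayleigh_error (real m * y) + y\<^sup>2 / 2 * drop_series (real m * y)"
proof -
  have x: "real m * y > 0" using y m by simp
  have e: "real (Suc j * m) * y = real (Suc j) * (real m * y)" for j by (simp only: of_nat_mult mult.assoc)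
  have "msum (ballot_approx y) m = (\<Sum>j. y * (real (Suc j) ^ 0 * poly_gauss [:0, 2:] (real (Suc j) * (real m * y)))
      + y\<^sup>2 / 2 * (real (Suc j) ^ 0 * poly_gauss [:-2, 0, 4:] (real (Suc j) * (real m * y))))"
    unfolding msum_def ballot_approx_def rayleigh_def rayleigh_drop_def e by simp
  also have "\<dots> = y * gsum 0 [:0, 2:] (real m * y) + y\<^sup>2 / 2 * gsum 0 [:-2, 0, 4:] (real m * y)"
  proof -
    have s: "(\<lambda>j. real (Suc j) ^ 0 * poly_gauss p (real (Suc j) * (real m * y))) sums gsum 0 p (real m * y)" for p
      unfolding gsum_def by (rule summable_sums[OF gsum_summable[OF x]])
    show ?thesis by (rule sums_unique[symmetric], intro sums_add sums_mult s)
  qed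
  also have "y * gsum 0 [:0, 2:] (real m * y) = 1 / real m + y * rayleigh_error (real m * y)"
    using y m by (simp add: rayleigh_error_def field_simps)
  finally show ?thesis by (simp add: drop_series_def)
qed

section \<open>Errors on a single level\<close>

definition ballot_error :: "nat \<Rightarrow> nat \<Rightarrow> real" where
  "ballot_error n k = ballot_ratio n k - ballot_approx (1 / sqrt (real n)) k"

lemma ballot_ratio_summable: "n > 0 \<Longrightarrow> summable (\<lambda>k. \<bar>ballot_ratio n (Suc k)\<bar>)"
  by (rule summable_finite[of "{..<n}"]) (auto intro!: ballot_ratio_eq_0)

lemma ballot_error_summable: "n > 0 \<Longrightarrow> summable (\<lambda>k. \<bar>ballot_error n (Suc k)\<bar>)"
  by (rule summable_comparison_test'[OF summable_add[OF ballot_ratio_summable ballot_approx_summable], of n "1 / sqrt (real n)" 0])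
    (auto simp: ballot_error_def)

lemma msum_ballot_error:
  assumes "n > 0" "m \<ge> 1"
  shows "msum (ballot_error n) m = msum (ballot_ratio n) m - msum (ballot_approx (1 / sqrt (real n))) m"
  unfolding msum_def ballot_error_def using assms
  by (intro suminf_diff[symmetric] msum_summable ballot_ratio_summable ballot_approx_summable) auto

lemma ballot_error_diff:
  "\<exists>C\<ge>0. \<forall>n\<ge>2. \<forall>k\<ge>1. \<bar>ballot_error n k - ballot_error n (Suc k)\<bar> \<le> C * (1 / sqrt (real n)) ^ 4 / (1 + real k * (1 / sqrt (real n))) ^ 3"
proof -
  from ballot_approx_diff obtain C where C: "C \<ge> 0" "\<And>y k. y > 0 \<Longrightarrow> \<bar>ballot_approx y k - ballot_approx y (Suc k) - y\<^sup>2 * rayleigh_drop (real k * y)\<bar> \<le> C * y ^ 4 / (1 + real k * y) ^ 3"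
    by blast
  from ballot_ratio_approx obtain D where D: "D \<ge> 0" "\<And>n k. n \<ge> 2 \<Longrightarrow> k \<ge> 1 \<Longrightarrow> \<bar>ballot_ratio n k - ballot_ratio n (Suc k) - (1 / sqrt (real n))\<^sup>2 * rayleigh_drop (real k * (1 / sqrt (real n)))\<bar>
     \<le> D * (1 / sqrt (real n)) ^ 4 / (1 + real k * (1 / sqrt (real n))) ^ 3" by blast
  have "\<bar>ballot_error n k - ballot_error n (Suc k)\<bar> \<le> (C + D) * (1 / sqrt (real n)) ^ 4 / (1 + real k * (1 / sqrt (real n))) ^ 3"
    if "n \<ge> 2" "k \<ge> 1" for n k
  proof -
    define y where "y = 1 / sqrt (real n)"
    have y: "y > 0" using that by (simp add: y_def)
    have tri: "\<bar>(a - b) - (a' - b')\<bar> \<le> (C' + D') " if "\<bar>a' - b' - t\<bar> \<le> C'" "\<bar>a - b - t\<bar> \<le> D'" for a b a' b' t C' D' :: real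
      using that by (simp only: abs_le_iff) auto
    have "\<bar>ballot_error n k - ballot_error n (Suc k)\<bar> = \<bar>(ballot_ratio n k - ballot_ratio n (Suc k)) - (ballot_approx y k - ballot_approx y (Suc k))\<bar>"
      by (simp add: ballot_error_def y_def algebra_simps)
    also have "\<dots> \<le> C * y ^ 4 / (1 + real k * y) ^ 3 + D * y ^ 4 / (1 + real k * y) ^ 3"
      by (rule tri[OF C(2)[OF y] D(2)[OF that, folded y_def]])
    also have "\<dots> = (C + D) * y ^ 4 / (1 + real k * y) ^ 3"
      by (simp add: distrib_right add_divide_distrib)
    finally show ?thesis by (simp only: y_def)
  qed
  with C(1) D(1) show ?thesis by (intro exI[of _ "C + D"]) auto
qed

text \<open>Subtracting \<open>msum_abel\<close> for m and for M = m + 1 leaves the weights of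
  \<open>mod_diff_bound\<close>, at most sqrt (2 k / M). With y = 1 / sqrt n and u = k y, the
  estimate sqrt u < 1 + u reduces the sum to a multiple of y^4 / sqrt (M y) times the sum of 1 / (1
  + k y)^2, which is at most 1 / y. Multiplication by n = 1 / y^2 leaves the order sqrt y / sqrt
  M.\<close>

lemma ballot_error_level:
  "\<exists>C\<ge>0. \<forall>n\<ge>2. \<forall>r. real n * \<bar>msum (ballot_error n) (2 ^ Suc r - 1) - msum (ballot_error n) (2 ^ Suc r)
     - (1 / real (2 ^ Suc r - 1) - 1 / real (2 ^ Suc r)) * msum (ballot_error n) 1\<bar>
     \<le> C * sqrt (1 / sqrt (real n)) * (1 / sqrt 2) ^ Suc r"
proof -
  from ballot_error_diff obtain C where C: "C \<ge> 0" "\<And>n k. n \<ge> 2 \<Longrightarrow> k \<ge> 1 \<Longrightarrow> \<bar>ballot_error n k - ballot_error n (Suc k)\<bar>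
     \<le> C * (1 / sqrt (real n)) ^ 4 / (1 + real k * (1 / sqrt (real n))) ^ 3" by blast
  have "real n * \<bar>msum (ballot_error n) (2 ^ Suc r - 1) - msum (ballot_error n) (2 ^ Suc r)
     - (1 / real (2 ^ Suc r - 1) - 1 / real (2 ^ Suc r)) * msum (ballot_error n) 1\<bar>
     \<le> (C * sqrt 2) * sqrt (1 / sqrt (real n)) * (1 / sqrt 2) ^ Suc r"
    if n: "n \<ge> 2" for n r
  proof -
    define y where "y = 1 / sqrt (real n)"
    have y: "y > 0" using n by (simp add: y_def)
    define M :: nat where "M = 2 ^ Suc r"
    define m :: nat where "m = M - 1"
    have m: "m \<ge> 1" "M = Suc m" unfolding m_def M_def by (cases "2 ^ r :: nat"; simp)+
    have M1: "M \<ge> 1" using m by simp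
    note sm = ballot_error_summable[of n]
    define h where "h = (\<lambda>k. (real (Suc k mod m) / real m - real (Suc k mod M) / real M) * (ballot_error n (Suc k) - ballot_error n (Suc (Suc k))))"
    have h: "h sums ((msum (ballot_error n) 1 / real m - msum (ballot_error n) m) - (msum (ballot_error n) 1 / real M - msum (ballot_error n) M))"
      unfolding h_def left_diff_distrib using n m M1
      by (intro sums_diff[unfolded left_diff_distrib] msum_abel sm) auto
    define B where "B = (\<lambda>k. C * sqrt 2 / sqrt (real M) * y ^ 4 / sqrt y * (1 / (1 + real (Suc k) * y)\<^sup>2))"
    have hB: "\<bar>h k\<bar> \<le> B k" for k
    proof -
      define u where "u = real (Suc k) * y"
      have u: "u > 0" using y by (simp add: u_def)
      have k1: "Suc k \<ge> 1" by simp
      have "\<bar>h k\<bar> \<le> sqrt (2 * real (Suc k) / real M) * (C * y ^ 4 / (1 + u) ^ 3)"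
        unfolding h_def abs_mult u_def
        by (intro mult_mono mod_diff_bound k1 m C(2)[OF n k1, folded y_def]) auto
      also have "sqrt (2 * real (Suc k) / real M) = sqrt 2 / sqrt (real M) * (sqrt u / sqrt y)"
        using y by (simp add: u_def real_sqrt_mult real_sqrt_divide del: of_nat_Suc)
      also have "\<dots> * (C * y ^ 4 / (1 + u) ^ 3) \<le> sqrt 2 / sqrt (real M) * ((1 + u) / sqrt y) * (C * y ^ 4 / (1 + u) ^ 3)"
      proof -
        have "u \<le> (1 + u)\<^sup>2" using u by (simp add: power2_eq_square algebra_simps)
        hence "sqrt u \<le> sqrt ((1 + u)\<^sup>2)" by (rule real_sqrt_le_mono)
        hence "sqrt u \<le> 1 + u" using u by simp
        then show ?thesis using y u C(1)
          by (intro mult_right_mono mult_left_mono divide_right_mono) auto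
      qed
      also have "\<dots> = B k"
      proof -
        have "(1 + u) / (1 + u) ^ 3 = 1 / (1 + u)\<^sup>2" using u by (simp add: power2_eq_square power3_eq_cube)
        hence "a * ((1 + u) / s) * (c / (1 + u) ^ 3) = a * c / s * (1 / (1 + u)\<^sup>2)" for a c s :: real
        proof -
          have "a * ((1 + u) / s) * (c / (1 + u) ^ 3) = a * c / s * ((1 + u) / (1 + u) ^ 3)"
            by (simp add: mult_ac)
          then show ?thesis unfolding \<open>(1 + u) / (1 + u) ^ 3 = 1 / (1 + u)\<^sup>2\<close> .
        qed
        from this[of "sqrt 2 / sqrt (real M)" "sqrt y" "C * y ^ 4"]
        show ?thesis unfolding B_def u_def[symmetric] by (simp only: mult_ac times_divide_eq_left times_divide_eq_right)
      qed
      finally show ?thesis .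
    qed
    have Bs: "summable B" unfolding B_def by (intro summable_mult sum_inverse_squares_multiples y)
    have "\<bar>suminf h\<bar> \<le> suminf B"
      using hB Bs by (intro norm_suminf_le[where 'a = real, unfolded real_norm_def])
    also have "suminf B = C * sqrt 2 / sqrt (real M) * y ^ 4 / sqrt y * (\<Sum>k. 1 / (1 + real (Suc k) * y)\<^sup>2)"
      unfolding B_def by (rule suminf_mult[OF sum_inverse_squares_multiples(1)[OF y]])
    also have "\<dots> \<le> C * sqrt 2 / sqrt (real M) * y ^ 4 / sqrt y * (1 / y)"
      using sum_inverse_squares_multiples(2)[OF y] C(1) y by (intro mult_left_mono) auto
    finally have "real n * \<bar>suminf h\<bar> \<le> real n * (C * sqrt 2 / sqrt (real M) * y ^ 4 / sqrt y * (1 / y))"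
      by (intro mult_left_mono) auto
    also have "\<dots> = (C * sqrt 2) * sqrt y * (1 / sqrt (real M))"
    proof -
      have ny: "real n * y\<^sup>2 = 1" using n by (simp add: y_def power_divide)
      have "y ^ 4 / sqrt y * (1 / y) = y\<^sup>2 * sqrt y"
      proof -
        have "y ^ 4 / sqrt y * (1 / y) = y\<^sup>2 * (y / sqrt y)"
          using y by (simp add: power2_eq_square power4_eq_xxxx)
        also have "y / sqrt y = sqrt y" using y by (simp add: real_div_sqrt)
        finally show ?thesis .
      qed
      moreover have "real n * (C * sqrt 2 / sqrt (real M) * y ^ 4 / sqrt y * (1 / y)) =
         real n * (C * sqrt 2 / sqrt (real M) * (y ^ 4 / sqrt y * (1 / y)))" by simp
      ultimately have "real n * (C * sqrt 2 / sqrt (real M) * y ^ 4 / sqrt y * (1 / y)) =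
         real n * (C * sqrt 2 / sqrt (real M) * (y\<^sup>2 * sqrt y))" by (simp only:)
      also have "\<dots> = C * sqrt 2 / sqrt (real M) * (real n * y\<^sup>2) * sqrt y" by (simp add: mult_ac)
      finally have "real n * (C * sqrt 2 / sqrt (real M) * y ^ 4 / sqrt y * (1 / y)) =
         C * sqrt 2 / sqrt (real M) * (real n * y\<^sup>2) * sqrt y" .
      then show ?thesis unfolding ny by simp
    qed
    also have "1 / sqrt (real M) = (1 / sqrt 2) ^ Suc r"
      unfolding M_def by (simp only: of_nat_power of_nat_numeral real_sqrt_power power_one_over)
    finally have fin: "real n * \<bar>suminf h\<bar> \<le> C * sqrt 2 * sqrt y * (1 / sqrt 2) ^ Suc r" .
    have "suminf h = - (msum (ballot_error n) m - msum (ballot_error n) M - (1 / real m - 1 / real M) * msum (ballot_error n) 1)"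
      using sums_unique[OF h] by (simp add: algebra_simps)
    hence abs: "\<bar>suminf h\<bar> = \<bar>msum (ballot_error n) m - msum (ballot_error n) M - (1 / real m - 1 / real M) * msum (ballot_error n) 1\<bar>"
      by (simp only: abs_minus_cancel)
    show ?thesis using fin unfolding abs unfolding m_def M_def y_def .
  qed
  then show ?thesis using C(1) by (intro exI[of _ "C * sqrt 2"]) auto
qed

text \<open>The smaller of the two bounds stays below C / sqrt x on either side of 1. Along x = 2^(r
  + 1) y this is geometric in \<open>r\<close> with ratio 1 / sqrt 2, as in
  \<open>ballot_error_level\<close>.\<close>

lemma pow_min_bound:
  assumes "\<exists>C\<ge>0. \<forall>x>0. \<bar>f x\<bar> \<le> C \<and> \<bar>f x\<bar> \<le> C / x ^ q" "q \<ge> 1"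
  shows "\<exists>C\<ge>0. \<forall>x>0. \<bar>f x\<bar> \<le> C / sqrt (x::real)"
proof -
  from assms(1) obtain C where C: "C \<ge> 0" "\<And>x. x > 0 \<Longrightarrow> \<bar>f x\<bar> \<le> C" "\<And>x. x > 0 \<Longrightarrow> \<bar>f x\<bar> \<le> C / x ^ q" by blast
  have "\<bar>f x\<bar> \<le> C / sqrt x" if x: "x > 0" for x
  proof (cases "x \<le> 1")
    case True
    have "\<bar>f x\<bar> \<le> C / 1" using C(2)[OF x] by simp
    also have "\<dots> \<le> C / sqrt x" using x True C(1) by (intro divide_left_mono) auto
    finally show ?thesis .
  next
    case False
    have "sqrt x \<le> x" using False by (simp add: real_le_lsqrt power2_eq_square)
    also have "\<dots> \<le> x ^ q" using False assms(2) by (intro self_le_power) auto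
    finally have le: "sqrt x \<le> x ^ q" .
    have "\<bar>f x\<bar> \<le> C / x ^ q" using C(3)[OF x] .
    also have "\<dots> \<le> C / sqrt x" using x le C(1) by (intro divide_left_mono) auto
    finally show ?thesis .
  qed
  with C(1) show ?thesis by blast
qed

text \<open>As \<open>2 * y \<le> x\<close>, the intermediate point of the mean value theorem is at
  least x / 2; this costs the factor sqrt 2.\<close>

lemma level_diff:
  assumes der: "\<And>x. x > 0 \<Longrightarrow> (F has_real_derivative f x) (at x)"
    and b: "\<And>x. x > 0 \<Longrightarrow> \<bar>f x\<bar> \<le> C / sqrt x" and "C \<ge> 0"
    and y: "0 < y" "2 * y \<le> x" and z: "x - y \<le> z" "z \<le> x"
  shows "\<bar>F z - F x\<bar> \<le> C * sqrt 2 * y / sqrt x"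
proof (cases "z = x")
  case True
  then show ?thesis using assms by simp
next
  case False
  have x: "x > 0" "z > 0" "z < x" using y z False by simp_all
  obtain t where t: "z < t" "t < x" "F x - F z = (x - z) * f t"
    using MVT2[OF x(3), of F f] der x(2) by force
  have "x / 2 \<le> t" using t(1) z y by simp
  hence s: "sqrt (x / 2) \<le> sqrt t" by (rule real_sqrt_le_mono)
  have "\<bar>F z - F x\<bar> = (x - z) * \<bar>f t\<bar>" using t(3) x by (simp add: abs_minus_commute[of "F z"] abs_mult)
  also have "\<dots> \<le> y * (C / sqrt (x / 2))"
  proof (rule mult_mono)
    have "\<bar>f t\<bar> \<le> C / sqrt t" using b t x by simp
    also have "\<dots> \<le> C / sqrt (x / 2)" using s x \<open>C \<ge> 0\<close> t by (intro divide_left_mono) auto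
    finally show "\<bar>f t\<bar> \<le> C / sqrt (x / 2)" .
  qed (use z x y in auto)
  also have "\<dots> = C * sqrt 2 * y / sqrt x" by (simp add: real_sqrt_divide)
  finally show ?thesis .
qed

text \<open>With y = 1 / sqrt n and x = 2^(r + 1) y, the factor n y equals 1 / y, so the mean value
  theorem turns the change of \<open>rayleigh_error\<close> from x to x - y into a value of
  \<open>level_fun\<close> close to x. The total mass of \<open>ballot_approx\<close> is 1 + y^2
  (1/2 - 1/6) up to higher order; multiplied by n, its excess leaves the correction with denominator
  3.\<close>

lemma level_main:
  "\<exists>C\<ge>0. \<forall>n\<ge>2. \<forall>r. \<bar>real n * (msum (ballot_approx (1 / sqrt (real n))) (2 ^ Suc r - 1) - msum (ballot_approx (1 / sqrt (real n))) (2 ^ Suc r)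
     - (1 / real (2 ^ Suc r - 1) - 1 / real (2 ^ Suc r)) * msum (ballot_approx (1 / sqrt (real n))) 1)
     - (level_fun (2 ^ Suc r / sqrt (real n)) - (1 / real (2 ^ Suc r - 1) - 1 / real (2 ^ Suc r)) / 3)\<bar>
     \<le> C * sqrt (1 / sqrt (real n)) * (1 / sqrt 2) ^ Suc r"
proof -
  obtain C1 where C1: "C1 \<ge> 0" "\<And>x. x > 0 \<Longrightarrow> \<bar>level_fun' x\<bar> \<le> C1 / sqrt x" using pow_min_bound[OF level_fun'_bound] by auto
  obtain C2 where C2: "C2 \<ge> 0" "\<And>x. x > 0 \<Longrightarrow> \<bar>drop_series' x\<bar> \<le> C2 / sqrt x" using pow_min_bound[OF drop_series'_bound] by auto
  obtain C3 where C3: "C3 \<ge> 0" "\<And>x. x > 0 \<Longrightarrow> x \<le> 1 \<Longrightarrow> \<bar>rayleigh_error x + x / 6\<bar> \<le> C3 * x ^ 2" using rayleigh_error_near_0 by blast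
  obtain C4 where C4: "C4 \<ge> 0" "\<And>x. x > 0 \<Longrightarrow> x \<le> 1 \<Longrightarrow> \<bar>drop_series x - 1\<bar> \<le> C4 * x\<^sup>2" using drop_series_near_0 by blast
  define D where "D = C1 * sqrt 2 + C2 * sqrt 2 / 2 + 2 * (C3 + C4 / 2)"
  have "\<bar>real n * (msum (ballot_approx (1 / sqrt (real n))) (2 ^ Suc r - 1) - msum (ballot_approx (1 / sqrt (real n))) (2 ^ Suc r)
     - (1 / real (2 ^ Suc r - 1) - 1 / real (2 ^ Suc r)) * msum (ballot_approx (1 / sqrt (real n))) 1)
     - (level_fun (2 ^ Suc r / sqrt (real n)) - (1 / real (2 ^ Suc r - 1) - 1 / real (2 ^ Suc r)) / 3)\<bar>
     \<le> D * sqrt (1 / sqrt (real n)) * (1 / sqrt 2) ^ Suc r" if n: "n \<ge> 2" for n r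
  proof -
    define y where "y = 1 / sqrt (real n)"
    have "sqrt (real n) \<ge> 1" using n by simp
    hence y: "y > 0" "y \<le> 1" using n by (simp_all add: y_def)
    define M :: nat where "M = 2 ^ Suc r"
    define m :: nat where "m = M - 1"
    have m: "m \<ge> 1" "M = Suc m" unfolding m_def M_def by (cases "2 ^ r :: nat"; simp)+
    have M1: "M \<ge> 2" using m by simp
    define c where "c = 1 / real m - 1 / real M"
    define x where "x = real M * y"
    have xm: "real m * y = x - y" by (simp add: x_def m algebra_simps)
    have x2: "2 * y \<le> x" unfolding x_def using M1 y by (intro mult_right_mono) auto
    have x0: "x > 0" using x2 y by simp
    have ny: "real n * y = 1 / y" "real n * y\<^sup>2 = 1"
    proof -
      show "real n * y\<^sup>2 = 1" using n by (simp add: y_def power_divide)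
      then show "real n * y = 1 / y" using y by (simp add: power2_eq_square field_simps)
    qed
    have xy: "y / sqrt x = sqrt y * (1 / sqrt 2) ^ Suc r"
    proof -
      have "y / sqrt x = (y / sqrt y) * (1 / sqrt (real M))"
        by (simp add: x_def real_sqrt_mult mult.commute)
      also have "y / sqrt y = sqrt y" using y by (simp add: real_div_sqrt)
      also have "1 / sqrt (real M) = (1 / sqrt 2) ^ Suc r"
        unfolding M_def by (simp only: of_nat_power of_nat_numeral real_sqrt_power power_one_over)
      finally show ?thesis .
    qed
    have d1: "msum (ballot_approx y) m = 1 / real m + y * rayleigh_error (x - y) + y\<^sup>2 / 2 * drop_series (x - y)"
      using msum_ballot_approx[OF y(1) m(1)] unfolding xm .
    have d2: "msum (ballot_approx y) M = 1 / real M + y * rayleigh_error x + y\<^sup>2 / 2 * drop_series x"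
      using msum_ballot_approx[OF y(1), of M] M1 unfolding x_def by simp
    have d3: "msum (ballot_approx y) 1 = 1 + y * rayleigh_error y + y\<^sup>2 / 2 * drop_series y"
      using msum_ballot_approx[OF y(1), of 1] by simp
    obtain \<xi> where xi: "x - y < \<xi>" "\<xi> < x" "rayleigh_error x - rayleigh_error (x - y) = y * (- level_fun \<xi>)"
      using MVT2[of "x - y" x rayleigh_error "\<lambda>x. - level_fun x"] rayleigh_error_deriv y x2 by force
    have "real n * (msum (ballot_approx y) m - msum (ballot_approx y) M - c * msum (ballot_approx y) 1) =
        real n * y * (rayleigh_error (x - y) - rayleigh_error x) + real n * y\<^sup>2 * ((drop_series (x - y) - drop_series x) / 2)
        - c * (real n * y * rayleigh_error y + real n * y\<^sup>2 * (drop_series y / 2))"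
    proof -
      have "N * ((p + y * a + y\<^sup>2 / 2 * k) - (q + y * a' + y\<^sup>2 / 2 * k') - (p - q) * (1 + y * a'' + y\<^sup>2 / 2 * k''))
        = N * y * (a - a') + N * y\<^sup>2 * ((k - k') / 2) - (p - q) * (N * y * a'' + N * y\<^sup>2 * (k'' / 2))"
        for N p q a a' a'' k k' k'' :: real by (simp add: field_simps)
      then show ?thesis unfolding d1 d2 d3 c_def .
    qed
    also have "\<dots> = level_fun \<xi> + (drop_series (x - y) - drop_series x) / 2 - c * (rayleigh_error y / y + drop_series y / 2)"
    proof -
      have "rayleigh_error (x - y) - rayleigh_error x = y * level_fun \<xi>" using xi(3) by simp
      then show ?thesis unfolding ny using y by simp
    qed
    finally have e: "real n * (msum (ballot_approx y) m - msum (ballot_approx y) M - c * msum (ballot_approx y) 1) - (level_fun x - c / 3)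
      = (level_fun \<xi> - level_fun x) + (drop_series (x - y) - drop_series x) / 2 - c * ((rayleigh_error y + y / 6) / y + (drop_series y - 1) / 2)"
      using y by (simp add: add_divide_distrib diff_divide_distrib algebra_simps)
    have b1: "\<bar>level_fun \<xi> - level_fun x\<bar> \<le> C1 * sqrt 2 * y / sqrt x"
      by (rule level_diff[of level_fun level_fun']) (use level_fun_deriv C1 y x2 xi in auto)
    have b2: "\<bar>drop_series (x - y) - drop_series x\<bar> \<le> C2 * sqrt 2 * y / sqrt x"
      by (rule level_diff[of drop_series drop_series']) (use drop_series_deriv C2 y x2 in auto)
    have b3: "\<bar>c * ((rayleigh_error y + y / 6) / y + (drop_series y - 1) / 2)\<bar> \<le> 2 * (C3 + C4 / 2) * y / sqrt x"
    proof -
      have "\<bar>(rayleigh_error y + y / 6) / y\<bar> \<le> C3 * y"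
        using C3(2)[OF y] y by (simp add: abs_divide divide_le_eq power2_eq_square mult.assoc)
      moreover have "\<bar>(drop_series y - 1) / 2\<bar> \<le> C4 * y / 2"
      proof -
        have "C4 * y\<^sup>2 \<le> C4 * y" using y C4(1) by (intro mult_left_mono) (auto simp: power2_eq_square mult_left_le)
        then show ?thesis using C4(2)[OF y] by simp
      qed
      ultimately have i: "\<bar>(rayleigh_error y + y / 6) / y + (drop_series y - 1) / 2\<bar> \<le> (C3 + C4 / 2) * y"
        by (intro order_trans[OF abs_triangle_ineq]) (simp add: algebra_simps)
      have ci: "c = 1 / (real m * real M)" unfolding c_def using m by (simp add: field_simps)
      have mp: "0 < real m" "0 < real M" "real M \<le> 2 * real m" using m by auto
      have c: "0 \<le> c" "c \<le> 2 / (real M * real M)"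
      proof -
        show "0 \<le> c" unfolding ci by simp
        have "real M * real M \<le> 2 * real m * real M" using mp by (intro mult_right_mono) auto
        hence "2 / (2 * real m * real M) \<le> 2 / (real M * real M)"
          using mp by (intro divide_left_mono) auto
        then show "c \<le> 2 / (real M * real M)" unfolding ci using mp by simp
      qed
      \<comment> \<open>Crude, but it brings this contribution to the form y / sqrt x of the other
        two.\<close>
      have "sqrt x \<le> real M * real M"
      proof -
        have "x \<le> real M" unfolding x_def using y by (simp add: mult_left_le)
        hence "sqrt x \<le> sqrt (real M)" by (rule real_sqrt_le_mono)
        also have "\<dots> \<le> real M" using M1 by (intro real_le_lsqrt) (auto simp: power2_eq_square)
        also have "\<dots> \<le> real M * real M" using M1 by simp
        finally show ?thesis .
      qed
      hence "2 / (real M * real M) \<le> 2 / sqrt x" using x0 M1 by (intro divide_left_mono) auto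
      with c have c': "c \<le> 2 / sqrt x" by simp
      have "\<bar>c * ((rayleigh_error y + y / 6) / y + (drop_series y - 1) / 2)\<bar> \<le> (2 / sqrt x) * ((C3 + C4 / 2) * y)"
        unfolding abs_mult using c c' i x0 by (intro mult_mono) auto
      then show ?thesis by (simp add: mult_ac)
    qed
    have "\<bar>real n * (msum (ballot_approx y) m - msum (ballot_approx y) M - c * msum (ballot_approx y) 1) - (level_fun x - c / 3)\<bar> \<le> D * (y / sqrt x)"
    proof -
      have g: "\<bar>a + b / 2 - d\<bar> \<le> A + B / 2 + E" if "\<bar>a\<bar> \<le> A" "\<bar>b\<bar> \<le> B" "\<bar>d\<bar> \<le> E" for a b d A B E :: real
        using that by (simp only: abs_le_iff) auto
      have "\<bar>real n * (msum (ballot_approx y) m - msum (ballot_approx y) M - c * msum (ballot_approx y) 1) - (level_fun x - c / 3)\<bar>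
         \<le> C1 * sqrt 2 * y / sqrt x + C2 * sqrt 2 * y / sqrt x / 2 + 2 * (C3 + C4 / 2) * y / sqrt x"
        unfolding e by (rule g[OF b1 b2 b3])
      also have "\<dots> = D * (y / sqrt x)" by (simp add: D_def algebra_simps add_divide_distrib)
      finally show ?thesis .
    qed
    then show ?thesis unfolding xy by (simp add: m_def M_def c_def x_def y_def mult.assoc)
  qed
  moreover have "D \<ge> 0" using C1 C2 C3 C4 by (simp add: D_def)
  ultimately show ?thesis by blast
qed

section \<open>Summation over all levels\<close>

lemma geometric_inverse_sqrt_2: "(\<lambda>r. (1 / sqrt 2) ^ Suc r) sums (1 / (1 - 1 / sqrt 2) * (1 / sqrt 2))"
proof -
  have "\<bar>1 / sqrt 2\<bar> < (1::real)" by simp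
  then show ?thesis using geometric_sums[of "1 / sqrt 2 :: real"]
    by (simp only: power_Suc2 real_norm_def) (intro sums_mult2, simp)
qed

lemma alpha_sums: "(\<lambda>r. 1 / real (2 ^ Suc r - 1) - 1 / real (2 ^ Suc r)) sums (alpha - 1)"
proof -
  have e: "real (2 ^ Suc r - 1) = 2 ^ Suc r - 1" for r by (simp add: of_nat_diff)
  have g: "(\<lambda>r. 1 / real (2 ^ Suc r)) sums 1"
    using power_half_series by (simp add: power_one_over divide_simps)
  have "summable (\<lambda>r. 1 / (2 ^ Suc r - 1 :: real))"
  proof (rule summable_comparison_test'[OF summable_mult[OF sums_summable[OF g], of 2], of 0])
    fix r
    have "(2::real) ^ Suc r \<ge> 2" by (simp add: self_le_power)
    then show "norm (1 / (2 ^ Suc r - 1 :: real)) \<le> 2 * (1 / real (2 ^ Suc r))"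
      by (simp add: divide_simps del: power_Suc)
  qed
  hence "(\<lambda>r. 1 / (2 ^ Suc r - 1)) sums alpha" unfolding alpha_def by (rule summable_sums)
  then show ?thesis unfolding e by (rule sums_diff[OF _ g])
qed

lemma level_fun_level_summable:
  assumes "y > 0" shows "summable (\<lambda>r. level_fun (2 ^ Suc r * y))"
proof -
  obtain C where C: "C \<ge> 0" "\<And>x. x > 0 \<Longrightarrow> \<bar>level_fun x\<bar> \<le> C / sqrt x" using pow_min_bound[OF level_fun_bound] by auto
  show ?thesis
  proof (rule summable_comparison_test'[OF summable_mult[OF sums_summable[OF geometric_inverse_sqrt_2], of "C / sqrt y"], of 0])
    fix r
    have "norm (level_fun (2 ^ Suc r * y)) \<le> C / sqrt (2 ^ Suc r * y)" using C(2)[of "2 ^ Suc r * y"] assms by simp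
    also have "\<dots> = C / sqrt y * (1 / sqrt 2) ^ Suc r"
      by (simp add: real_sqrt_mult real_sqrt_power power_one_over del: power_Suc)
    finally show "norm (level_fun (2 ^ Suc r * y)) \<le> C / sqrt y * (1 / sqrt 2) ^ Suc r" .
  qed
qed

lemma expected_main:
  "\<exists>C\<ge>0. \<forall>n\<ge>2. \<bar>expected_paths n - ((alpha - 1) * real n - (alpha - 1) / 3 + (\<Sum>r. level_fun (2 ^ Suc r * (1 / sqrt (real n)))))\<bar>
    \<le> C * sqrt (1 / sqrt (real n))"
proof -
  obtain C where C: "C \<ge> 0" "\<And>n r. n \<ge> 2 \<Longrightarrow> real n * \<bar>msum (ballot_error n) (2 ^ Suc r - 1) - msum (ballot_error n) (2 ^ Suc r)
     - (1 / real (2 ^ Suc r - 1) - 1 / real (2 ^ Suc r)) * msum (ballot_error n) 1\<bar>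
     \<le> C * sqrt (1 / sqrt (real n)) * (1 / sqrt 2) ^ Suc r" using ballot_error_level by blast
  obtain D where D: "D \<ge> 0" "\<And>n r. n \<ge> 2 \<Longrightarrow> \<bar>real n * (msum (ballot_approx (1 / sqrt (real n))) (2 ^ Suc r - 1) - msum (ballot_approx (1 / sqrt (real n))) (2 ^ Suc r)
     - (1 / real (2 ^ Suc r - 1) - 1 / real (2 ^ Suc r)) * msum (ballot_approx (1 / sqrt (real n))) 1)
     - (level_fun (2 ^ Suc r / sqrt (real n)) - (1 / real (2 ^ Suc r - 1) - 1 / real (2 ^ Suc r)) / 3)\<bar>
     \<le> D * sqrt (1 / sqrt (real n)) * (1 / sqrt 2) ^ Suc r" using level_main by blast
  define G where "G = (\<Sum>r. (1 / sqrt 2 :: real) ^ Suc r)"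
  have G: "G \<ge> 0" unfolding G_def by (rule suminf_nonneg[OF sums_summable[OF geometric_inverse_sqrt_2]]) simp
  have "\<bar>expected_paths n - ((alpha - 1) * real n - (alpha - 1) / 3 + (\<Sum>r. level_fun (2 ^ Suc r * (1 / sqrt (real n)))))\<bar>
    \<le> (C + D) * G * sqrt (1 / sqrt (real n))" if n: "n \<ge> 2" for n
  proof -
    define y where "y = 1 / sqrt (real n)"
    have y: "y > 0" using n by (simp add: y_def)
    define c where "c = (\<lambda>r. 1 / real (2 ^ Suc r - 1) - 1 / real (2 ^ Suc r))"
    define T where "T = (\<lambda>r. real n * (msum (ballot_ratio n) (2 ^ Suc r - 1) - msum (ballot_ratio n) (2 ^ Suc r)) - (real n * c r - c r / 3 + level_fun (2 ^ Suc r * y)))"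
    have "T sums (expected_paths n - (real n * (alpha - 1) - (alpha - 1) / 3 + (\<Sum>r. level_fun (2 ^ Suc r * y))))"
      unfolding T_def c_def
      by (intro sums_diff sums_add sums_mult sums_divide alpha_sums
          summable_sums[OF level_fun_level_summable[OF y]] expected_paths_sums[folded msum_def]) (use n in simp)
    note T = sums_unique[OF this]
    have bT: "\<bar>T r\<bar> \<le> (C + D) * sqrt y * (1 / sqrt 2) ^ Suc r" for r
    proof -
      define m :: nat where "m = 2 ^ Suc r - 1"
      define M :: nat where "M = 2 ^ Suc r"
      have m: "m \<ge> 1" unfolding m_def by (cases "2 ^ r :: nat"; simp)
      have M: "M \<ge> 1" unfolding M_def by simp
      have s: "msum (ballot_ratio n) k = msum (ballot_error n) k + msum (ballot_approx y) k" if "k \<ge> 1" for k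
        using msum_ballot_error[of n k] n that by (simp add: y_def)
      have 1: "msum (ballot_error n) 1 + msum (ballot_approx y) 1 = 1"
        using s[of 1] sums_unique[OF ballot_ratio_sum[of n]] n by (simp add: msum_def)
      have tri: "\<bar>N * (e1 + d1 - (exp2 + d2)) - (N * c - c / 3 + h)\<bar> \<le> A + B"
        if a: "N * \<bar>e1 - exp2 - c * e\<bar> \<le> A" and b: "\<bar>N * (d1 - d2 - c * d) - (h - c / 3)\<bar> \<le> B"
          and ed: "e + d = 1" and N: "N \<ge> 0" for N e1 exp2 d1 d2 c h e d A B :: real
      proof -
        \<comment> \<open>The exact total mass 1 enters here, split into the masses of the error and
          of the approximant; therefore the linear term is precisely \<open>N * c\<close>.\<close>
        have "N * c = N * (c * (e + d))" using ed by simp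
        hence "N * (e1 + d1 - (exp2 + d2)) - (N * c - c / 3 + h) = N * (e1 - exp2 - c * e) + (N * (d1 - d2 - c * d) - (h - c / 3))"
          by (simp add: algebra_simps)
        also have "\<bar>\<dots>\<bar> \<le> N * \<bar>e1 - exp2 - c * e\<bar> + \<bar>N * (d1 - d2 - c * d) - (h - c / 3)\<bar>"
          using N by (intro order_trans[OF abs_triangle_ineq]) (simp add: abs_mult)
        also have "\<dots> \<le> A + B" using a b by (rule add_mono)
        finally show ?thesis .
      qed
      have hy: "2 ^ Suc r / sqrt (real n) = 2 ^ Suc r * y" by (simp add: y_def)
      have A: "real n * \<bar>msum (ballot_error n) m - msum (ballot_error n) M - c r * msum (ballot_error n) 1\<bar> \<le> C * sqrt y * (1 / sqrt 2) ^ Suc r"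
        using C(2)[OF n, of r] unfolding c_def m_def M_def y_def .
      have B: "\<bar>real n * (msum (ballot_approx y) m - msum (ballot_approx y) M - c r * msum (ballot_approx y) 1) - (level_fun (2 ^ Suc r * y) - c r / 3)\<bar>
          \<le> D * sqrt y * (1 / sqrt 2) ^ Suc r"
        using D(2)[OF n, of r] unfolding hy unfolding c_def m_def M_def y_def .
      have Tr: "T r = real n * (msum (ballot_ratio n) m - msum (ballot_ratio n) M) - (real n * c r - c r / 3 + level_fun (2 ^ Suc r * y))"
        by (simp only: T_def m_def M_def)
      have "\<bar>T r\<bar> \<le> C * sqrt y * (1 / sqrt 2) ^ Suc r + D * sqrt y * (1 / sqrt 2) ^ Suc r"
        unfolding Tr s[OF m] s[OF M] by (rule tri[OF A B 1]) simp
      then show ?thesis by (simp only: distrib_right)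
    qed
    have s: "summable (\<lambda>r. (C + D) * sqrt y * (1 / sqrt 2) ^ Suc r)"
      by (rule summable_mult[OF sums_summable[OF geometric_inverse_sqrt_2]])
    have "\<bar>suminf T\<bar> \<le> (\<Sum>r. (C + D) * sqrt y * (1 / sqrt 2) ^ Suc r)"
      using bT s by (intro norm_suminf_le[where 'a = real, unfolded real_norm_def])
    also have "\<dots> = (C + D) * sqrt y * G" unfolding G_def by (rule suminf_mult[OF sums_summable[OF geometric_inverse_sqrt_2]])
    finally show ?thesis unfolding T[symmetric] y_def by (simp only: mult_ac)
  qed
  then show ?thesis using C(1) D(1) G by (intro exI[of _ "(C + D) * G"]) auto
qed

section \<open>Pointwise convergence of Fourier series\<close>

definition fmode :: "int \<Rightarrow> real \<Rightarrow> complex" where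
  "fmode k x = cis (2 * pi * of_int k * x)"

definition fcoeff :: "(real \<Rightarrow> complex) \<Rightarrow> int \<Rightarrow> complex" where
  "fcoeff f k = integral {0..1} (\<lambda>x. f x * fmode (- k) x)"

lemma fmode_add: "fmode j x * fmode k x = fmode (j + k) x"
  by (simp add: fmode_def cis_mult ring_distribs)

lemma fmode_0 [simp]: "fmode 0 x = 1" "fmode k 0 = 1" by (simp_all add: fmode_def)

lemma fmode_1 [simp]: "fmode k 1 = 1"
  using cis_multiple_2pi[of "of_int k"] by (simp add: fmode_def)

lemma fmode_diff: "fmode k (x - y) = fmode k x * fmode (- k) y"
  by (simp add: fmode_def cis_mult ring_distribs)

lemma norm_fmode [simp]: "norm (fmode k x) = 1" by (simp add: fmode_def)

lemma cnj_fmode: "cnj (fmode k x) = fmode (- k) x" by (simp add: fmode_def cis_cnj)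

lemma fmode_deriv: "(fmode k has_vector_derivative (2 * pi * of_int k * \<i>) * fmode k x) (at x within A)"
  unfolding fmode_def[abs_def] cis_conv_exp
  by (auto intro!: derivative_eq_intros has_vector_derivative_real_field simp: has_vector_derivative_def[symmetric])

lemma continuous_on_fmode [continuous_intros]: "continuous_on A (fmode k)"
  unfolding fmode_def[abs_def] by (intro continuous_intros)

lemma fmode_integral: "((\<lambda>x. fmode k x) has_integral of_bool (k = 0)) {0..1}"
proof (cases "k = 0")
  case True
  then show ?thesis using has_integral_const_real[of "1::complex" 0 1] by simp
next
  case False
  define c where "c = 2 * complex_of_real pi * of_int k * \<i>"
  have c: "c \<noteq> 0" using False by (simp add: c_def)
  have "(fmode k has_integral (fmode k 1 / c - fmode k 0 / c)) {0..1}"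
  proof (rule fundamental_theorem_of_calculus)
    fix x :: real
    have "((\<lambda>x. fmode k x / c) has_vector_derivative (c * fmode k x) / c) (at x within {0..1})"
      unfolding c_def by (rule has_vector_derivative_divide) (use fmode_deriv in simp)
    then show "((\<lambda>x. fmode k x / c) has_vector_derivative fmode k x) (at x within {0..1})" using c by simp
  qed simp
  then show ?thesis using False by simp
qed

lemma bessel:
  assumes h: "continuous_on {0..1} h" and F: "finite F"
  shows "(\<Sum>k\<in>F. (norm (fcoeff h k))\<^sup>2) \<le> integral {0..1} (\<lambda>x. (norm (h x))\<^sup>2)"
proof -
  define c where "c = fcoeff h"
  define s where "s = (\<lambda>x. \<Sum>k\<in>F. c k * fmode k x)"
  define I where "I = (\<lambda>g::real \<Rightarrow> complex. integral {0..1} g)"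
  have int: "g integrable_on {0..1}" if "continuous_on {0..1} g" for g :: "real \<Rightarrow> complex"
    using that by (rule integrable_continuous_real)
  have chk: "continuous_on {0..1} (\<lambda>x. h x * fmode k x)" for k by (intro continuous_intros h)
  have e1: "((\<lambda>x. h x * cnj (s x)) has_integral (\<Sum>k\<in>F. cnj (c k) * c k)) {0..1}"
  proof -
    have "((\<lambda>x. \<Sum>k\<in>F. cnj (c k) * (h x * fmode (- k) x)) has_integral (\<Sum>k\<in>F. cnj (c k) * c k)) {0..1}"
      by (intro has_integral_sum has_integral_mult_right F)
        (unfold c_def fcoeff_def, intro integrable_integral int chk)
    then show ?thesis by (simp add: s_def cnj_fmode sum_distrib_left mult_ac)
  qed
  have exp2: "((\<lambda>x. cnj (h x) * s x) has_integral (\<Sum>k\<in>F. cnj (c k) * c k)) {0..1}"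
    using has_integral_cnj[THEN iffD2, OF e1] by (simp add: comp_def mult.commute)
  have e3: "((\<lambda>x. s x * cnj (s x)) has_integral (\<Sum>k\<in>F. cnj (c k) * c k)) {0..1}"
  proof -
    have "((\<lambda>x. \<Sum>j\<in>F. \<Sum>k\<in>F. (c j * cnj (c k)) * fmode (j - k) x) has_integral
       (\<Sum>j\<in>F. \<Sum>k\<in>F. (c j * cnj (c k)) * of_bool (j - k = 0))) {0..1}"
      by (intro has_integral_sum has_integral_mult_right F fmode_integral)
    moreover have "(\<Sum>j\<in>F. \<Sum>k\<in>F. (c j * cnj (c k)) * of_bool (j - k = 0)) = (\<Sum>k\<in>F. cnj (c k) * c k)"
      by (simp add: of_bool_def if_distrib[where f = "\<lambda>x. _ * x"] sum.delta F mult.commute cong: if_cong)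
    moreover have "(\<Sum>j\<in>F. \<Sum>k\<in>F. (c j * cnj (c k)) * fmode (j - k) x) = s x * cnj (s x)" for x
      unfolding s_def cnj_sum sum_product
      by (intro sum.cong refl) (simp add: cnj_fmode fmode_add[symmetric] diff_conv_add_uminus mult_ac del: add_uminus_conv_diff)
    ultimately show ?thesis by simp
  qed
  have exp4: "((\<lambda>x. h x * cnj (h x)) has_integral I (\<lambda>x. h x * cnj (h x))) {0..1}"
    unfolding I_def by (intro integrable_integral int continuous_intros h)
  define S where "S = (\<Sum>k\<in>F. cnj (c k) * c k)"
  have "((\<lambda>x. h x * cnj (h x) - h x * cnj (s x) - cnj (h x) * s x + s x * cnj (s x)) has_integral
     (I (\<lambda>x. h x * cnj (h x)) - S - S + S)) {0..1}"
    unfolding S_def by (intro has_integral_add has_integral_diff e1 exp2 e3 exp4)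
  hence H: "((\<lambda>x. Re (h x * cnj (h x) - h x * cnj (s x) - cnj (h x) * s x + s x * cnj (s x))) has_integral
     Re (I (\<lambda>x. h x * cnj (h x)) - S - S + S)) {0..1}" by (rule has_integral_Re)
  have N: "Re (h x * cnj (h x) - h x * cnj (s x) - cnj (h x) * s x + s x * cnj (s x)) = (norm (h x - s x))\<^sup>2" for x
    unfolding cmod_power2 by (simp add: power2_eq_square algebra_simps)
  have "0 \<le> Re (I (\<lambda>x. h x * cnj (h x)) - S - S + S)"
    by (rule has_integral_nonneg[OF H[unfolded N]]) simp
  moreover have "Re S = (\<Sum>k\<in>F. (norm (fcoeff h k))\<^sup>2)"
    unfolding S_def c_def cmod_power2 by (simp add: power2_eq_square)
  moreover have "Re (I (\<lambda>x. h x * cnj (h x))) = integral {0..1} (\<lambda>x. (norm (h x))\<^sup>2)"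
  proof -
    have "((\<lambda>x. Re (h x * cnj (h x))) has_integral Re (I (\<lambda>x. h x * cnj (h x)))) {0..1}"
      by (rule has_integral_Re[OF exp4])
    then show ?thesis unfolding cmod_power2 by (simp add: power2_eq_square integral_unique)
  qed
  ultimately show ?thesis by simp
qed

lemma fcoeff_tendsto_0:
  assumes h: "continuous_on {0..1} h" and inj: "inj g"
  shows "(\<lambda>n::nat. fcoeff h (g n)) \<longlonglongrightarrow> 0"
proof -
  have "summable (\<lambda>n. (norm (fcoeff h (g n)))\<^sup>2)"
  proof (rule bounded_imp_summable)
    fix n
    have "(\<Sum>k\<le>n. (norm (fcoeff h (g k)))\<^sup>2) = (\<Sum>k\<in>g ` {..n}. (norm (fcoeff h k))\<^sup>2)"
      using inj by (subst sum.reindex) (auto intro: inj_on_subset)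
    also have "\<dots> \<le> integral {0..1} (\<lambda>x. (norm (h x))\<^sup>2)" by (rule bessel[OF h]) simp
    finally show "(\<Sum>k\<le>n. (norm (fcoeff h (g k)))\<^sup>2) \<le> integral {0..1} (\<lambda>x. (norm (h x))\<^sup>2)" .
  qed simp
  hence "(\<lambda>n. (norm (fcoeff h (g n)))\<^sup>2) \<longlonglongrightarrow> 0" by (rule summable_LIMSEQ_zero)
  hence "(\<lambda>n. sqrt ((norm (fcoeff h (g n)))\<^sup>2)) \<longlonglongrightarrow> sqrt 0" by (rule tendsto_real_sqrt)
  then show ?thesis by (simp add: tendsto_norm_zero_iff)
qed


lemma fmode_eq_1_iff:
  assumes "\<bar>u\<bar> < 1"
  shows "fmode 1 u = 1 \<longleftrightarrow> u = 0"
proof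
  assume "fmode 1 u = 1"
  hence "cos (2 * pi * u) = 1" by (metis fmode_def cis.sel(1) mult.right_neutral of_int_1 one_complex.sel(1))
  then obtain n :: int where "2 * pi * u = of_int n * 2 * pi" by (auto simp: cos_one_2pi_int)
  hence n: "u = of_int n" by simp
  hence "\<bar>n\<bar> < 1" using assms by linarith
  then show "u = 0" using n by simp
qed simp

lemma fmode_quotient: "((\<lambda>t. (fmode 1 (t - x) - 1) / of_real (t - x)) \<longlongrightarrow> 2 * pi * \<i>) (at x)"
proof -
  let ?c = "2 * complex_of_real pi * \<i>"
  have "((\<lambda>z. exp (?c * (z - of_real x))) has_field_derivative ?c) (at (of_real x))"
    by (auto intro!: derivative_eq_intros)
  hence "((\<lambda>z. (exp (?c * (z - of_real x)) - 1) / (z - of_real x)) \<longlongrightarrow> ?c) (at (of_real x))"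
    by (simp add: has_field_derivative_iff)
  moreover have "filterlim complex_of_real (at (of_real x)) (at x)"
    by (rule filterlim_atI) (auto intro!: tendsto_intros simp: eventually_at intro: exI[of _ 1])
  ultimately have "((\<lambda>t. (exp (?c * (of_real t - of_real x)) - 1) / (of_real t - of_real x)) \<longlongrightarrow> ?c) (at x)"
    by (rule filterlim_compose)
  then show ?thesis by (simp add: fmode_def cis_conv_exp mult_ac)
qed

lemma sum_symmetric_telescope:
  "(\<Sum>k\<in>{- int N..int N}. a (k - 1) - a k) = a (- int N - 1) - (a (int N) :: complex)"
proof (induction N)
  case (Suc N)
  have "{- int (Suc N)..int (Suc N)} = insert (- int N - 1) (insert (int N + 1) {- int N..int N})" by auto
  then show ?case using Suc by (simp add: algebra_simps)
qed simp

text \<open>Chernoff's argument: the Fourier coefficients of \<open>f - f x\<close> are differences of consecutive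
  coefficients of \<open>h\<close>, so the symmetric partial sums telescope and vanish in the limit.\<close>

lemma fourier_partial:
  assumes P: "\<And>t. (P has_real_derivative P' t) (at t)" and x: "0 < x" "x < 1"
  shows "(\<lambda>N. \<Sum>k\<in>{- int N..int N}. fcoeff (\<lambda>t. of_real (P t)) k * fmode k x) \<longlonglongrightarrow> of_real (P x)"
proof -
  define f where "f = (\<lambda>t. complex_of_real (P t))"
  \<comment> \<open>The value at \<open>x\<close> is the limit of the quotient. As \<open>x\<close>
    lies in the open interval, the denominator has no other zero on the closed one; for an endpoint
    \<open>x\<close> it would vanish at the opposite endpoint too.\<close>
  define h where "h = (\<lambda>t. if t = x then of_real (P' x) / (2 * pi * \<i>) else (f t - f x) / (fmode 1 (t - x) - 1))"
  have cP: "isCont P t" for t using P by (rule DERIV_isCont)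
  have ek_ne: "fmode 1 (t - x) - 1 \<noteq> 0" if "t \<in> {0..1}" "t \<noteq> x" for t
  proof -
    have "\<bar>t - x\<bar> < 1" using that x by (simp add: abs_less_iff)
    then show ?thesis using that fmode_eq_1_iff[of "t - x"] by simp
  qed
  have "isCont h t" if t: "t \<in> {0..1}" for t
  proof (cases "t = x")
    case True
    have "((\<lambda>t. (P t - P x) / (t - x)) \<longlongrightarrow> P' x) (at x)"
      using P[of x] by (simp add: has_field_derivative_iff)
    hence "((\<lambda>t. complex_of_real ((P t - P x) / (t - x))) \<longlongrightarrow> of_real (P' x)) (at x)" by (rule tendsto_of_real)
    hence "((\<lambda>t. complex_of_real ((P t - P x) / (t - x)) / ((fmode 1 (t - x) - 1) / of_real (t - x))) \<longlongrightarrow> of_real (P' x) / (2 * pi * \<i>)) (at x)"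
      by (intro tendsto_divide fmode_quotient) auto
    moreover have "eventually (\<lambda>t. complex_of_real ((P t - P x) / (t - x)) / ((fmode 1 (t - x) - 1) / of_real (t - x)) = h t) (at x)"
      using eventually_at_filter by (auto simp: h_def f_def eventually_at_filter)
    ultimately have "(h \<longlongrightarrow> of_real (P' x) / (2 * pi * \<i>)) (at x)" by (rule Lim_transform_eventually)
    then show ?thesis unfolding True by (simp add: isCont_def h_def)
  next
    case False
    have "isCont (\<lambda>t. (f t - f x) / (fmode 1 (t - x) - 1)) t"
    proof -
      have "isCont (\<lambda>s. fmode 1 (s - x)) t" unfolding fmode_def cis_conv_exp by (intro continuous_intros)
      moreover have "isCont f t" unfolding f_def by (intro continuous_intros cP)
      ultimately show ?thesis using ek_ne[OF t False] by (intro continuous_intros)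
    qed
    moreover have "eventually (\<lambda>s. s \<noteq> x) (nhds t)" by (rule t1_space_nhds[OF False])
    hence "eventually (\<lambda>s. h s = (f s - f x) / (fmode 1 (s - x) - 1)) (nhds t)"
      by eventually_elim (simp add: h_def)
    ultimately show ?thesis by (simp only: isCont_cong)
  qed
  hence h: "continuous_on {0..1} h" by (intro continuous_at_imp_continuous_on) auto
  have fh: "f t = f x + (fmode 1 (t - x) - 1) * h t" if "t \<in> {0..1}" for t
    using ek_ne[OF that] by (cases "t = x") (auto simp: h_def)
  define a where "a = (\<lambda>k. fcoeff h k * fmode k x)"
  have c: "fcoeff f k * fmode k x = f x * of_bool (k = 0) + (a (k - 1) - a k)" for k
  proof -
    have i: "((\<lambda>t. h t * fmode (- j) t) has_integral fcoeff h j) {0..1}" for j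
      unfolding fcoeff_def by (intro integrable_integral integrable_continuous_real continuous_intros h)
    have "((\<lambda>t. f x * fmode (- k) t + fmode (- 1) x * (h t * fmode (- (k - 1)) t) - h t * fmode (- k) t) has_integral
       (f x * of_bool (- k = 0) + fmode (- 1) x * fcoeff h (k - 1) - fcoeff h k)) {0..1}"
      by (intro has_integral_add has_integral_diff has_integral_mult_right fmode_integral i)
    moreover have "f x * fmode (- k) t + fmode (- 1) x * (h t * fmode (- (k - 1)) t) - h t * fmode (- k) t = f t * fmode (- k) t"
      if "t \<in> {0..1}" for t
    proof -
      have "fmode (- (k - 1)) t = fmode 1 t * fmode (- k) t" by (simp add: fmode_add)
      then show ?thesis unfolding fh[OF that] fmode_diff by (simp add: algebra_simps)
    qed
    ultimately have "((\<lambda>t. f t * fmode (- k) t) has_integral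
       (f x * of_bool (- k = 0) + fmode (- 1) x * fcoeff h (k - 1) - fcoeff h k)) {0..1}"
      by (rule has_integral_eq[rotated]) auto
    hence fck: "fcoeff f k = f x * of_bool (k = 0) + fmode (- 1) x * fcoeff h (k - 1) - fcoeff h k"
      unfolding fcoeff_def by (simp add: integral_unique)
    have "fcoeff f k * fmode k x = f x * (of_bool (k = 0) * fmode k x) + fcoeff h (k - 1) * (fmode (- 1) x * fmode k x) - fcoeff h k * fmode k x"
      unfolding fck by (simp add: ring_distribs)
    moreover have "fmode (- 1) x * fmode k x = fmode (k - 1) x" by (simp add: fmode_add)
    moreover have "of_bool (k = 0) * fmode k x = of_bool (k = 0)" by (cases "k = 0") simp_all
    ultimately show ?thesis by (simp add: a_def)
  qed
  have S: "(\<Sum>k\<in>{- int N..int N}. fcoeff f k * fmode k x) = f x + (a (- int N - 1) - a (int N))" for N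
  proof -
    have "(\<Sum>k\<in>{- int N..int N}. f x * of_bool (k = 0)) = f x"
    proof -
      have "(\<Sum>k\<in>{- int N..int N}. f x * of_bool (k = 0)) = (\<Sum>k\<in>{- int N..int N}. if k = 0 then f x else 0)"
        by (intro sum.cong) auto
      then show ?thesis by (subst (asm) sum.delta) auto
    qed
    then show ?thesis unfolding c sum.distrib sum_symmetric_telescope by simp
  qed
  have a0: "(\<lambda>N::nat. a (g N)) \<longlonglongrightarrow> 0" if "inj g" for g
  proof -
    have "(\<lambda>N. norm (fcoeff h (g N))) \<longlonglongrightarrow> 0" using fcoeff_tendsto_0[OF h that] by (simp add: tendsto_norm_zero_iff)
    hence "(\<lambda>N. norm (a (g N))) \<longlonglongrightarrow> 0" by (simp add: a_def norm_mult)
    then show ?thesis by (simp add: tendsto_norm_zero_iff)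
  qed
  have "(\<lambda>N. f x + (a (- int N - 1) - a (int N))) \<longlonglongrightarrow> f x + (0 - 0)"
    by (intro tendsto_intros a0) (auto simp: inj_on_def)
  then show ?thesis unfolding S[symmetric] by (simp add: f_def)
qed

lemma fcoeff_deriv:
  assumes P: "\<And>t. (P has_real_derivative P' t) (at t)" and c: "continuous_on UNIV P'" and per: "P 1 = P 0"
  shows "fcoeff (\<lambda>t. of_real (P' t)) k = 2 * pi * of_int k * \<i> * fcoeff (\<lambda>t. of_real (P t)) k"
proof -
  let ?c = "2 * complex_of_real pi * of_int k * \<i>"
  have cP: "continuous_on A P" for A using P by (meson DERIV_isCont continuous_at_imp_continuous_on)
  have cP': "continuous_on {0..1} P'" using c by (rule continuous_on_subset) simp
  have "((\<lambda>t. of_real (P' t) * fmode (- k) t + of_real (P t) * ((2 * pi * of_int (- k) * \<i>) * fmode (- k) t)) has_integral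
     (of_real (P 1) * fmode (- k) 1 - of_real (P 0) * fmode (- k) 0)) {0..1}"
  proof (rule fundamental_theorem_of_calculus)
    fix t :: real
    have "((\<lambda>t. complex_of_real (P t)) has_vector_derivative of_real (P' t)) (at t within {0..1})"
      by (rule has_vector_derivative_of_real) (use P in \<open>auto intro: has_field_derivative_at_within\<close>)
    from has_vector_derivative_mult[OF this fmode_deriv[of "- k" t]]
    show "((\<lambda>t. of_real (P t) * fmode (- k) t) has_vector_derivative
       of_real (P' t) * fmode (- k) t + of_real (P t) * ((2 * pi * of_int (- k) * \<i>) * fmode (- k) t)) (at t within {0..1})"
      by (simp add: add.commute)
  qed simp
  hence 0: "((\<lambda>t. of_real (P' t) * fmode (- k) t - ?c * (of_real (P t) * fmode (- k) t)) has_integral 0) {0..1}"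
    using per by (simp add: mult_ac)
  have "((\<lambda>t. of_real (P' t) * fmode (- k) t - ?c * (of_real (P t) * fmode (- k) t)) has_integral
     (fcoeff (\<lambda>t. of_real (P' t)) k - ?c * fcoeff (\<lambda>t. of_real (P t)) k)) {0..1}"
    unfolding fcoeff_def
    by (intro has_integral_diff has_integral_mult_right integrable_integral integrable_continuous_real continuous_intros cP cP')
  from has_integral_unique[OF this 0] show ?thesis by simp
qed

lemma summable_on_inverse_int_squares: "(\<lambda>k::int. 1 / (real_of_int k)\<^sup>2) summable_on UNIV"
proof (rule nonneg_bdd_above_summable_on)
  show "bdd_above (sum (\<lambda>k::int. 1 / (real_of_int k)\<^sup>2) ` {F. F \<subseteq> UNIV \<and> finite F})"
  proof (rule bdd_aboveI2)
    fix F :: "int set" assume "F \<in> {F. F \<subseteq> UNIV \<and> finite F}"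
    hence F: "finite F" by simp
    let ?S = "\<Sum>n. 1 / (real n)\<^sup>2"
    have s: "summable (\<lambda>n. 1 / (real n)\<^sup>2)" using inverse_power_summable[of 2, where 'a = real] by (simp add: inverse_eq_divide)
    have half: "(\<Sum>k\<in>G. 1 / (real_of_int k)\<^sup>2) \<le> ?S" if "finite G" "inj_on (\<lambda>k. nat \<bar>k\<bar>) G" for G
    proof -
      have "(\<Sum>k\<in>G. 1 / (real_of_int k)\<^sup>2) = (\<Sum>n\<in>(\<lambda>k. nat \<bar>k\<bar>) ` G. 1 / (real n)\<^sup>2)"
        by (subst sum.reindex[OF that(2)]) simp
      also have "\<dots> \<le> ?S" by (rule sum_le_suminf[OF s]) (use that in auto)
      finally show ?thesis .
    qed
    have "F = {k\<in>F. k \<ge> 0} \<union> {k\<in>F. k < 0}" by auto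
    hence "(\<Sum>k\<in>F. 1 / (real_of_int k)\<^sup>2) = (\<Sum>k\<in>{k\<in>F. k \<ge> 0}. 1 / (real_of_int k)\<^sup>2) + (\<Sum>k\<in>{k\<in>F. k < 0}. 1 / (real_of_int k)\<^sup>2)"
      using F by (subst sum.union_disjoint[symmetric]) (auto intro: sum.cong)
    also have "\<dots> \<le> ?S + ?S"
      by (intro add_mono half) (use F in \<open>auto simp: inj_on_def\<close>)
    finally show "(\<Sum>k\<in>F. 1 / (real_of_int k)\<^sup>2) \<le> ?S + ?S" .
  qed
qed simp

text \<open>The coefficients of \<open>P'\<close> are square summable and dominate |k| times those
  of \<open>P\<close>, so 2 a b \<le> a^2 + b^2 gives absolute convergence. The sum is then
  continuous and equals \<open>P\<close> inside the unit interval by \<open>fourier_partial\<close>;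
  a one-sided limit settles 0, periodicity the rest.\<close>

lemma fourier_series:
  assumes P: "\<And>t. (P has_real_derivative P' t) (at t)" and c: "continuous_on UNIV P'" and per: "\<And>t. P (t + 1) = P t"
  shows "(\<lambda>k. norm (fcoeff (\<lambda>t. of_real (P t)) k)) summable_on UNIV"
    and "((\<lambda>k. fcoeff (\<lambda>t. of_real (P t)) k * fmode k x) has_sum of_real (P x)) UNIV"
proof -
  define f where "f = (\<lambda>t. complex_of_real (P t))"
  have cP': "continuous_on {0..1} (\<lambda>t. complex_of_real (P' t))" using c by (intro continuous_intros continuous_on_subset[OF c]) simp
  have "P 1 = P 0" using per[of 0] by simp
  note fd = fcoeff_deriv[OF P c this, folded f_def]
  have sq: "(\<lambda>k. (norm (fcoeff (\<lambda>t. of_real (P' t)) k))\<^sup>2) summable_on UNIV"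
    by (rule nonneg_bdd_above_summable_on) (auto intro!: bdd_aboveI2 bessel[OF cP'])
  show *: "(\<lambda>k. norm (fcoeff (\<lambda>t. of_real (P t)) k)) summable_on UNIV"
  proof -
    have "(\<lambda>k. norm (fcoeff f k)) summable_on (UNIV - {0})"
    proof (rule summable_on_comparison_test)
      show "(\<lambda>k. 1 / (real_of_int k)\<^sup>2 + (norm (fcoeff (\<lambda>t. of_real (P' t)) k))\<^sup>2) summable_on (UNIV - {0})"
        by (rule summable_on_subset_banach[OF summable_on_add[OF summable_on_inverse_int_squares sq]]) simp
      fix k :: int assume "k \<in> UNIV - {0}"
      hence k: "real_of_int \<bar>k\<bar> \<ge> 1" by auto
      define A where "A = norm (fcoeff (\<lambda>t. of_real (P' t)) k)"
      have A: "A = 2 * pi * real_of_int \<bar>k\<bar> * norm (fcoeff f k)" unfolding A_def fd by (simp add: norm_mult)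
      have "norm (fcoeff f k) * 1 \<le> norm (fcoeff f k) * (2 * pi)" using pi_gt3 by (intro mult_left_mono) auto
      hence le: "norm (fcoeff f k) \<le> A / real_of_int \<bar>k\<bar>" using k by (simp add: A field_simps)
      have "2 * (A * (1 / real_of_int \<bar>k\<bar>)) \<le> A\<^sup>2 + (1 / real_of_int \<bar>k\<bar>)\<^sup>2"
        using sum_squares_bound[of A "1 / real_of_int \<bar>k\<bar>"] by simp
      moreover have "0 \<le> A * (1 / real_of_int \<bar>k\<bar>)" by (simp add: A_def)
      moreover have "a \<le> b" if "2 * a \<le> b" "0 \<le> a" for a b :: real using that by simp
      ultimately have "A * (1 / real_of_int \<bar>k\<bar>) \<le> A\<^sup>2 + (1 / real_of_int \<bar>k\<bar>)\<^sup>2" by blast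
      hence "A / real_of_int \<bar>k\<bar> \<le> A\<^sup>2 + (1 / real_of_int \<bar>k\<bar>)\<^sup>2" by simp
      also have "(1 / real_of_int \<bar>k\<bar>)\<^sup>2 = 1 / (real_of_int k)\<^sup>2" by (simp add: power_divide)
      finally show "norm (fcoeff f k) \<le> 1 / (real_of_int k)\<^sup>2 + (norm (fcoeff (\<lambda>t. of_real (P' t)) k))\<^sup>2"
        using le by (simp add: A_def)
    qed simp
    hence "(\<lambda>k. norm (fcoeff f k)) summable_on (insert 0 (UNIV - {0}))" by (subst summable_on_insert_iff)
    then show ?thesis by (simp add: f_def insert_absorb)
  qed
  define S where "S = (\<lambda>x. \<Sum>\<^sub>\<infinity>k. fcoeff f k * fmode k x)"
  have hs: "((\<lambda>k. fcoeff f k * fmode k x) has_sum S x) UNIV" for x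
  proof -
    have "(\<lambda>k. norm (fcoeff f k * fmode k x)) summable_on UNIV" using * by (simp add: norm_mult f_def)
    hence "(\<lambda>k. fcoeff f k * fmode k x) summable_on UNIV" by (rule abs_summable_summable)
    then show ?thesis unfolding S_def by (rule has_sum_infsum)
  qed
  have fl: "filterlim (\<lambda>N::nat. {- int N..int N}) (finite_subsets_at_top UNIV) sequentially"
    unfolding filterlim_finite_subsets_at_top
  proof safe
    fix X :: "int set" assume X: "finite X"
    obtain B where B: "\<And>k. k \<in> X \<Longrightarrow> nat \<bar>k\<bar> \<le> B" using finite_nat_set_iff_bounded_le[of "(\<lambda>k. nat \<bar>k\<bar>) ` X"] X by auto
    have "X \<subseteq> {- int N..int N}" if "N \<ge> B" for N using B that by fastforce
    then show "\<forall>\<^sub>F N in sequentially. finite {- int N..int N} \<and> X \<subseteq> {- int N..int N} \<and> {- int N..int N} \<subseteq> UNIV"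
      by (intro eventually_sequentiallyI[of B]) auto
  qed
  have in01: "S x = f x" if "0 < x" "x < 1" for x
  proof -
    have "(\<lambda>N::nat. \<Sum>k\<in>{- int N..int N}. fcoeff f k * fmode k x) \<longlonglongrightarrow> S x"
      using filterlim_compose[OF hs[of x, unfolded has_sum_def] fl] .
    moreover have "(\<lambda>N::nat. \<Sum>k\<in>{- int N..int N}. fcoeff f k * fmode k x) \<longlonglongrightarrow> f x"
      unfolding f_def by (rule fourier_partial[OF P that])
    ultimately show ?thesis by (rule LIMSEQ_unique)
  qed
  have S_per: "S (x + of_int m) = S x" for x m
  proof -
    have "fmode k (x + of_int m) = fmode k x" for k
      using cis_multiple_2pi[of "of_int (k * m)"] by (simp add: fmode_def ring_distribs cis_mult[symmetric] mult_ac)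
    then show ?thesis by (simp add: S_def)
  qed
  have f_per: "f (x + of_int m) = f x" for x m
  proof -
    have "P (x + of_int m) = P x"
    proof (induction m rule: int_induct[of _ 0])
      case (step1 i)
      then show ?case using per[of "x + of_int i"] by (simp add: algebra_simps)
    next
      case (step2 i)
      then show ?case using per[of "x + of_int (i - 1)"] by (simp add: algebra_simps)
    qed simp
    then show ?thesis by (simp add: f_def)
  qed
  have S_cont: "continuous_on UNIV S"
  proof -
    have "uniform_limit UNIV (\<lambda>F x. \<Sum>k\<in>F. fcoeff f k * fmode k x) (\<lambda>x. \<Sum>\<^sub>\<infinity>k. fcoeff f k * fmode k x) (finite_subsets_at_top UNIV)"
      by (rule Weierstrass_m_test_general[where M = "\<lambda>k. norm (fcoeff f k)"]) (use * in \<open>auto simp: norm_mult f_def\<close>)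
    then show ?thesis unfolding S_def
      by (rule uniform_limit_theorem[rotated]) (auto intro!: always_eventually continuous_intros)
  qed
  have "S 0 = f 0"
  proof -
    have "(S \<longlongrightarrow> S 0) (at_right 0)" using S_cont by (auto simp: continuous_on_def intro: tendsto_mono[OF at_le])
    moreover have "(f \<longlongrightarrow> f 0) (at_right 0)"
      unfolding f_def using P[of 0] by (intro tendsto_intros tendsto_mono[OF at_le DERIV_isCont[unfolded isCont_def]]) auto
    moreover have "eventually (\<lambda>x. S x = f x) (at_right 0)"
      using eventually_at_right_real[OF zero_less_one] by eventually_elim (auto intro: in01)
    ultimately show ?thesis by (metis tendsto_cong tendsto_unique trivial_limit_at_right_real)
  qed
  hence "S (frac x) = f (frac x)" using in01[of "frac x"] frac_ge_0[of x] frac_lt_1[of x] by (cases "frac x = 0") (simp only:, simp)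
  hence "S x = f x" using S_per[of "frac x" "\<lfloor>x\<rfloor>"] f_per[of "frac x" "\<lfloor>x\<rfloor>"] by (simp add: frac_def)
  then show "((\<lambda>k. fcoeff (\<lambda>t. of_real (P t)) k * fmode k x) has_sum of_real (P x)) UNIV"
    using hs[of x] by (simp add: f_def)
qed

section \<open>Mellin transforms cut at the powers of 4\<close>

text \<open>The power 4^x, written through \<open>exp\<close> so that it combines with the complex
  exponential in \<open>mellin_integrand\<close>.\<close>

definition exp4 :: "real \<Rightarrow> real" where "exp4 x = exp (ln 4 * x)"

lemma exp4_pos [simp]: "exp4 x > 0" and exp4_nonneg [simp]: "exp4 x \<ge> 0" and exp4_nz [simp]: "exp4 x \<noteq> 0" by (simp_all add: exp4_def)

lemma continuous_on_exp4 [continuous_intros]: "continuous_on A f \<Longrightarrow> continuous_on A (\<lambda>x. exp4 (f x))"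
  unfolding exp4_def by (intro continuous_intros)

lemma ln_4_pos [simp]: "ln (4::real) > 0" by simp

lemma exp4_powr: "exp4 x powr p = exp (p * (ln 4 * x))"
  by (simp add: powr_def exp4_def)

text \<open>Substituting \<open>w = exp4 (r - x)\<close> cuts the Mellin integral of \<open>f\<close> at the powers of \<open>4\<close>. The piece for \<open>r\<close> covers
  \<open>4 powr (r - 1) \<le> w \<le> 4 powr r\<close> and lacks the factor \<open>ln 4\<close>; if \<open>r\<close> is an integer and \<open>z = chi k / 2\<close>, it is also a
  Fourier coefficient of \<open>x \<mapsto> f (exp4 (r - x))\<close>.\<close>

definition mellin_integrand :: "(real \<Rightarrow> real) \<Rightarrow> complex \<Rightarrow> real \<Rightarrow> real \<Rightarrow> complex" where
  "mellin_integrand f z r x = of_real (f (exp4 (r - x))) * exp (z * of_real (ln 4 * (r - x)))"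

definition mellin_piece :: "(real \<Rightarrow> real) \<Rightarrow> real \<Rightarrow> complex \<Rightarrow> complex" where
  "mellin_piece f r z = integral {0..1} (mellin_integrand f z r)"

lemma continuous_on_mellin_integrand:
  assumes "continuous_on {0<..} f"
  shows "continuous_on A (mellin_integrand f z r)"
  unfolding mellin_integrand_def
  by (intro continuous_intros continuous_on_compose2[OF assms]) auto

lemma mellin_integrand_has_integral:
  assumes "continuous_on {0<..} f"
  shows "(mellin_integrand f z r has_integral mellin_piece f r z) {0..1}"
  unfolding mellin_piece_def by (intro integrable_integral integrable_continuous_real continuous_on_mellin_integrand assms)

lemma mellin_piece_holomorphic:
  assumes f: "continuous_on {0<..} f"
  shows "mellin_piece f r holomorphic_on UNIV"
proof -
  have "(\<lambda>z. integral (cbox 0 1) (mellin_integrand f z r)) holomorphic_on UNIV"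
  proof (rule leibniz_rule_holomorphic)
    fix z t
    show "((\<lambda>z. mellin_integrand f z r t) has_field_derivative of_real (f (exp4 (r - t))) * (exp (z * of_real (ln 4 * (r - t))) * of_real (ln 4 * (r - t)))) (at z within UNIV)"
      unfolding mellin_integrand_def by (auto intro!: derivative_eq_intros)
    show "mellin_integrand f z r integrable_on cbox 0 1"
      using mellin_integrand_has_integral[OF f] by (auto simp: integrable_on_def)
  next
    show "continuous_on (UNIV \<times> cbox 0 1) (\<lambda>(z, t). of_real (f (exp4 (r - t))) * (exp (z * of_real (ln 4 * (r - t))) * complex_of_real (ln 4 * (r - t))))"
      unfolding split_def
      by (intro continuous_intros continuous_on_compose2[OF f]) auto
  qed simp
  then show ?thesis by (simp add: mellin_piece_def[abs_def])
qed

lemma norm_mellin_integrand: "norm (mellin_integrand f z r x) = \<bar>f (exp4 (r - x))\<bar> * exp (Re z * (ln 4 * (r - x)))"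
  by (simp add: mellin_integrand_def norm_mult)

lemma mellin_piece_bound:
  assumes f: "continuous_on {0<..} f" and b: "\<And>x. 0 \<le> x \<Longrightarrow> x \<le> 1 \<Longrightarrow> norm (mellin_integrand f z r x) \<le> B"
  shows "norm (mellin_piece f r z) \<le> B"
proof -
  have "0 \<le> B" using order_trans[OF norm_ge_zero b[of 0]] by simp
  hence "norm (mellin_piece f r z) \<le> B * measure lborel {0..1::real}"
    by (rule has_integral_bound_real[OF _ finite.emptyI mellin_integrand_has_integral[OF f]]) (use b in auto)
  then show ?thesis by simp
qed

text \<open>The majorant is asked for only from some index on, because in
  \<open>zeta_tail_holomorphic\<close> the terms are controlled only once \<open>n\<close> is
  large.\<close>

lemma holomorphic_series:
  fixes g :: "nat \<Rightarrow> complex \<Rightarrow> complex"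
  assumes D: "open D" and g: "\<And>n. g n holomorphic_on D"
    and b: "\<And>z. z \<in> D \<Longrightarrow> \<exists>d>0. \<exists>M. cball z d \<subseteq> D \<and> summable M \<and> (\<exists>n0. \<forall>n\<ge>n0. \<forall>w\<in>cball z d. norm (g n w) \<le> M n)"
  shows "(\<lambda>z. \<Sum>n. g n z) holomorphic_on D" "\<And>z. z \<in> D \<Longrightarrow> summable (\<lambda>n. g n z)"
proof -
  have *: "\<exists>d>0. cball z d \<subseteq> D \<and> uniform_limit (cball z d) (\<lambda>N z. \<Sum>n<N. g n z) (\<lambda>z. \<Sum>n. g n z) sequentially" if "z \<in> D" for z
  proof -
    obtain d M n0 where d: "d > 0" "cball z d \<subseteq> D" "summable M" "\<And>n w. n \<ge> n0 \<Longrightarrow> w \<in> cball z d \<Longrightarrow> norm (g n w) \<le> M n"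
      using b[OF \<open>z \<in> D\<close>] by blast
    have "uniform_limit (cball z d) (\<lambda>N z. \<Sum>n<N. g n z) (\<lambda>z. \<Sum>n. g n z) sequentially"
      by (rule Weierstrass_m_test_ev[OF _ d(3)]) (use d(4) in \<open>auto intro!: eventually_sequentiallyI[of n0]\<close>)
    with d show ?thesis by blast
  qed
  show "(\<lambda>z. \<Sum>n. g n z) holomorphic_on D"
    by (rule holomorphic_uniform_sequence[OF D _ *]) (auto intro!: holomorphic_intros g)
  fix z assume "z \<in> D"
  then obtain d M n0 where d: "d > 0" "summable M" "\<And>n w. n \<ge> n0 \<Longrightarrow> w \<in> cball z d \<Longrightarrow> norm (g n w) \<le> M n"
    using b[OF \<open>z \<in> D\<close>] by blast
  show "summable (\<lambda>n. g n z)"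
    by (rule summable_comparison_test'[OF d(2), of n0]) (use d in auto)
qed

text \<open>Where the series converge, \<open>rmellin\<close> and \<open>lmellin\<close> are the
  Mellin integrals over w \<ge> 1 and over w \<le> 1, both divided by ln 4.\<close>

definition rmellin :: "(real \<Rightarrow> real) \<Rightarrow> complex \<Rightarrow> complex" where
  "rmellin f z = (\<Sum>j. mellin_piece f (real j + 1) z)"

definition lmellin :: "(real \<Rightarrow> real) \<Rightarrow> complex \<Rightarrow> complex" where
  "lmellin f z = (\<Sum>j. mellin_piece f (- real j) z)"

lemma rmellin_holomorphic:
  assumes f: "continuous_on {0<..} f" and b: "C \<ge> 0" "\<And>w. w \<ge> 1 \<Longrightarrow> \<bar>f w\<bar> \<le> C * w powr p"
  shows "rmellin f holomorphic_on {z. Re z < - p}" "Re z < - p \<Longrightarrow> summable (\<lambda>j. mellin_piece f (real j + 1) z)"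
proof -
  have b: "\<exists>d>0. \<exists>M. cball z d \<subseteq> {z. Re z < - p} \<and> summable M \<and> (\<exists>n0. \<forall>n\<ge>n0. \<forall>w\<in>cball z d. norm (mellin_piece f (real n + 1) w) \<le> M n)"
    if z: "z \<in> {z. Re z < - p}" for z
  proof -
    define d where "d = (- p - Re z) / 2"
    have d: "d > 0" using z by (simp add: d_def)
    have Re: "p + Re w \<le> - d" if "w \<in> cball z d" for w
    proof -
      have "Re w - Re z \<le> d" using that abs_Re_le_cmod[of "w - z"] by (simp add: dist_norm norm_minus_commute abs_le_iff)
      then show ?thesis by (simp add: d_def field_simps)
    qed
    define q where "q = exp (- (d * ln 4))"
    have q: "0 \<le> q" "q < 1" using d by (simp_all add: q_def)
    have "norm (mellin_piece f (real n + 1) w) \<le> C * q ^ n" if "w \<in> cball z d" for n w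
    proof (rule mellin_piece_bound[OF f])
      fix x :: real assume x: "0 \<le> x" "x \<le> 1"
      define y where "y = ln 4 * (real n + 1 - x)"
      have y: "ln 4 * real n \<le> y" unfolding y_def using x by (intro mult_left_mono) auto
      have "0 \<le> y" using y by (rule order_trans[rotated]) simp
      hence "exp4 (real n + 1 - x) \<ge> 1" by (simp add: exp4_def y_def)
      hence "norm (mellin_integrand f w (real n + 1) x) \<le> C * exp4 (real n + 1 - x) powr p * exp (Re w * y)"
        unfolding norm_mellin_integrand y_def by (intro mult_right_mono b(2)) auto
      also have "\<dots> = C * exp ((p + Re w) * y)" by (simp add: exp4_powr y_def exp_add[symmetric] distrib_right)
      also have "\<dots> \<le> C * exp ((- d) * y)"
      proof -
        have "(p + Re w) * y \<le> (- d) * y" using Re[OF that] \<open>0 \<le> y\<close> by (rule mult_right_mono)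
        then show ?thesis using b(1) by (intro mult_left_mono) simp_all
      qed
      also have "\<dots> \<le> C * exp ((- d) * (ln 4 * real n))"
        using y d b(1) by (intro mult_left_mono) auto
      also have "exp ((- d) * (ln 4 * real n)) = q ^ n" by (simp add: q_def exp_of_nat_mult[symmetric] mult_ac)
      finally show "norm (mellin_integrand f w (real n + 1) x) \<le> C * q ^ n" .
    qed
    moreover have "cball z d \<subseteq> {z. Re z < - p}"
    proof
      fix w assume "w \<in> cball z d"
      from Re[OF this] d show "w \<in> {z. Re z < - p}" by simp
    qed
    moreover have "summable (\<lambda>n. C * q ^ n)" using q by (intro summable_mult summable_geometric) simp
    ultimately show ?thesis using d by blast
  qed
  have op: "open {z. Re z < - p}" by (rule open_halfspace_Re_lt)
  have h: "mellin_piece f (real n + 1) holomorphic_on {z. Re z < - p}" for n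
    using mellin_piece_holomorphic[OF f] holomorphic_on_subset by blast
  show "rmellin f holomorphic_on {z. Re z < - p}"
    unfolding rmellin_def[abs_def] by (rule holomorphic_series(1)[OF op h b])
  show "summable (\<lambda>j. mellin_piece f (real j + 1) z)" if "Re z < - p"
    using holomorphic_series(2)[OF op h b, of z] that by simp
qed

text \<open>A bound by C w^p makes the pieces decay geometrically. The last claim is explicit in C:
  for fixed p and z the value tends to 0 with C, which is applied to Taylor remainders in
  \<open>lmellin_bose\<close>.\<close>

lemma lmellin_holomorphic:
  assumes f: "continuous_on {0<..} f" and b: "C \<ge> 0" "\<And>w. 0 < w \<Longrightarrow> w \<le> 1 \<Longrightarrow> \<bar>f w\<bar> \<le> C * w powr p"
  shows "lmellin f holomorphic_on {z. Re z > - p}" "Re z > - p \<Longrightarrow> summable (\<lambda>j. mellin_piece f (- real j) z)"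
    "Re z > - p \<Longrightarrow> norm (lmellin f z) \<le> C / (1 - exp (- ((p + Re z) * ln 4)))"
proof -
  have pb: "norm (mellin_piece f (- real n) w) \<le> C * exp (- (d * ln 4)) ^ n" if d: "d \<le> p + Re w" and d0: "0 \<le> d" for n w d
  proof (rule mellin_piece_bound[OF f])
    fix x :: real assume x: "0 \<le> x" "x \<le> 1"
    define y where "y = ln 4 * (real n + x)"
    have y: "ln 4 * real n \<le> y" unfolding y_def using x by (intro mult_left_mono) auto
    have n1: "ln 4 * (- real n - x) = - y" by (simp add: y_def algebra_simps)
    have y0: "0 \<le> y" using y by (rule order_trans[rotated]) simp
    hence "exp4 (- real n - x) \<le> 1" by (simp add: exp4_def n1)
    hence "norm (mellin_integrand f w (- real n) x) \<le> C * exp4 (- real n - x) powr p * exp (Re w * (- y))"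
      unfolding norm_mellin_integrand n1 by (intro mult_right_mono b(2)) auto
    also have "\<dots> = C * exp (- ((p + Re w) * y))"
      unfolding exp4_powr n1 by (simp add: exp_add[symmetric] distrib_right)
    also have "\<dots> \<le> C * exp (- (d * (ln 4 * real n)))"
    proof -
      have "d * (ln 4 * real n) \<le> (p + Re w) * y" using d d0 y y0 by (intro mult_mono) auto
      then show ?thesis using b(1) by (intro mult_left_mono) simp_all
    qed
    finally show "norm (mellin_integrand f w (- real n) x) \<le> C * exp (- (d * ln 4)) ^ n"
      by (simp add: exp_of_nat_mult[symmetric] mult_ac)
  qed
  have b: "\<exists>d>0. \<exists>M. cball z d \<subseteq> {z. Re z > - p} \<and> summable M \<and> (\<exists>n0. \<forall>n\<ge>n0. \<forall>w\<in>cball z d. norm (mellin_piece f (- real n) w) \<le> M n)"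
    if z: "z \<in> {z. Re z > - p}" for z
  proof -
    define d where "d = (p + Re z) / 2"
    have d: "d > 0" using z by (simp add: d_def)
    have Re: "d \<le> p + Re w" if "w \<in> cball z d" for w
    proof -
      have "Re z - Re w \<le> d" using that abs_Re_le_cmod[of "z - w"] by (simp add: dist_norm abs_le_iff)
      then show ?thesis by (simp add: d_def field_simps)
    qed
    have "norm (mellin_piece f (- real n) w) \<le> C * exp (- (d * ln 4)) ^ n" if "w \<in> cball z d" for n w
      by (rule pb[OF Re[OF that] less_imp_le[OF d]])
    moreover have "cball z d \<subseteq> {z. Re z > - p}"
    proof
      fix w assume "w \<in> cball z d"
      from Re[OF this] d show "w \<in> {z. Re z > - p}" by simp
    qed
    moreover have "summable (\<lambda>n. C * exp (- (d * ln 4)) ^ n)" using d by (intro summable_mult summable_geometric) simp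
    ultimately show ?thesis using d by blast
  qed
  have op: "open {z. Re z > - p}" by (rule open_halfspace_Re_gt)
  have h: "mellin_piece f (- real n) holomorphic_on {z. Re z > - p}" for n
    using mellin_piece_holomorphic[OF f] holomorphic_on_subset by blast
  show "lmellin f holomorphic_on {z. Re z > - p}"
    unfolding lmellin_def[abs_def] by (rule holomorphic_series(1)[OF op h b])
  show "summable (\<lambda>j. mellin_piece f (- real j) z)" if "Re z > - p"
    using holomorphic_series(2)[OF op h b, of z] that by simp
  show "norm (lmellin f z) \<le> C / (1 - exp (- ((p + Re z) * ln 4)))" if z: "Re z > - p"
  proof -
    let ?q = "exp (- ((p + Re z) * ln 4))"
    have q: "norm ?q < 1" using z by simp
    have "norm (lmellin f z) \<le> (\<Sum>n. C * ?q ^ n)"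
      unfolding lmellin_def
      by (rule norm_suminf_le[OF pb[OF order_refl]]) (use z in simp, intro summable_mult summable_geometric q)
    also have "\<dots> = C * (1 / (1 - ?q))"
      by (simp only: suminf_mult[OF summable_geometric[OF q]] suminf_geometric[OF q])
    finally show ?thesis by simp
  qed
qed

lemma mellin_piece_powr:
  assumes a: "of_real p + z \<noteq> 0"
  shows "mellin_piece (\<lambda>w. w powr p) r z =
    (exp ((of_real p + z) * of_real (ln 4 * r)) - exp ((of_real p + z) * of_real (ln 4 * (r - 1)))) / ((of_real p + z) * of_real (ln 4))"
proof -
  define a where "a = (of_real p + z) * of_real (ln 4)"
  have a0: "a \<noteq> 0" using assms by (simp add: a_def)
  have e: "mellin_integrand (\<lambda>w. w powr p) z r x = exp (a * of_real (r - x))" for x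
  proof -
    define u where "u = complex_of_real (ln 4 * (r - x))"
    have "of_real (exp4 (r - x) powr p) = exp (of_real p * u)"
      by (simp only: exp4_powr u_def exp_of_real[symmetric] of_real_mult)
    hence "mellin_integrand (\<lambda>w. w powr p) z r x = exp (of_real p * u) * exp (z * u)"
      by (simp only: mellin_integrand_def u_def)
    also have "\<dots> = exp ((of_real p + z) * u)" by (simp only: exp_add distrib_right)
    also have "(of_real p + z) * u = a * of_real (r - x)" by (simp add: a_def u_def)
    finally show ?thesis .
  qed
  have "((\<lambda>x. exp (a * of_real (r - x))) has_integral
     (- exp (a * of_real (r - 1)) / a - (- exp (a * of_real (r - 0)) / a))) {0..1}"
  proof (rule fundamental_theorem_of_calculus)
    fix x :: real
    have "((\<lambda>w. - exp (a * (of_real r - w)) / a) has_field_derivative exp (a * (of_real r - of_real x))) (at (of_real x))"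
      using a0 by (auto intro!: derivative_eq_intros)
    from has_vector_derivative_real_field[OF this]
    show "((\<lambda>x. - exp (a * of_real (r - x)) / a) has_vector_derivative exp (a * of_real (r - x))) (at x within {0..1})"
      by simp
  qed simp
  hence "(mellin_integrand (\<lambda>w. w powr p) z r has_integral (exp (a * of_real r) - exp (a * of_real (r - 1))) / a) {0..1}"
    unfolding e by (simp add: diff_divide_distrib)
  then show ?thesis unfolding mellin_piece_def by (simp add: integral_unique a_def mult_ac)
qed


lemma lmellin_powr:
  assumes a: "Re z > - p"
  shows "lmellin (\<lambda>w. w powr p) z = 1 / ((of_real p + z) * of_real (ln 4))"
proof -
  define a where "a = (of_real p + z) * of_real (ln 4)"
  have Re_a: "Re a = (p + Re z) * ln 4" by (simp add: a_def)
  have a0: "of_real p + z \<noteq> 0" using assms by (auto simp: complex_eq_iff)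
  define g where "g = (\<lambda>j. exp (- (a * of_nat j)) / a)"
  have p: "mellin_piece (\<lambda>w. w powr p) (- real j) z = g j - g (Suc j)" for j
  proof -
    have "(of_real p + z) * of_real (ln 4 * (- real j)) = - (a * of_nat j)"
      "(of_real p + z) * of_real (ln 4 * (- real j - 1)) = - (a * of_nat (Suc j))"
      by (simp_all add: a_def algebra_simps)
    then show ?thesis unfolding mellin_piece_powr[OF a0] g_def a_def[symmetric] by (simp only: diff_divide_distrib)
  qed
  have "g \<longlonglongrightarrow> 0"
  proof -
    have "norm (exp (- a)) < 1" using Re_a assms by simp
    hence "(\<lambda>j. exp (- a) ^ j / a) \<longlonglongrightarrow> 0 / a" by (cases "a = 0") (auto intro!: tendsto_divide LIMSEQ_power_zero)
    then show ?thesis by (simp add: g_def exp_of_nat_mult[symmetric] mult.commute)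
  qed
  hence "(\<lambda>j. g j - g (Suc j)) sums (g 0 - 0)" by (rule telescope_sums')
  then show ?thesis unfolding lmellin_def p by (simp add: sums_unique[symmetric] g_def a_def)
qed

text \<open>The expression is that of \<open>lmellin_powr\<close> with the opposite sign: after
  continuation the two halves of the transform of a power cancel. This is why 1 / w can be split off
  from either half.\<close>

lemma rmellin_powr:
  assumes a: "Re z < - p"
  shows "rmellin (\<lambda>w. w powr p) z = - 1 / ((of_real p + z) * of_real (ln 4))"
proof -
  define a where "a = (of_real p + z) * of_real (ln 4)"
  have Re_a: "Re a = (p + Re z) * ln 4" by (simp add: a_def)
  have a0: "of_real p + z \<noteq> 0" using assms by (auto simp: complex_eq_iff)
  define g where "g = (\<lambda>j. exp (a * of_nat j) / a)"
  have p: "mellin_piece (\<lambda>w. w powr p) (real j + 1) z = g (Suc j) - g j" for j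
  proof -
    have "(of_real p + z) * of_real (ln 4 * (real j + 1 - 1)) = a * of_nat j"
      "(of_real p + z) * of_real (ln 4 * (real j + 1)) = a * of_nat (Suc j)"
      by (simp_all add: a_def algebra_simps)
    then show ?thesis unfolding mellin_piece_powr[OF a0] g_def a_def[symmetric] by (simp only: diff_divide_distrib)
  qed
  have "g \<longlonglongrightarrow> 0"
  proof -
    have "norm (exp a) < 1" using Re_a assms by (simp add: mult_neg_pos)
    hence "(\<lambda>j. exp a ^ j / a) \<longlonglongrightarrow> 0 / a" by (cases "a = 0") (auto intro!: tendsto_divide LIMSEQ_power_zero)
    then show ?thesis by (simp add: g_def exp_of_nat_mult[symmetric] mult.commute)
  qed
  hence "(\<lambda>j. g (Suc j) - g j) sums (0 - g 0)" by (rule telescope_sums)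
  then show ?thesis unfolding rmellin_def p by (simp add: sums_unique[symmetric] g_def a_def)
qed

lemma mellin_piece_linear:
  assumes f: "continuous_on {0<..} f" and g: "continuous_on {0<..} g"
    and h: "\<And>w. w > 0 \<Longrightarrow> h w = a * f w + b * g w"
  shows "mellin_piece h r z = of_real a * mellin_piece f r z + of_real b * mellin_piece g r z"
proof -
  have "((\<lambda>x. of_real a * mellin_integrand f z r x + of_real b * mellin_integrand g z r x) has_integral
     (of_real a * mellin_piece f r z + of_real b * mellin_piece g r z)) {0..1}"
    by (intro has_integral_add has_integral_mult_right mellin_integrand_has_integral f g)
  moreover have "of_real a * mellin_integrand f z r x + of_real b * mellin_integrand g z r x = mellin_integrand h z r x" for x
    by (simp add: mellin_integrand_def h algebra_simps)
  ultimately show ?thesis unfolding mellin_piece_def by (simp add: integral_unique)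
qed

lemma mellin_piece_shift:
  assumes h: "\<And>w. w > 0 \<Longrightarrow> h w = w * f w"
  shows "mellin_piece h r z = mellin_piece f r (z + 1)"
proof -
  have "mellin_integrand h z r x = mellin_integrand f (z + 1) r x" for x
  proof -
    define u where "u = complex_of_real (ln 4 * (r - x))"
    have "of_real (exp4 (r - x)) = exp u" by (simp only: exp4_def u_def exp_of_real[symmetric])
    moreover have "exp ((z + 1) * u) = exp (z * u) * exp u" by (simp add: distrib_right exp_add)
    ultimately show ?thesis unfolding mellin_integrand_def u_def[symmetric] by (simp add: h)
  qed
  hence "mellin_integrand h z r = mellin_integrand f (z + 1) r" by (rule ext)
  then show ?thesis by (simp add: mellin_piece_def)
qed

text \<open>Euler's integral under the substitution t = l 4^x, whose derivative contributes t ln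
  4.\<close>

lemma Gamma_log_integral:
  assumes z: "z > 0" and l: "l > 0"
  shows "((\<lambda>x. exp (z * (ln 4 * x)) * exp (- (l * exp4 x))) has_integral (Gamma z * l powr (- z) / ln 4)) UNIV"
proof -
  let ?f = "\<lambda>t::real. t powr (z - 1) / exp t"
  let ?g = "\<lambda>x. l * exp4 x"
  have img: "?g ` UNIV = {0<..}"
  proof safe
    fix t :: real assume "t > 0"
    hence "t = ?g (ln (t / l) / ln 4)" using l by (simp add: exp4_def)
    then show "t \<in> range ?g" by blast
  qed (use l in simp)
  have "(?f has_integral Gamma z) {0..}" by (rule Gamma_integral_real[OF z])
  hence "((\<lambda>t. if t \<in> {0<..} then ?f t else 0) has_integral Gamma z) {0..}"
    by (rule has_integral_spike[of "{0}", rotated 2]) auto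
  hence hi: "(?f has_integral Gamma z) {0<..}"
    by (subst (asm) has_integral_restrict) auto
  hence "?f absolutely_integrable_on {0<..}"
    by (intro nonnegative_absolutely_integrable_1) (auto simp: integrable_on_def)
  hence "?f absolutely_integrable_on (?g ` UNIV) \<and> integral (?g ` UNIV) ?f = Gamma z"
    unfolding img using hi by (simp add: integral_unique)
  moreover have "inj_on ?g UNIV" using l by (auto simp: inj_on_def exp4_def)
  moreover have "(?g has_field_derivative (l * (exp4 x * ln 4))) (at x within UNIV)" for x
    unfolding exp4_def by (auto intro!: derivative_eq_intros)
  ultimately have "(\<lambda>x. \<bar>l * (exp4 x * ln 4)\<bar> * ?f (?g x)) absolutely_integrable_on UNIV \<and>
     integral UNIV (\<lambda>x. \<bar>l * (exp4 x * ln 4)\<bar> * ?f (?g x)) = Gamma z"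
    by (subst has_absolute_integral_change_of_variables_1') auto
  hence "((\<lambda>x. \<bar>l * (exp4 x * ln 4)\<bar> * ?f (?g x)) has_integral Gamma z) UNIV"
    unfolding has_integral_iff using set_lebesgue_integral_eq_integral(1) by blast
  hence "((\<lambda>x. l powr (- z) / ln 4 * (\<bar>l * (exp4 x * ln 4)\<bar> * ?f (?g x))) has_integral (l powr (- z) / ln 4 * Gamma z)) UNIV"
    by (rule has_integral_mult_right)
  moreover have "l powr (- z) / ln 4 * (\<bar>l * (exp4 x * ln 4)\<bar> * ?f (?g x)) = exp (z * (ln 4 * x)) * exp (- (l * exp4 x))" for x
  proof -
    have A: "\<bar>l * (exp4 x * ln 4)\<bar> = (l * exp4 x) * ln 4" using l by simp
    have B: "(l * exp4 x) * (l * exp4 x) powr (z - 1) = (l * exp4 x) powr z"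
      using l powr_mult_base[of "l * exp4 x" "z - 1"] by simp
    have C: "l powr (- z) * (l * exp4 x) powr z = exp (z * (ln 4 * x))"
      using l by (simp add: powr_mult powr_minus exp4_powr)
    have D: "l powr (- z) / ln 4 * ((l * exp4 x) * ln 4 * (P / E)) = l powr (- z) * ((l * exp4 x) * P) / E" for P E :: real
      by simp
    show ?thesis unfolding A D B C by (simp add: exp_minus divide_inverse)
  qed
  ultimately show ?thesis by (simp add: mult_ac)
qed

lemma mellin_piece_real:
  assumes f: "continuous_on {0<..} f"
  shows "mellin_piece f r (of_real z) = of_real (integral {r - 1..r} (\<lambda>x. f (exp4 x) * exp (z * (ln 4 * x))))"
proof -
  define F where "F = (\<lambda>x. f (exp4 x) * exp (z * (ln 4 * x)))"
  have cF: "continuous_on A F" for A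
    unfolding F_def by (intro continuous_intros continuous_on_compose2[OF f]) auto
  have "(F has_integral integral {r - 1..r} F) {r - 1..r}"
    by (intro integrable_integral integrable_continuous_real cF)
  from has_integral_affinity[of F _ "r - 1" r "-1" r] this
  have "((\<lambda>x. F (r - x)) has_integral integral {r - 1..r} F) ((\<lambda>x. r - x) ` {r - 1..r})" by simp
  moreover have "(\<lambda>x. r - x) ` {r - 1..r} = {0..1}" by (auto intro!: image_eqI[of _ _ "r - x" for x])
  ultimately have "((\<lambda>x. complex_of_real (F (r - x))) has_integral of_real (integral {r - 1..r} F)) {0..1}"
    by (intro has_integral_of_real) simp
  moreover have "complex_of_real (F (r - x)) = mellin_integrand f (of_real z) r x" for x
    by (simp add: F_def mellin_integrand_def exp_of_real[symmetric])
  ultimately show ?thesis unfolding mellin_piece_def by (simp add: integral_unique F_def)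
qed

text \<open>For real \<open>z\<close> and nonnegative coefficients, monotone convergence permits
  integration term by term, each term giving a Gamma integral. On the logarithmic scale the pieces
  up to N fill the interval from -N to N, so both halves together exhaust the line.\<close>

lemma mellin_exp_series:
  assumes f: "continuous_on {0<..} f" and z: "z > 0"
    and c: "\<And>j. c j \<ge> 0" and l: "\<And>j. l j > 0"
    and s: "\<And>w. w > 0 \<Longrightarrow> (\<lambda>j. c j * exp (- (l j * w))) sums f w"
    and g: "summable (\<lambda>j. c j * l j powr (- z))"
    and sr: "summable (\<lambda>j. mellin_piece f (real j + 1) (of_real z))" and sl: "summable (\<lambda>j. mellin_piece f (- real j) (of_real z))"
  shows "rmellin f (of_real z) + lmellin f (of_real z) = of_real (Gamma z * (\<Sum>j. c j * l j powr (- z)) / ln 4)"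
proof -
  define F where "F = (\<lambda>x. f (exp4 x) * exp (z * (ln 4 * x)))"
  have cF: "continuous_on A F" for A
    unfolding F_def by (intro continuous_intros continuous_on_compose2[OF f]) auto
  define G where "G = (\<lambda>j x. c j * (exp (z * (ln 4 * x)) * exp (- (l j * exp4 x))))"
  have G: "(G j has_integral (c j * (Gamma z * l j powr (- z) / ln 4))) UNIV" for j
    unfolding G_def by (intro has_integral_mult_right Gamma_log_integral z l)
  have GN: "((\<lambda>x. \<Sum>j<N. G j x) has_integral (\<Sum>j<N. c j * (Gamma z * l j powr (- z) / ln 4))) UNIV" for N
    by (intro has_integral_sum G) simp
  have tot: "(\<lambda>j. c j * (Gamma z * l j powr (- z) / ln 4)) sums (Gamma z * (\<Sum>j. c j * l j powr (- z)) / ln 4)"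
    using sums_divide[OF sums_mult[OF summable_sums[OF g], of "Gamma z"], of "ln 4"] by (simp add: mult_ac)
  have GF: "(\<lambda>j. G j x) sums F x" for x
    using sums_mult[OF s[of "exp4 x"], of "exp (z * (ln 4 * x))"] by (simp add: G_def F_def mult_ac)
  have "F integrable_on UNIV \<and> (\<lambda>N. integral UNIV (\<lambda>x. \<Sum>j<N. G j x)) \<longlonglongrightarrow> integral UNIV F"
  proof (rule monotone_convergence_increasing)
    show "(\<lambda>x. \<Sum>j<N. G j x) integrable_on UNIV" for N using GN by blast
    show "(\<Sum>j<N. G j x) \<le> (\<Sum>j<Suc N. G j x)" for N x using c by (simp add: G_def)
    show "(\<lambda>N. \<Sum>j<N. G j x) \<longlonglongrightarrow> F x" for x using GF by (simp add: sums_def)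
    have "(\<lambda>N. \<Sum>j<N. c j * (Gamma z * l j powr (- z) / ln 4)) \<longlonglongrightarrow> (Gamma z * (\<Sum>j. c j * l j powr (- z)) / ln 4)"
      using tot by (simp add: sums_def)
    then show "bounded (range (\<lambda>N. integral UNIV (\<lambda>x. \<Sum>j<N. G j x)))"
      unfolding integral_unique[OF GN] by (intro convergent_imp_bounded)
  qed
  moreover have "(\<lambda>N. integral UNIV (\<lambda>x. \<Sum>j<N. G j x)) \<longlonglongrightarrow> (Gamma z * (\<Sum>j. c j * l j powr (- z)) / ln 4)"
    unfolding integral_unique[OF GN] using tot by (simp add: sums_def)
  ultimately have F: "F integrable_on UNIV" "integral UNIV F = Gamma z * (\<Sum>j. c j * l j powr (- z)) / ln 4"
    by (auto intro: LIMSEQ_unique)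
  have F0: "F x \<ge> 0" for x
  proof -
    have "f (exp4 x) \<ge> 0" using s[of "exp4 x"] c by (intro sums_le[OF _ sums_zero s[of "exp4 x"]]) auto
    then show ?thesis by (simp add: F_def)
  qed
  have lim: "(\<lambda>N. integral UNIV (\<lambda>x. if x \<in> {- real N..real N} then F x else 0)) \<longlonglongrightarrow> integral UNIV F"
  proof (rule dominated_convergence(2)[where h = F])
    show "(\<lambda>x. if x \<in> {- real N..real N} then F x else 0) integrable_on UNIV" for N
      unfolding integrable_restrict_UNIV by (intro integrable_continuous_real cF)
    show "norm (if x \<in> {- real N..real N} then F x else 0) \<le> F x" for N x using F0 by simp
    show "(\<lambda>N. if x \<in> {- real N..real N} then F x else 0) \<longlonglongrightarrow> F x" for x
    proof (rule tendsto_eventually, rule eventually_sequentiallyI[of "nat \<lceil>\<bar>x\<bar>\<rceil>"])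
      fix N assume "nat \<lceil>\<bar>x\<bar>\<rceil> \<le> N"
      hence "\<bar>x\<bar> \<le> real N" by (rule order_trans[OF real_nat_ceiling_ge, OF of_nat_mono])
      then show "(if x \<in> {- real N..real N} then F x else 0) = F x" by (simp add: abs_le_iff)
    qed
  qed (rule F(1))
  have part: "(\<Sum>j<N. mellin_piece f (real j + 1) (of_real z)) + (\<Sum>j<N. mellin_piece f (- real j) (of_real z)) =
     of_real (integral {- real N..real N} F)" for N
  proof (induction N)
    case (Suc N)
    have i: "F integrable_on {a..b}" for a b by (intro integrable_continuous_real cF)
    have "integral {- real (Suc N)..real (Suc N)} F = integral {- real (Suc N)..- real N} F + integral {- real N..real (Suc N)} F"
      by (rule Henstock_Kurzweil_Integration.integral_combine[symmetric]) (auto intro: i)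
    also have "integral {- real N..real (Suc N)} F = integral {- real N..real N} F + integral {real N..real (Suc N)} F"
      by (rule Henstock_Kurzweil_Integration.integral_combine[symmetric]) (auto intro: i)
    finally have fin: "integral {- real (Suc N)..real (Suc N)} F = integral {- real (Suc N)..- real N} F +
      (integral {- real N..real N} F + integral {real N..real (Suc N)} F)" .
    have "real N + 1 - 1 = real N" "real N + 1 = real (Suc N)" "- real N - 1 = - real (Suc N)" by simp_all
    hence p: "mellin_piece f (real N + 1) (of_real z) = of_real (integral {real N..real (Suc N)} F)"
      "mellin_piece f (- real N) (of_real z) = of_real (integral {- real (Suc N)..- real N} F)"
      unfolding mellin_piece_real[OF f] F_def by (simp_all only:)
    have "(A + a) + (B + b) = b + (I + a)" if "A + B = I" for A B I a b :: complex
      unfolding that[symmetric] by simp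
    from this[OF Suc] show ?case unfolding sum.lessThan_Suc p fin of_real_add .
  qed simp
  have "(\<lambda>N. (\<Sum>j<N. mellin_piece f (real j + 1) (of_real z)) + (\<Sum>j<N. mellin_piece f (- real j) (of_real z)))
     \<longlonglongrightarrow> rmellin f (of_real z) + lmellin f (of_real z)"
    unfolding rmellin_def lmellin_def using summable_sums[OF sr] summable_sums[OF sl]
    by (intro tendsto_add) (simp_all add: sums_def)
  moreover have "(\<lambda>N. (\<Sum>j<N. mellin_piece f (real j + 1) (of_real z)) + (\<Sum>j<N. mellin_piece f (- real j) (of_real z)))
     \<longlonglongrightarrow> of_real (integral UNIV F)"
    unfolding part using lim unfolding integral_restrict_UNIV by (intro tendsto_of_real)
  ultimately show ?thesis unfolding F(2) by (rule LIMSEQ_unique)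
qed

section \<open>The zeta function\<close>

lemma powr_bound_exp:
  assumes "w \<ge> (1::real)"
  shows "exp (- w) \<le> fact (nat \<lceil>- p\<rceil>) * w powr p"
proof -
  define k where "k = nat \<lceil>- p\<rceil>"
  have "(\<Sum>i\<in>{k}. inverse (fact i) * w ^ i) \<le> (\<Sum>i. inverse (fact i) * w ^ i)"
    by (rule sum_le_suminf) (use assms in \<open>auto intro: summable_exp\<close>)
  hence "w ^ k / fact k \<le> exp w" by (simp add: exp_def scaleR_conv_of_real divide_inverse mult.commute)
  hence "exp (- w) \<le> fact k * inverse (w ^ k)" using assms by (simp add: exp_minus field_simps)
  also have "inverse (w ^ k) = w powr (- real k)" using assms by (simp add: powr_minus powr_realpow)
  also have "\<dots> \<le> w powr p"
  proof (rule powr_mono)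
    have "- p \<le> real k" unfolding k_def by (rule real_nat_ceiling_ge)
    then show "- real k \<le> p" by simp
  qed (use assms in simp)
  finally show ?thesis by (simp add: k_def)
qed

lemma holomorphic_on_all_halfplanes:
  assumes "\<And>K. f holomorphic_on {z. Re z < K}"
  shows "f holomorphic_on UNIV"
  unfolding holomorphic_on_def
proof
  fix z :: complex
  show "f field_differentiable (at z within UNIV)"
    using holomorphic_on_imp_differentiable_at[OF assms[of "Re z + 1"] open_halfspace_Re_lt] by simp
qed

lemma dirichlet_holomorphic:
  shows "(\<lambda>s. \<Sum>n. of_nat (Suc n) powr (- s)) holomorphic_on {s. Re s > 1}"
    and "Re s > 1 \<Longrightarrow> summable (\<lambda>n. of_nat (Suc n) powr (- s) :: complex)"
proof -
  have b: "\<exists>d>0. \<exists>M. cball z d \<subseteq> {s. Re s > 1} \<and> summable M \<and> (\<exists>n0. \<forall>n\<ge>n0. \<forall>w\<in>cball z d. norm (of_nat (Suc n) powr (- w) :: complex) \<le> M n)"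
    if z: "z \<in> {s. Re s > 1}" for z
  proof -
    define d where "d = (Re z - 1) / 2"
    have d: "d > 0" using z by (simp add: d_def)
    have Re: "1 + d \<le> Re w" if "w \<in> cball z d" for w
    proof -
      have "Re z - Re w \<le> d" using that abs_Re_le_cmod[of "z - w"] by (simp add: dist_norm abs_le_iff)
      then show ?thesis by (simp add: d_def field_simps)
    qed
    have "norm (of_nat (Suc n) powr (- w) :: complex) \<le> real (Suc n) powr (- (1 + d))" if "w \<in> cball z d" for n w
    proof -
      have "norm (of_nat (Suc n) powr (- w) :: complex) = real (Suc n) powr (- Re w)"
        using norm_powr_real_powr[of "of_nat (Suc n)" "- w"] by (simp del: of_nat_Suc)
      also have "\<dots> \<le> real (Suc n) powr (- (1 + d))" using Re[OF that] by (intro powr_mono) auto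
      finally show ?thesis .
    qed
    moreover have "cball z d \<subseteq> {s. Re s > 1}"
    proof
      fix w assume "w \<in> cball z d"
      from Re[OF this] d show "w \<in> {s. Re s > 1}" by simp
    qed
    moreover have "summable (\<lambda>n. real (Suc n) powr (- (1 + d)))"
      using d by (subst summable_Suc_iff) (simp add: summable_real_powr_iff)
    ultimately show ?thesis using d by blast
  qed
  have h: "(\<lambda>s. of_nat (Suc n) powr (- s) :: complex) holomorphic_on {s. Re s > 1}" for n
    by (intro holomorphic_intros)
  show "(\<lambda>s. \<Sum>n. of_nat (Suc n) powr (- s) :: complex) holomorphic_on {s. Re s > 1}"
    by (rule holomorphic_series(1)[OF open_halfspace_Re_gt h b])
  show "summable (\<lambda>n. of_nat (Suc n) powr (- s) :: complex)" if "Re s > 1"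
    using holomorphic_series(2)[OF open_halfspace_Re_gt h b, of s] that by simp
qed

text \<open>The integrand of Riemann's formula: Gamma(s) zeta(s) is the integral of w^(s - 1) / (exp
  w - 1) over the positive half-line, for Re s > 1.\<close>

definition bose :: "real \<Rightarrow> real" where "bose w = 1 / (exp w - 1)"

lemma continuous_bose: "continuous_on {0<..} bose"
  unfolding bose_def by (intro continuous_intros) auto

lemma bose_bound: "w \<ge> 1 \<Longrightarrow> \<bar>bose w\<bar> \<le> 2 * fact (nat \<lceil>- p\<rceil>) * w powr p"
proof -
  assume w: "w \<ge> 1"
  have "2 \<le> 1 + w" using w by simp
  hence e: "exp w \<ge> 2" using exp_ge_add_one_self by (rule order_trans)
  have "\<bar>bose w\<bar> = 1 / (exp w - 1)" using e by (simp add: bose_def)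
  also have "\<dots> \<le> 1 / (exp w / 2)" using e w by (intro divide_left_mono mult_pos_pos) auto
  also have "\<dots> = 2 * exp (- w)" by (simp add: exp_minus inverse_eq_divide)
  also have "\<dots> \<le> 2 * (fact (nat \<lceil>- p\<rceil>) * w powr p)" using powr_bound_exp[OF w, of p] by simp
  finally show ?thesis by simp
qed

lemma rmellin_bose: "rmellin bose holomorphic_on UNIV" "summable (\<lambda>j. mellin_piece bose (real j + 1) z)"
proof -
  show "rmellin bose holomorphic_on UNIV"
  proof (rule holomorphic_on_all_halfplanes)
    fix K
    show "rmellin bose holomorphic_on {z. Re z < K}"
      using rmellin_holomorphic(1)[OF continuous_bose, of "2 * fact (nat \<lceil>- (- K)\<rceil>)" "- K"] bose_bound[of _ "- K"] by simp
  qed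
  show "summable (\<lambda>j. mellin_piece bose (real j + 1) z)"
    by (rule rmellin_holomorphic(2)[OF continuous_bose _ bose_bound, of "- Re z - 1"]) auto
qed

text \<open>The coefficients are B_n / n! with the Bernoulli numbers B_n. The singularities of w /
  (exp w - 1) nearest to 0 are at plus and minus 2 pi i, so the function is holomorphic on the disc
  of radius 2 and the coefficients are absolutely summable.\<close>

lemma bose_taylor:
  obtains \<alpha> :: "nat \<Rightarrow> real" where "summable (\<lambda>n. \<bar>\<alpha> n\<bar>)"
    "\<And>w. 0 < w \<Longrightarrow> w \<le> 1 \<Longrightarrow> (\<lambda>n. \<alpha> n * w ^ n) sums (w * bose w)"
proof -
  \<comment> \<open>(exp w - 1) / w with the removable singularity filled; its inverse is what gets
    expanded.\<close>
  define G :: "complex \<Rightarrow> complex" where "G = (\<lambda>w. if w = 0 then deriv exp 0 else (exp w - exp 0) / (w - 0))"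
  have G: "G holomorphic_on ball 0 2"
    unfolding G_def by (rule pole_lemma) (auto intro: holomorphic_intros)
  have nz: "G w \<noteq> 0" if "w \<in> ball 0 2" for w
  proof (cases "w = 0")
    case True
    then show ?thesis using DERIV_imp_deriv[OF DERIV_exp[of "0::complex"]] by (simp add: G_def)
  next
    case False
    have "exp w \<noteq> 1"
    proof
      assume "exp w = 1"
      then obtain n :: int where n: "Re w = 0" "Im w = of_int (2 * n) * pi" by (auto simp: exp_eq_1)
      have "\<bar>Im w\<bar> < 2" using that abs_Im_le_cmod[of w] by simp
      moreover have "\<bar>Im w\<bar> = 2 * pi * \<bar>real_of_int n\<bar>" unfolding n(2) by (simp add: abs_mult)
      ultimately have *: "2 * pi * \<bar>real_of_int n\<bar> < 2" by (simp only:)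
      have "n = 0"
      proof (rule ccontr)
        assume "n \<noteq> 0"
        hence "1 \<le> \<bar>real_of_int n\<bar>" by simp
        hence "2 * pi * 1 \<le> 2 * pi * \<bar>real_of_int n\<bar>" by (intro mult_left_mono) auto
        hence "2 * pi * 1 < 2" using * by (rule order_le_less_trans)
        then show False using pi_gt3 by simp
      qed
      then show False using n False by (simp add: complex_eq_iff)
    qed
    then show ?thesis using False by (simp add: G_def)
  qed
  define h where "h = (\<lambda>w. inverse (G w))"
  have h: "h holomorphic_on ball 0 2" unfolding h_def by (rule holomorphic_on_inverse[OF G nz])
  define a where "a = (\<lambda>n. (deriv ^^ n) h 0 / fact n)"
  have s: "(\<lambda>n. a n * w ^ n) sums h w" if "w \<in> ball 0 2" for w
    using holomorphic_power_series[OF h that] by (simp add: a_def)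
  have "summable (\<lambda>n. norm (a n * 1 ^ n))"
    by (rule powser_insidea[OF sums_summable[OF s[of "3 / 2"]]]) (auto simp: dist_norm)
  hence sa: "summable (\<lambda>n. norm (a n))" by simp
  show ?thesis
  proof (rule that[of "\<lambda>n. Re (a n)"])
    show "summable (\<lambda>n. \<bar>Re (a n)\<bar>)"
      by (rule summable_comparison_test'[OF sa, of 0]) (use abs_Re_le_cmod in auto)
    fix w :: real assume w: "0 < w" "w \<le> 1"
    have "(\<lambda>n. a n * of_real w ^ n) sums h (of_real w)" by (rule s) (use w in auto)
    hence "(\<lambda>n. Re (a n * of_real w ^ n)) sums Re (h (of_real w))" by (rule sums_Re)
    moreover have "h (of_real w) = of_real (w * bose w)"
      using w by (simp add: h_def G_def bose_def exp_of_real)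
    moreover have "Re (a n * of_real w ^ n) = Re (a n) * w ^ n" for n
      unfolding of_real_power[symmetric] by simp
    ultimately show "(\<lambda>n. Re (a n) * w ^ n) sums (w * bose w)" by simp
  qed
qed

lemma lmellin_linear:
  assumes f: "continuous_on {0<..} f" and g: "continuous_on {0<..} g"
    and sf: "summable (\<lambda>j. mellin_piece f (- real j) z)" and sg: "summable (\<lambda>j. mellin_piece g (- real j) z)"
    and h: "\<And>w. w > 0 \<Longrightarrow> h w = a * f w + b * g w"
  shows "lmellin h z = of_real a * lmellin f z + of_real b * lmellin g z"
proof -
  have p: "mellin_piece h r z = of_real a * mellin_piece f r z + of_real b * mellin_piece g r z" for r
    by (rule mellin_piece_linear[OF f g]) (rule h)
  have "(\<lambda>j. mellin_piece h (- real j) z) sums (of_real a * lmellin f z + of_real b * lmellin g z)"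
    unfolding p lmellin_def
    by (intro sums_add sums_mult summable_sums sf sg)
  then show ?thesis by (simp add: lmellin_def sums_unique[symmetric])
qed

lemma continuous_powr_pos: "continuous_on {0<..} (\<lambda>w::real. w powr p)"
  by (intro continuous_intros) auto

text \<open>Each power w^(z + n - 2) integrates to 1 / (z + n - 1) over the unit interval. The
  remainder after K terms is at most the tail of the coefficients times 1 / w, so its transform
  tends to 0.\<close>

lemma lmellin_bose:
  assumes \<alpha>: "summable (\<lambda>n. \<bar>\<alpha> n\<bar>)" "\<And>w. 0 < w \<Longrightarrow> w \<le> 1 \<Longrightarrow> (\<lambda>n. \<alpha> n * w ^ n) sums (w * bose w)"
    and z: "Re z > 1"
  shows "(\<lambda>n. of_real (\<alpha> n) / (z + of_nat n - 1)) sums (of_real (ln 4) * lmellin bose z)"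
    "summable (\<lambda>j. mellin_piece bose (- real j) z)"
proof -
  define R where "R = (\<lambda>K w. bose w - (\<Sum>n<K. \<alpha> n * w powr (real n - 1)))"
  define t where "t = (\<lambda>K. \<Sum>n. \<bar>\<alpha> (n + K)\<bar>)"
  have t0: "t K \<ge> 0" for K unfolding t_def using summable_ignore_initial_segment[OF \<alpha>(1), of K] by (intro suminf_nonneg) auto
  have cR: "continuous_on {0<..} (R K)" for K
    unfolding R_def by (intro continuous_intros continuous_bose) auto
  have bR: "\<bar>R K w\<bar> \<le> t K * w powr (- 1)" if w: "0 < w" "w \<le> 1" for K w
  proof -
    have "w * w powr (real n - 1) = w ^ n" for n
      using w powr_mult_base[of w "real n - 1"] by (simp add: powr_realpow)
    hence "w * (\<alpha> n * w powr (real n - 1)) = \<alpha> n * w ^ n" for n by (metis mult.left_commute)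
    hence wR: "w * R K w = w * bose w - (\<Sum>n<K. \<alpha> n * w ^ n)"
      unfolding R_def right_diff_distrib sum_distrib_left by (simp only:)
    have sm: "summable (\<lambda>n. \<alpha> n * w ^ n)" "w * bose w = (\<Sum>n. \<alpha> n * w ^ n)"
      using \<alpha>(2)[OF w] by (auto simp: sums_iff)
    have "w * R K w = (\<Sum>n. \<alpha> (n + K) * w ^ (n + K))"
      unfolding wR sm(2) using suminf_split_initial_segment[OF sm(1), of K] by simp
    also have "\<bar>\<dots>\<bar> \<le> t K"
      unfolding t_def
    proof (rule norm_suminf_le[where 'a = real, unfolded real_norm_def])
      fix n
      have "w ^ (n + K) \<le> 1" "0 \<le> w ^ (n + K)" using w by (auto intro: power_le_one)
      then show "\<bar>\<alpha> (n + K) * w ^ (n + K)\<bar> \<le> \<bar>\<alpha> (n + K)\<bar>" by (simp add: abs_mult mult_left_le)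
    qed (rule summable_ignore_initial_segment[OF \<alpha>(1)])
    finally have "w * \<bar>R K w\<bar> \<le> t K" using w by (simp add: abs_mult)
    then show ?thesis using w by (simp add: powr_minus field_simps)
  qed
  have sR: "summable (\<lambda>j. mellin_piece (R K) (- real j) z)" for K
    by (rule lmellin_holomorphic(2)[OF cR t0 bR]) (use z in auto)
  have R0: "R 0 = bose" by (simp add: R_def)
  show "summable (\<lambda>j. mellin_piece bose (- real j) z)" using sR[of 0] by (simp add: R0)
  have spw: "summable (\<lambda>j. mellin_piece (\<lambda>w. w powr (real n - 1)) (- real j) z)" for n
    by (rule lmellin_holomorphic(2)[OF continuous_powr_pos, where C = 1 and p = "real n - 1"]) (use z in auto)
  have step: "lmellin (R K) z = lmellin (R (Suc K)) z + of_real (\<alpha> K) / ((z + of_nat K - 1) * of_real (ln 4))" for K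
  proof -
    have "lmellin (R K) z = of_real 1 * lmellin (R (Suc K)) z + of_real (\<alpha> K) * lmellin (\<lambda>w. w powr (real K - 1)) z"
      by (rule lmellin_linear[OF cR continuous_powr_pos sR spw]) (simp add: R_def)
    moreover have "lmellin (\<lambda>w. w powr (real K - 1)) z = 1 / ((of_real (real K - 1) + z) * of_real (ln 4))"
      by (rule lmellin_powr) (use z in simp)
    ultimately show ?thesis by (simp add: algebra_simps)
  qed
  have part: "of_real (ln 4) * lmellin bose z = (\<Sum>n<K. of_real (\<alpha> n) / (z + of_nat n - 1)) + of_real (ln 4) * lmellin (R K) z" for K
  proof (induction K)
    case 0
    then show ?case by (simp add: R0)
  next
    case (Suc K)
    have l4: "complex_of_real (ln 4) \<noteq> 0" using ln_4_pos by (simp del: ln_4_pos)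
    have "of_real (ln 4) * (L + A / (Z * of_real (ln 4))) = of_real (ln 4) * L + A / Z" for L A Z :: complex
      using l4 by (simp add: field_simps)
    then show ?case using Suc step[of K] by simp
  qed
  have "(\<lambda>K. lmellin (R K) z) \<longlonglongrightarrow> 0"
  proof (rule Lim_null_comparison)
    let ?q = "1 - exp (- ((- 1 + Re z) * ln 4))"
    show "\<forall>\<^sub>F K in sequentially. norm (lmellin (R K) z) \<le> t K / ?q"
      by (intro always_eventually allI lmellin_holomorphic(3)[OF cR t0 bR]) (use z in auto)
    have "t \<longlonglongrightarrow> 0" unfolding t_def using suminf_exist_split2[OF \<alpha>(1)] by simp
    then show "(\<lambda>K. t K / ?q) \<longlonglongrightarrow> 0" using z by (intro tendsto_divide_zero)
  qed
  hence "(\<lambda>K. of_real (ln 4) * lmellin bose z - of_real (ln 4) * lmellin (R K) z) \<longlonglongrightarrow> of_real (ln 4) * lmellin bose z - of_real (ln 4) * 0"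
    by (intro tendsto_intros)
  moreover have "of_real (ln 4) * lmellin bose z - of_real (ln 4) * lmellin (R K) z = (\<Sum>n<K. of_real (\<alpha> n) / (z + of_nat n - 1))" for K
    using part[of K] by simp
  ultimately show "(\<lambda>n. of_real (\<alpha> n) / (z + of_nat n - 1)) sums (of_real (ln 4) * lmellin bose z)"
    by (simp add: sums_def)
qed


text \<open>The product of \<open>rGamma s\<close> and \<open>1 / (s + n - 1)\<close>, which is the integral of \<open>w powr (s + n - 2)\<close> over the unit interval,
  written such that the removable singularities for \<open>n > 0\<close> do not show.\<close>

definition zeta_term :: "nat \<Rightarrow> complex \<Rightarrow> complex" where
  "zeta_term n s = (case n of 0 \<Rightarrow> rGamma s / (s - 1) | Suc m \<Rightarrow> pochhammer s m * rGamma (s + of_nat (Suc m)))"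

lemma zeta_term_mult: "(s + of_nat n - 1) * zeta_term n s = rGamma s" if "s \<noteq> 1"
proof (cases n)
  case 0
  then show ?thesis using that by (simp add: zeta_term_def)
next
  case (Suc m)
  have "rGamma s = pochhammer s (Suc m) * rGamma (s + of_nat (Suc m))" by (rule pochhammer_rGamma)
  then show ?thesis unfolding Suc zeta_term_def pochhammer_Suc by (simp add: mult_ac)
qed

lemma zeta_term_holomorphic: "zeta_term n holomorphic_on - {1}"
proof (cases n)
  case 0
  have "(\<lambda>s. rGamma s / (s - 1)) holomorphic_on - {1}"
    by (intro holomorphic_intros) auto
  then show ?thesis by (simp add: 0 zeta_term_def[abs_def])
next
  case (Suc m)
  have "(\<lambda>s. pochhammer s m * rGamma (s + of_nat (Suc m))) holomorphic_on - {1}"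
    unfolding pochhammer_prod by (intro holomorphic_intros)
  then show ?thesis by (simp add: Suc zeta_term_def[abs_def])
qed

text \<open>On a small disc the factor s + n - 1 has modulus at least 1 once \<open>n\<close> is
  large. There \<open>zeta_term n\<close> is bounded by the maximum of \<open>rGamma\<close>, and
  the summable coefficients give a majorant.\<close>

lemma zeta_tail_holomorphic:
  assumes \<alpha>: "summable (\<lambda>n. \<bar>\<alpha> n\<bar>)"
  shows "(\<lambda>s. \<Sum>n. of_real (\<alpha> n) * zeta_term n s) holomorphic_on - {1}"
proof (rule holomorphic_series(1))
  show op: "open (- {1::complex})" by auto
  show "(\<lambda>s. of_real (\<alpha> n) * zeta_term n s) holomorphic_on - {1}" for n
    by (intro holomorphic_intros zeta_term_holomorphic)
  fix z :: complex assume "z \<in> - {1}"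
  then obtain d where d: "d > 0" "cball z d \<subseteq> - {1}" using op open_contains_cball by blast
  have "compact (rGamma ` cball z d)"
    by (intro compact_continuous_image holomorphic_on_imp_continuous_on holomorphic_intros) auto
  then obtain B where B: "\<And>s. s \<in> cball z d \<Longrightarrow> norm (rGamma s) \<le> B" using compact_imp_bounded bounded_iff by (metis imageI)
  define n0 where "n0 = nat \<lceil>norm z + d + 2\<rceil>"
  have "norm (of_real (\<alpha> n) * zeta_term n s) \<le> B * \<bar>\<alpha> n\<bar>" if n: "n \<ge> n0" and s: "s \<in> cball z d" for n s
  proof -
    have "norm z + d + 2 \<le> real n0" unfolding n0_def by (rule real_nat_ceiling_ge)
    hence "norm z + d + 2 \<le> real n" using n by (meson of_nat_mono order_trans)
    moreover have "norm s \<le> norm z + d" using s norm_triangle_ineq2[of s z] by (simp add: dist_norm norm_minus_commute)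
    moreover have "norm (s + of_nat n - 1) \<ge> real n - norm s - 1"
    proof -
      have "real n = norm ((s + of_nat n - 1) - s + 1)" by simp
      also have "\<dots> \<le> norm (s + of_nat n - 1) + norm s + norm (1::complex)"
        by (meson add_mono norm_triangle_ineq norm_triangle_ineq4 order_refl order_trans)
      finally show ?thesis by simp
    qed
    ultimately have ge: "1 \<le> norm (s + of_nat n - 1)" by simp
    have "s \<noteq> 1" using s d by auto
    from zeta_term_mult[OF this, of n] have "norm (s + of_nat n - 1) * norm (zeta_term n s) = norm (rGamma s)"
      by (metis norm_mult)
    moreover have "1 * norm (zeta_term n s) \<le> norm (s + of_nat n - 1) * norm (zeta_term n s)"
      using ge by (intro mult_right_mono) auto
    ultimately have "norm (zeta_term n s) \<le> B" using B[OF s] by simp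
    then show ?thesis by (simp add: norm_mult mult.commute[of B] mult_left_mono)
  qed
  then show "\<exists>d>0. \<exists>M. cball z d \<subseteq> - {1} \<and> summable M \<and>
      (\<exists>n0. \<forall>n\<ge>n0. \<forall>s\<in>cball z d. norm (of_real (\<alpha> n) * zeta_term n s) \<le> M n)"
    using d summable_mult[OF \<alpha>, of B] by blast
qed

lemma bose_mellin:
  assumes x: "x > (1::real)"
  shows "of_real (ln 4) * (rmellin bose (of_real x) + lmellin bose (of_real x)) =
     Gamma (of_real x) * (\<Sum>n. of_nat (Suc n) powr (- of_real x) :: complex)"
proof -
  obtain \<alpha> :: "nat \<Rightarrow> real" where \<alpha>: "summable (\<lambda>n. \<bar>\<alpha> n\<bar>)"
    "\<And>w. 0 < w \<Longrightarrow> w \<le> 1 \<Longrightarrow> (\<lambda>n. \<alpha> n * w ^ n) sums (w * bose w)" using bose_taylor by blast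
  have s: "summable (\<lambda>n. real (Suc n) powr (- x))"
    using x by (subst summable_Suc_iff) (simp add: summable_real_powr_iff)
  have "rmellin bose (of_real x) + lmellin bose (of_real x) = of_real (Gamma x * (\<Sum>j. 1 * real (Suc j) powr (- x)) / ln 4)"
  proof (rule mellin_exp_series[OF continuous_bose])
    fix w :: real assume w: "w > 0"
    have "(\<lambda>j. exp (- w) * exp (- w) ^ j) sums (exp (- w) * (1 / (1 - exp (- w))))"
      using w by (intro sums_mult geometric_sums) simp
    moreover have "exp (- w) * exp (- w) ^ j = 1 * exp (- (real (Suc j) * w))" for j
      by (simp add: exp_of_nat_mult[symmetric] exp_add[symmetric] algebra_simps)
    moreover have "exp (- w) * (1 / (1 - exp (- w))) = bose w"
    proof -
      have "exp w * (1 - exp (- w)) = exp w - 1" by (simp add: exp_minus right_diff_distrib)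
      then show ?thesis by (simp add: bose_def exp_minus divide_simps)
    qed
    ultimately show "(\<lambda>j. 1 * exp (- (real (Suc j) * w))) sums bose w" by simp
  next
    show "summable (\<lambda>j. mellin_piece bose (real j + 1) (of_real x))" by (rule rmellin_bose)
    show "summable (\<lambda>j. mellin_piece bose (- real j) (of_real x))" by (rule lmellin_bose(2)[OF \<alpha>]) (use x in auto)
  qed (use x s in auto)
  also have "\<dots> = Gamma (of_real x) * (\<Sum>n. of_nat (Suc n) powr (- of_real x)) / of_real (ln 4)"
  proof -
    have "complex_of_real (real (Suc n) powr (- x)) = of_nat (Suc n) powr (- of_real x)" for n
      using powr_of_real[of "real (Suc n)" "- x"] by (simp del: of_nat_Suc)
    hence "complex_of_real (\<Sum>n. real (Suc n) powr (- x)) = (\<Sum>n. of_nat (Suc n) powr (- of_real x))"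
      using suminf_of_real[OF s, where 'a = complex] by simp
    then show ?thesis using x by (simp add: Gamma_complex_of_real)
  qed
  finally show ?thesis using ln_4_pos by (simp add: field_simps del: ln_4_pos)
qed

text \<open>Riemann's formula divided by Gamma, that is, multiplied by the entire function
  \<open>rGamma\<close>: the integral over w \<ge> 1 becomes entire, and the one over w \<le> 1
  becomes the series of the terms \<open>zeta_term\<close>. Agreement with the Dirichlet series is
  shown on the real axis, where \<open>mellin_exp_series\<close> applies, and extended by the
  identity theorem.\<close>

lemma zeta_exists:
  "\<exists>f. f holomorphic_on - {1} \<and> (\<forall>s. Re s > 1 \<longrightarrow> (\<lambda>n. of_nat (Suc n) powr (- s)) sums f s)"
proof -
  obtain \<alpha> :: "nat \<Rightarrow> real" where \<alpha>: "summable (\<lambda>n. \<bar>\<alpha> n\<bar>)"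
    "\<And>w. 0 < w \<Longrightarrow> w \<le> 1 \<Longrightarrow> (\<lambda>n. \<alpha> n * w ^ n) sums (w * bose w)" using bose_taylor by blast
  define F where "F = (\<lambda>s. rGamma s * of_real (ln 4) * rmellin bose s + (\<Sum>n. of_real (\<alpha> n) * zeta_term n s))"
  define Z where "Z = (\<lambda>s::complex. \<Sum>n. of_nat (Suc n) powr (- s))"
  have F: "F holomorphic_on - {1}"
    unfolding F_def
    by (intro holomorphic_intros zeta_tail_holomorphic[OF \<alpha>(1)] holomorphic_on_subset[OF rmellin_bose(1)]) auto
  have real: "F (of_real x) - Z (of_real x) = 0" if x: "x > 1" for x :: real
  proof -
    let ?x = "complex_of_real x"
    have x1: "?x \<noteq> 1" using x by (metis of_real_eq_1_iff less_irrefl)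
    have ne: "?x + of_nat n - 1 \<noteq> 0" for n
    proof -
      have "?x + of_nat n - 1 = of_real (x + real n - 1)" by simp
      moreover have "x + real n - 1 \<noteq> 0" using x by (smt (verit) of_nat_0_le_iff)
      ultimately show ?thesis by (metis of_real_eq_0_iff)
    qed
    have "(\<lambda>n. rGamma ?x * (of_real (\<alpha> n) / (?x + of_nat n - 1))) sums (rGamma ?x * (of_real (ln 4) * lmellin bose ?x))"
      by (intro sums_mult lmellin_bose(1)[OF \<alpha>]) (use x in auto)
    moreover have "rGamma ?x * (of_real (\<alpha> n) / (?x + of_nat n - 1)) = of_real (\<alpha> n) * zeta_term n ?x" for n
      unfolding zeta_term_mult[OF x1, of n, symmetric] using ne[of n] by simp
    ultimately have "(\<Sum>n. of_real (\<alpha> n) * zeta_term n ?x) = rGamma ?x * (of_real (ln 4) * lmellin bose ?x)"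
      by (simp add: sums_iff)
    hence "F ?x = rGamma ?x * (of_real (ln 4) * (rmellin bose ?x + lmellin bose ?x))"
      by (simp add: F_def algebra_simps)
    also have "\<dots> = (rGamma ?x * Gamma ?x) * Z ?x" unfolding bose_mellin[OF x] Z_def by simp
    also have "rGamma ?x * Gamma ?x = 1"
    proof -
      have "?x \<notin> \<int>\<^sub>\<le>\<^sub>0" using x by (auto elim!: nonpos_Ints_cases simp: complex_eq_iff)
      hence "Gamma ?x \<noteq> 0" by (simp add: Gamma_eq_zero_iff)
      then show ?thesis by (simp add: rGamma_inverse_Gamma)
    qed
    finally show ?thesis by simp
  qed
  have eq: "F s = Z s" if s: "Re s > 1" for s
  proof -
    have "F s - Z s = 0"
    proof (rule analytic_continuation[of "\<lambda>s. F s - Z s" "{s. Re s > 1}" "of_real ` {1<..}" 2 s])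
      show "(\<lambda>s. F s - Z s) holomorphic_on {s. Re s > 1}"
        unfolding Z_def by (intro holomorphic_intros dirichlet_holomorphic(1) holomorphic_on_subset[OF F]) auto
      show "connected {s::complex. Re s > 1}" by (intro convex_connected convex_halfspace_Re_gt)
      show "(2::complex) islimpt of_real ` {1<..}"
      proof -
        have "complex_of_real 2 islimpt of_real ` {1<..}"
        proof (rule islimpt_isCont_image)
          show "eventually (\<lambda>y. complex_of_real y \<noteq> of_real 2) (at 2)"
            unfolding of_real_eq_iff by (rule eventually_neq_at_within)
        qed (auto intro!: open_imp_islimpt)
        then show ?thesis by simp
      qed
    qed (use s real open_halfspace_Re_gt in auto)
    then show ?thesis by simp
  qed
  have "(\<lambda>n. of_nat (Suc n) powr (- s)) sums F s" if "Re s > 1" for s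
    unfolding eq[OF that] Z_def by (rule summable_sums[OF dirichlet_holomorphic(2)[OF that]])
  with F show ?thesis by blast
qed

lemma zeta_holomorphic: "zeta holomorphic_on - {1}"
  and zeta_sums: "Re s > 1 \<Longrightarrow> (\<lambda>n. of_nat (Suc n) powr (- s)) sums zeta s"
proof -
  have "zeta holomorphic_on - {1} \<and> (\<forall>s. Re s > 1 \<longrightarrow> (\<lambda>n. of_nat (Suc n) powr (- s)) sums zeta s)"
    unfolding zeta_def by (rule someI_ex[OF zeta_exists])
  then show "zeta holomorphic_on - {1}" "Re s > 1 \<Longrightarrow> (\<lambda>n. of_nat (Suc n) powr (- s)) sums zeta s" by blast+
qed

section \<open>The Mellin transform of the level function\<close>

text \<open>In the variable w = x^2 the Gaussian factors become exp (- k^2 w), the shape that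
  \<open>mellin_exp_series\<close> expects.\<close>

definition sqrt_series :: "nat \<Rightarrow> real poly \<Rightarrow> real \<Rightarrow> real" where
  "sqrt_series i p w = gsum i p (sqrt w)"

lemma continuous_sqrt_series: "continuous_on {0<..} (sqrt_series i p)"
proof -
  have "isCont (gsum i p) x" if "x > 0" for x using gsum_deriv[OF that] by (rule DERIV_isCont)
  hence "continuous_on {0<..} (gsum i p)" by (intro continuous_at_imp_continuous_on) auto
  then show ?thesis unfolding sqrt_series_def[abs_def]
    by (rule continuous_on_compose2) (auto intro!: continuous_intros)
qed

lemma sqrt_power_powr: "w > 0 \<Longrightarrow> sqrt w ^ q = w powr (real q / 2)"
  by (simp add: powr_half_sqrt[symmetric] powr_realpow[symmetric] powr_powr)

lemma sqrt_series_bound_right: "\<exists>C\<ge>0. \<forall>w\<ge>1. \<bar>sqrt_series i p w\<bar> \<le> C * w powr s"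
proof -
  \<comment> \<open>\<open>i + 2\<close> is what \<open>gsum_bound\<close> demands; the 2 in
    \<open>- 2 * s\<close> compensates for the square root in the argument.\<close>
  define q where "q = max (i + 2) (nat \<lceil>- 2 * s\<rceil>)"
  obtain C where C: "C \<ge> 0" "\<And>x. x > 0 \<Longrightarrow> \<bar>gsum i p x\<bar> \<le> C / x ^ q" using gsum_bound[of i q p] by (auto simp: q_def)
  have qs: "- 2 * s \<le> real q" unfolding q_def by (rule order_trans[OF real_nat_ceiling_ge]) simp
  have "\<bar>sqrt_series i p w\<bar> \<le> C * w powr s" if w: "w \<ge> 1" for w
  proof -
    have "\<bar>sqrt_series i p w\<bar> \<le> C / sqrt w ^ q" unfolding sqrt_series_def using C(2)[of "sqrt w"] w by simp
    also have "\<dots> = C * w powr (- (real q / 2))" 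
    proof -
      have "w > 0" using w by simp
      then show ?thesis by (simp only: sqrt_power_powr powr_minus divide_inverse)
    qed
    also have "\<dots> \<le> C * w powr s"
    proof (intro mult_left_mono powr_mono)
      show "- (real q / 2) \<le> s" using qs by simp
    qed (use w C(1) in auto)
    finally show ?thesis .
  qed
  with C(1) show ?thesis by blast
qed

lemma sqrt_series_bound_left: "\<exists>C\<ge>0. \<forall>w>0. \<bar>sqrt_series i p w\<bar> \<le> C * w powr (- (real i / 2 + 1))"
proof -
  obtain C where C: "C \<ge> 0" "\<And>x. x > 0 \<Longrightarrow> \<bar>gsum i p x\<bar> \<le> C / x ^ (i + 2)" using gsum_bound[of i "i + 2" p] by auto
  have "\<bar>sqrt_series i p w\<bar> \<le> C * w powr (- (real i / 2 + 1))" if w: "w > 0" for w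
  proof -
    have "\<bar>sqrt_series i p w\<bar> \<le> C / sqrt w ^ (i + 2)" unfolding sqrt_series_def using C(2)[of "sqrt w"] w by simp
    also have "\<dots> = C * w powr (- (real (i + 2) / 2))" using w by (simp only: sqrt_power_powr powr_minus divide_inverse)
    also have "- (real (i + 2) / 2) = - (real i / 2 + 1)" by (simp add: field_simps)
    finally show ?thesis .
  qed
  with C(1) show ?thesis by blast
qed

lemma rmellin_sqrt_series: "rmellin (sqrt_series i p) holomorphic_on UNIV" "summable (\<lambda>j. mellin_piece (sqrt_series i p) (real j + 1) z)"
proof -
  show "rmellin (sqrt_series i p) holomorphic_on UNIV"
  proof (rule holomorphic_on_all_halfplanes)
    fix K
    obtain C where "C \<ge> 0" "\<And>w. w \<ge> 1 \<Longrightarrow> \<bar>sqrt_series i p w\<bar> \<le> C * w powr (- K)" using sqrt_series_bound_right by blast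
    from rmellin_holomorphic(1)[OF continuous_sqrt_series this] show "rmellin (sqrt_series i p) holomorphic_on {z. Re z < K}" by simp
  qed
  obtain C where "C \<ge> 0" "\<And>w. w \<ge> 1 \<Longrightarrow> \<bar>sqrt_series i p w\<bar> \<le> C * w powr (- Re z - 1)" using sqrt_series_bound_right by blast
  from rmellin_holomorphic(2)[OF continuous_sqrt_series this] show "summable (\<lambda>j. mellin_piece (sqrt_series i p) (real j + 1) z)" by simp
qed

lemma lmellin_sqrt_series_summable:
  assumes "Re z > real i / 2 + 1"
  shows "summable (\<lambda>j. mellin_piece (sqrt_series i p) (- real j) z)"
proof -
  obtain C where "C \<ge> 0" "\<And>w. w > 0 \<Longrightarrow> \<bar>sqrt_series i p w\<bar> \<le> C * w powr (- (real i / 2 + 1))" using sqrt_series_bound_left by blast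
  then show ?thesis using assms by (intro lmellin_holomorphic(2)[OF continuous_sqrt_series]) auto
qed

lemma sqrt_series_mellin:
  assumes z: "z > real i / 2 + 1" and c: "c \<ge> 0"
  shows "rmellin (sqrt_series i [:c:]) (of_real z) + lmellin (sqrt_series i [:c:]) (of_real z) =
    of_real (Gamma z * (c * (\<Sum>j. real (Suc j) powr (real i - 2 * z))) / ln 4)"
proof -
  have e: "c * real (Suc j) ^ i * ((real (Suc j))\<^sup>2) powr (- z) = c * real (Suc j) powr (real i - 2 * z)" for j
  proof -
    have "((real (Suc j))\<^sup>2) powr (- z) = real (Suc j) powr (2 * (- z))"
    proof -
      have "(real (Suc j))\<^sup>2 = real (Suc j) powr 2" by (simp add: powr_numeral del: of_nat_Suc)
      then show ?thesis by (simp only: powr_powr)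
    qed
    moreover have "real (Suc j) ^ i = real (Suc j) powr real i" by (simp add: powr_realpow del: of_nat_Suc)
    ultimately show ?thesis by (simp add: powr_add[symmetric] mult.assoc del: of_nat_Suc)
  qed
  have s: "summable (\<lambda>j. real (Suc j) powr (real i - 2 * z))"
  proof (subst summable_Suc_iff)
    have "real i - 2 * z < - 1" using z by simp
    then show "summable (\<lambda>j. real j powr (real i - 2 * z))" by (simp add: summable_real_powr_iff)
  qed
  have z0: "z > 0" using z by (rule order_le_less_trans[rotated]) simp
  have "rmellin (sqrt_series i [:c:]) (of_real z) + lmellin (sqrt_series i [:c:]) (of_real z) =
    of_real (Gamma z * (\<Sum>j. c * real (Suc j) ^ i * ((real (Suc j))\<^sup>2) powr (- z)) / ln 4)"
  proof (rule mellin_exp_series[OF continuous_sqrt_series z0])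
    fix w :: real assume w: "w > 0"
    have "(\<lambda>j. real (Suc j) ^ i * poly_gauss [:c:] (real (Suc j) * sqrt w)) sums sqrt_series i [:c:] w"
      unfolding sqrt_series_def gsum_def by (rule summable_sums[OF gsum_summable]) (use w in simp)
    moreover have "real (Suc j) ^ i * poly_gauss [:c:] (real (Suc j) * sqrt w) = c * real (Suc j) ^ i * exp (- ((real (Suc j))\<^sup>2 * w))" for j
      using w by (simp add: poly_gauss_def power_mult_distrib del: of_nat_Suc)
    ultimately show "(\<lambda>j. c * real (Suc j) ^ i * exp (- ((real (Suc j))\<^sup>2 * w))) sums sqrt_series i [:c:] w" by (simp only:)
  next
    show "summable (\<lambda>j. c * real (Suc j) ^ i * ((real (Suc j))\<^sup>2) powr (- z))"
      unfolding e by (rule summable_mult[OF s])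
    show "summable (\<lambda>j. mellin_piece (sqrt_series i [:c:]) (real j + 1) (of_real z))" by (rule rmellin_sqrt_series)
    show "summable (\<lambda>j. mellin_piece (sqrt_series i [:c:]) (- real j) (of_real z))" by (rule lmellin_sqrt_series_summable) (use z in simp)
  qed (use c in auto)
  also have "(\<Sum>j. c * real (Suc j) ^ i * ((real (Suc j))\<^sup>2) powr (- z)) = c * (\<Sum>j. real (Suc j) powr (real i - 2 * z))"
    unfolding e by (rule suminf_mult[OF s])
  finally show ?thesis .
qed

definition level_series :: "real \<Rightarrow> real" where "level_series = sqrt_series 1 [:-2, 0, 4:]"
text \<open>\<open>level_fun\<close> prepared for either end. Without its limit 1/6 at 0 it is
  O(sqrt w), so \<open>lmellin level_left\<close> exists for Re z > - 1/2;
  \<open>level_right\<close> is O(1 / w), so \<open>rmellin level_right\<close> exists for Re z < 1.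
  Both ranges contain the imaginary axis.\<close>

definition level_left :: "real \<Rightarrow> real" where "level_left w = level_fun (sqrt w) - 1 / 6"
definition level_right :: "real \<Rightarrow> real" where "level_right w = level_fun (sqrt w)"

lemma level_series_level_right: "w > 0 \<Longrightarrow> level_series w = level_right w + 1 / w"
  by (simp add: level_series_def sqrt_series_def level_right_def level_fun_def)

lemma continuous_level_right: "continuous_on {0<..} level_right"
proof -
  have "isCont level_fun x" if "x > 0" for x using level_fun_deriv[OF that] by (rule DERIV_isCont)
  hence "continuous_on {0<..} level_fun" by (intro continuous_at_imp_continuous_on) auto
  then show ?thesis unfolding level_right_def[abs_def]
    by (rule continuous_on_compose2) (auto intro!: continuous_intros)
qed

lemma continuous_level_left: "continuous_on {0<..} level_left"
  using continuous_level_right unfolding level_right_def[abs_def] level_left_def[abs_def] by (intro continuous_intros)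

lemma level_left_bound: "\<exists>C\<ge>0. \<forall>w>0. w \<le> 1 \<longrightarrow> \<bar>level_left w\<bar> \<le> C * w powr (1 / 2)"
proof -
  obtain C where C: "C \<ge> 0" "\<And>x. x > 0 \<Longrightarrow> x \<le> 1 \<Longrightarrow> \<bar>level_fun x - 1 / 6\<bar> \<le> C * x" using level_fun_near_0 by blast
  have "\<bar>level_left w\<bar> \<le> C * w powr (1 / 2)" if "w > 0" "w \<le> 1" for w
    using C(2)[of "sqrt w"] that by (simp add: level_left_def powr_half_sqrt)
  with C(1) show ?thesis by blast
qed

lemma lmellin_level_left: "lmellin level_left holomorphic_on {z. Re z > - 1 / 2}"
  "Re z > - 1 / 2 \<Longrightarrow> summable (\<lambda>j. mellin_piece level_left (- real j) z)"
proof -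
  obtain C where C: "C \<ge> 0" "\<And>w. w > 0 \<Longrightarrow> w \<le> 1 \<Longrightarrow> \<bar>level_left w\<bar> \<le> C * w powr (1 / 2)" using level_left_bound by blast
  show "lmellin level_left holomorphic_on {z. Re z > - 1 / 2}" using lmellin_holomorphic(1)[OF continuous_level_left C] by simp
  show "Re z > - 1 / 2 \<Longrightarrow> summable (\<lambda>j. mellin_piece level_left (- real j) z)" using lmellin_holomorphic(2)[OF continuous_level_left C] by simp
qed

lemma level_right_bound: "\<exists>C\<ge>0. \<forall>w>0. \<bar>level_right w\<bar> \<le> C * w powr (- 1)"
proof -
  obtain C where C: "C \<ge> 0" "\<And>x. x > 0 \<Longrightarrow> \<bar>level_fun x\<bar> \<le> C / x ^ 2" using level_fun_bound by blast
  have "\<bar>level_right w\<bar> \<le> C * w powr (- 1)" if "w > 0" for w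
    using C(2)[of "sqrt w"] that by (simp add: level_right_def powr_minus divide_inverse)
  with C(1) show ?thesis by blast
qed

lemma rmellin_linear:
  assumes f: "continuous_on {0<..} f" and g: "continuous_on {0<..} g"
    and sf: "summable (\<lambda>j. mellin_piece f (real j + 1) z)" and sg: "summable (\<lambda>j. mellin_piece g (real j + 1) z)"
    and h: "\<And>w. w > 0 \<Longrightarrow> h w = a * f w + b * g w"
  shows "rmellin h z = of_real a * rmellin f z + of_real b * rmellin g z"
proof -
  have p: "mellin_piece h r z = of_real a * mellin_piece f r z + of_real b * mellin_piece g r z" for r
    by (rule mellin_piece_linear[OF f g]) (rule h)
  have "(\<lambda>j. mellin_piece h (real j + 1) z) sums (of_real a * rmellin f z + of_real b * rmellin g z)"
    unfolding p rmellin_def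
    by (intro sums_add sums_mult summable_sums sf sg)
  then show ?thesis by (simp add: rmellin_def sums_unique[symmetric])
qed

text \<open>With \<open>mellin_ext\<close> as defined below, this says that in the strip - 1/2 < Re
  z < 1 the value \<open>mellin_ext z\<close> is ln 4 times
  \<open>rmellin level_right z + lmellin level_left z\<close>. The Fourier coefficients are taken
  inside that strip.\<close>

lemma rmellin_level_right:
  assumes z: "Re z < 1"
  shows "summable (\<lambda>j. mellin_piece level_right (real j + 1) z)" "rmellin level_right z = rmellin level_series z + 1 / ((z - 1) * of_real (ln 4))"
proof -
  obtain C where C: "C \<ge> 0" "\<And>w. w > 0 \<Longrightarrow> \<bar>level_right w\<bar> \<le> C * w powr (- 1)" using level_right_bound by blast
  show s: "summable (\<lambda>j. mellin_piece level_right (real j + 1) z)"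
    by (rule rmellin_holomorphic(2)[OF continuous_level_right C(1), where p = "- 1"]) (use C(2) z in auto)
  have sp: "summable (\<lambda>j. mellin_piece (\<lambda>w. w powr (- 1)) (real j + 1) z)"
    by (rule rmellin_holomorphic(2)[OF continuous_powr_pos, where C = 1 and p = "- 1"]) (use z in auto)
  have "rmellin level_series z = of_real 1 * rmellin level_right z + of_real 1 * rmellin (\<lambda>w. w powr (- 1)) z"
    by (rule rmellin_linear[OF continuous_level_right continuous_powr_pos s sp])
      (simp add: level_series_level_right powr_minus divide_inverse)
  moreover have "rmellin (\<lambda>w. w powr (- 1)) z = - 1 / ((of_real (- 1) + z) * of_real (ln 4))"
    by (rule rmellin_powr) (use z in simp)
  ultimately show "rmellin level_right z = rmellin level_series z + 1 / ((z - 1) * of_real (ln 4))"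
    by (simp add: add.commute)
qed

text \<open>Continues the Mellin transform of \<open>level_series\<close>, up to its polar term \<open>1 / (6 z)\<close> at \<open>0\<close>, from \<open>Re z > 1\<close> to
  \<open>Re z > - 1 / 2\<close>: near \<open>0\<close>, \<open>level_series w\<close> is \<open>1 / w + 1 / 6 + level_left w\<close>.\<close>

definition mellin_ext :: "complex \<Rightarrow> complex" where
  "mellin_ext z = of_real (ln 4) * (rmellin level_series z + lmellin level_left z) + 1 / (z - 1)"

text \<open>The terms k (4 k^2 w - 2) exp (- k^2 w) change sign, so they are split into two series
  with positive coefficients. The factor w in the first shifts its argument to z + 1, and both lead
  to zeta (2 z - 1), with the factors 4 Gamma (z + 1) and 2 Gamma z. The powers 1 / w and 1 split
  off near 0 yield 1 / (z - 1) and 1 / (6 z).\<close>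

lemma level_series_mellin_real:
  assumes z: "z > (2::real)"
  shows "of_real z * mellin_ext (of_real z) + 1 / 6 = 2 * (2 * of_real z - 1) * Gamma (of_real z + 1) * zeta (2 * of_real z - 1)"
proof -
  define Z where "Z = (\<Sum>j. real (Suc j) powr (1 - 2 * z))"
  let ?z = "complex_of_real z"
  let ?A = "sqrt_series 3 [:4:]" and ?B = "sqrt_series 1 [:2:]"
  have A: "rmellin ?A (?z + 1) + lmellin ?A (?z + 1) = of_real (Gamma (z + 1) * (4 * Z) / ln 4)"
    using sqrt_series_mellin[of 3 "z + 1" 4] z by (simp add: Z_def del: of_nat_Suc)
  have B: "rmellin ?B ?z + lmellin ?B ?z = of_real (Gamma z * (2 * Z) / ln 4)"
    using sqrt_series_mellin[of 1 z 2] z by (simp add: Z_def)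
  define wA where "wA = (\<lambda>w. w * ?A w)"
  have cwA: "continuous_on {0<..} wA" unfolding wA_def by (intro continuous_intros continuous_sqrt_series)
  have pwA: "mellin_piece wA r z = mellin_piece ?A r (z + 1)" for r z by (rule mellin_piece_shift) (simp add: wA_def)
  have rel: "level_series w = 1 * wA w + (- 1) * ?B w" if w: "w > 0" for w
  proof -
    have s: "(\<lambda>j. real (Suc j) ^ i * poly_gauss p (real (Suc j) * sqrt w)) sums sqrt_series i p w" for i p
      unfolding sqrt_series_def gsum_def by (rule summable_sums[OF gsum_summable]) (use w in simp)
    have "(\<lambda>j. w * (real (Suc j) ^ 3 * poly_gauss [:4:] (real (Suc j) * sqrt w)) - real (Suc j) ^ 1 * poly_gauss [:2:] (real (Suc j) * sqrt w))
        sums (wA w - ?B w)" unfolding wA_def by (intro sums_diff sums_mult s)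
    moreover have "w * (real (Suc j) ^ 3 * poly_gauss [:4:] (real (Suc j) * sqrt w)) - real (Suc j) ^ 1 * poly_gauss [:2:] (real (Suc j) * sqrt w)
       = real (Suc j) ^ 1 * poly_gauss [:-2, 0, 4:] (real (Suc j) * sqrt w)" for j
    proof -
      define k where "k = real (Suc j)"
      have "(k * sqrt w) * (k * sqrt w) = k * k * w" using w by (simp add: mult.left_commute mult.commute)
      hence "poly [:-2, 0, 4:] (k * sqrt w) = 4 * (k * k * w) - 2" by (simp add: mult.assoc)
      then show ?thesis unfolding k_def[symmetric] poly_gauss_def by (simp add: power3_eq_cube algebra_simps abs_of_pos[OF w])
    qed
    ultimately have "(\<lambda>j. real (Suc j) ^ 1 * poly_gauss [:-2, 0, 4:] (real (Suc j) * sqrt w)) sums (wA w - ?B w)" by (simp only:)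
    from sums_unique2[OF this s] show ?thesis by (simp add: level_series_def)
  qed
  have swA: "summable (\<lambda>j. mellin_piece wA (real j + 1) ?z)" unfolding pwA by (rule rmellin_sqrt_series)
  have lwA: "summable (\<lambda>j. mellin_piece wA (- real j) ?z)" unfolding pwA by (rule lmellin_sqrt_series_summable) (use z in simp)
  have lB: "summable (\<lambda>j. mellin_piece ?B (- real j) ?z)" by (rule lmellin_sqrt_series_summable) (use z in simp)
  have r: "rmellin level_series ?z = rmellin ?A (?z + 1) - rmellin ?B ?z"
    using rmellin_linear[OF cwA continuous_sqrt_series swA rmellin_sqrt_series(2) rel] by (simp add: rmellin_def pwA)
  have l: "lmellin level_series ?z = lmellin ?A (?z + 1) - lmellin ?B ?z"
    using lmellin_linear[OF cwA continuous_sqrt_series lwA lB rel] by (simp add: lmellin_def pwA)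
  have tot: "rmellin level_series ?z + lmellin level_series ?z = of_real (Gamma (z + 1) * (4 * Z) / ln 4 - Gamma z * (2 * Z) / ln 4)"
    unfolding r l of_real_diff A[symmetric] B[symmetric] by simp
  have sL: "summable (\<lambda>j. mellin_piece level_left (- real j) ?z)" by (rule lmellin_level_left) (use z in simp)
  have s1: "summable (\<lambda>j. mellin_piece (\<lambda>w. w powr (- 1)) (- real j) ?z)"
    by (rule lmellin_holomorphic(2)[OF continuous_powr_pos, where C = 1 and p = "- 1"]) (use z in auto)
  have s0: "summable (\<lambda>j. mellin_piece (\<lambda>w. w powr 0) (- real j) ?z)"
    by (rule lmellin_holomorphic(2)[OF continuous_powr_pos, where C = 1 and p = 0]) (use z in auto)
  have c1: "continuous_on {0<..} (\<lambda>w. level_left w + w powr (- 1))" by (intro continuous_intros continuous_level_left) auto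
  have l1: "lmellin (\<lambda>w. level_left w + w powr (- 1)) ?z = lmellin level_left ?z + 1 / ((?z - 1) * of_real (ln 4))"
    using lmellin_linear[OF continuous_level_left continuous_powr_pos sL s1, of "\<lambda>w. level_left w + w powr (- 1)" 1 1]
      lmellin_powr[of "- 1" ?z] z by (simp add: add.commute)
  have sL1: "summable (\<lambda>j. mellin_piece (\<lambda>w. level_left w + w powr (- 1)) (- real j) ?z)"
  proof -
    have "mellin_piece (\<lambda>w. level_left w + w powr (- 1)) r ?z = of_real 1 * mellin_piece level_left r ?z + of_real 1 * mellin_piece (\<lambda>w. w powr (- 1)) r ?z" for r
      by (rule mellin_piece_linear[OF continuous_level_left continuous_powr_pos]) simp
    then show ?thesis using summable_add[OF sL s1] by simp
  qed
  have l2: "lmellin level_series ?z = of_real 1 * lmellin (\<lambda>w. level_left w + w powr (- 1)) ?z + of_real (1 / 6) * lmellin (\<lambda>w. w powr 0) ?z"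
  proof (rule lmellin_linear[OF c1 continuous_powr_pos sL1 s0])
    fix w :: real assume w: "w > 0"
    have "w powr (- 1) = 1 / w" "w powr 0 = 1" using w by (simp_all add: powr_minus_divide)
    then show "level_series w = 1 * (level_left w + w powr (- 1)) + 1 / 6 * w powr 0"
      using w by (simp add: level_series_level_right level_right_def level_left_def)
  qed
  have l3: "lmellin (\<lambda>w. w powr 0) ?z = 1 / (?z * of_real (ln 4))"
    using lmellin_powr[of 0 ?z] z by simp
  have l4: "complex_of_real (ln 4) \<noteq> 0" using ln_4_pos by (simp del: ln_4_pos)
  have z1: "?z - 1 \<noteq> 0" "?z \<noteq> 0" using z by (auto simp: complex_eq_iff)
  define R where "R = complex_of_real (Gamma (z + 1) * (4 * Z) - Gamma z * (2 * Z))"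
  have q1: "of_real (ln 4) * (rmellin level_series ?z + lmellin level_series ?z) = mellin_ext ?z + 1 / (6 * ?z)"
    unfolding l2 l3 l1 mellin_ext_def using l4 z1 by (simp add: field_simps)
  have q2: "of_real (ln 4) * (rmellin level_series ?z + lmellin level_series ?z) = R"
    unfolding tot of_real_mult[symmetric] R_def by (simp add: right_diff_distrib)
  have q3: "mellin_ext ?z + 1 / (6 * ?z) = R" by (rule trans[OF q1[symmetric] q2])
  have "?z * mellin_ext ?z + 1 / 6 = ?z * (mellin_ext ?z + 1 / (6 * ?z))" using z1 by (simp add: distrib_left)
  also have "\<dots> = ?z * of_real (Gamma (z + 1) * (4 * Z) - Gamma z * (2 * Z))" unfolding q3 R_def ..
  also have "\<dots> = of_real (2 * (2 * z - 1) * Gamma (z + 1) * Z)"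
  proof -
    have "Gamma (z + 1) = z * Gamma z" using z by (intro Gamma_plus1) (auto elim!: nonpos_Ints_cases)
    then show ?thesis unfolding of_real_mult[symmetric] by (simp add: algebra_simps)
  qed
  also have "\<dots> = 2 * (2 * ?z - 1) * Gamma (?z + 1) * of_real Z"
    by (simp add: Gamma_complex_of_real[symmetric])
  also have "of_real Z = zeta (2 * ?z - 1)"
  proof -
    have s: "summable (\<lambda>j. real (Suc j) powr (1 - 2 * z))"
      using z by (subst summable_Suc_iff) (simp add: summable_real_powr_iff)
    have "complex_of_real (real (Suc n) powr (1 - 2 * z)) = of_nat (Suc n) powr (- (2 * ?z - 1))" for n
      using powr_of_real[of "real (Suc n)" "1 - 2 * z"] by (simp del: of_nat_Suc)
    moreover have "(\<lambda>n. complex_of_real (real (Suc n) powr (1 - 2 * z))) sums of_real Z"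
      unfolding Z_def by (intro sums_of_real summable_sums s)
    ultimately have "(\<lambda>n. of_nat (Suc n) powr (- (2 * ?z - 1))) sums complex_of_real Z" by (simp only:)
    moreover have "(\<lambda>n. of_nat (Suc n) powr (- (2 * ?z - 1))) sums zeta (2 * ?z - 1)"
      by (rule zeta_sums) (use z in simp)
    ultimately show ?thesis by (rule sums_unique2)
  qed
  finally show ?thesis .
qed


lemma mellin_ext_holomorphic: "mellin_ext holomorphic_on {z. Re z > - 1 / 2} - {1}"
  unfolding mellin_ext_def level_series_def
  by (intro holomorphic_intros holomorphic_on_subset[OF rmellin_sqrt_series(1)] holomorphic_on_subset[OF lmellin_level_left(1)]) auto

text \<open>Multiplication by z has removed the pole at 0 on both sides, so the identity theorem
  carries the real identity to the punctured half-plane and to z = 0 in particular. The excluded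
  point 1 is the pole of zeta (2 z - 1).\<close>

lemma mellin_ext_identity:
  assumes z: "Re z > - 1 / 2" "z \<noteq> 1"
  shows "z * mellin_ext z + 1 / 6 = 2 * (2 * z - 1) * Gamma (z + 1) * zeta (2 * z - 1)"
proof -
  let ?D = "{z. Re z > - 1 / 2} - {1::complex}"
  let ?f = "\<lambda>z. z * mellin_ext z + 1 / 6 - 2 * (2 * z - 1) * Gamma (z + 1) * zeta (2 * z - 1)"
  have np: "z + 1 \<notin> \<int>\<^sub>\<le>\<^sub>0" if "Re z > - 1 / 2" for z :: complex
  proof
    assume "z + 1 \<in> \<int>\<^sub>\<le>\<^sub>0"
    then obtain n :: int where "z + 1 = of_int n" "n \<le> 0" by (elim nonpos_Ints_cases)
    hence "Re (z + 1) \<le> 0" by simp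
    then show False using that by simp
  qed
  have zh: "(\<lambda>z. zeta (2 * z - 1)) holomorphic_on ?D"
  proof -
    have "(zeta \<circ> (\<lambda>z. 2 * z - 1)) holomorphic_on ?D"
      by (rule holomorphic_on_compose) (auto intro!: holomorphic_intros holomorphic_on_subset[OF zeta_holomorphic])
    then show ?thesis by (simp add: comp_def)
  qed
  have "?f z = 0"
  proof (rule analytic_continuation[of ?f ?D "of_real ` {2<..}" 3 z])
    show "?f holomorphic_on ?D"
      by (intro holomorphic_intros mellin_ext_holomorphic zh) (use np in auto)
    have op: "open {z::complex. Re z > - 1 / 2}" by (rule open_halfspace_Re_gt)
    then show "open ?D" by (rule open_delete)
    show "connected ?D"
      by (rule connected_open_delete[OF op]) (auto intro: convex_connected convex_halfspace_Re_gt)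
    have "complex_of_real 3 islimpt of_real ` {2<..}"
    proof (rule islimpt_isCont_image)
      show "eventually (\<lambda>y. complex_of_real y \<noteq> of_real 3) (at 3)"
        unfolding of_real_eq_iff by (rule eventually_neq_at_within)
    qed (auto intro!: open_imp_islimpt)
    then show "(3::complex) islimpt of_real ` {2<..}" by simp
    show "?f x = 0" if "x \<in> of_real ` {2<..}" for x
      using that level_series_mellin_real by auto
  qed (use z in \<open>auto simp: complex_eq_iff\<close>)
  then show ?thesis by simp
qed

text \<open>At z = 0 the identity leaves only 1/6, the limit of \<open>level_fun\<close> at
  0.\<close>

lemma zeta_minus_1: "zeta (- 1) = - 1 / 12"
proof -
  have "1 / 6 = 2 * (- 1) * Gamma (1::complex) * zeta (- 1)" using mellin_ext_identity[of 0] by simp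
  moreover have "zeta (- 1) = - (1 / 2) * (2 * (- 1) * Gamma 1 * zeta (- 1))" by simp
  ultimately have "zeta (- 1) = - (1 / 2) * (1 / 6)" by metis
  then show ?thesis by simp
qed

text \<open>The product rule at 0 isolates \<open>mellin_ext 0\<close> on the left. On the right the
  derivative of Gamma at 1 brings in minus the Euler-Mascheroni constant, and the inner derivative 2
  doubles \<open>deriv zeta (- 1)\<close>.\<close>

lemma mellin_ext_0: "mellin_ext 0 = - 1 / 3 - of_real euler_mascheroni / 6 - 4 * deriv zeta (- 1)"
proof -
  have op: "open ({z. Re z > - 1 / 2} - {1::complex})" by (intro open_delete open_halfspace_Re_gt)
  obtain A' where A': "(mellin_ext has_field_derivative A') (at 0)"
    using holomorphic_derivI[OF mellin_ext_holomorphic op, of 0] by auto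
  have L: "((\<lambda>z. z * mellin_ext z + 1 / 6) has_field_derivative mellin_ext 0) (at 0)"
    by (rule derivative_eq_intros A' refl)+ simp
  have zd: "(zeta has_field_derivative deriv zeta (- 1)) (at (- 1))"
    by (rule holomorphic_derivI[OF zeta_holomorphic]) auto
  have "((\<lambda>z. zeta (2 * z - 1)) has_field_derivative deriv zeta (- 1) * 2) (at 0)"
    by (rule DERIV_chain2[of zeta]) (use zd in \<open>auto intro!: derivative_eq_intros\<close>)
  moreover have "((\<lambda>z. Gamma (z + 1)) has_field_derivative - of_real euler_mascheroni * 1) (at (0::complex))"
  proof (rule DERIV_chain2[of Gamma])
    show "(Gamma has_field_derivative - of_real euler_mascheroni) (at (0 + 1 :: complex))"
      using has_field_derivative_Gamma[of "1::complex" UNIV] by simp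
  qed (auto intro!: derivative_eq_intros)
  ultimately have R: "((\<lambda>z. 2 * (2 * z - 1) * Gamma (z + 1) * zeta (2 * z - 1)) has_field_derivative
     (4 * zeta (- 1) + 2 * of_real euler_mascheroni * zeta (- 1) - 4 * deriv zeta (- 1))) (at 0)"
    by (auto intro!: derivative_eq_intros simp: algebra_simps)
  have "eventually (\<lambda>z. z \<in> {z. Re z > - 1 / 2} - {1::complex}) (nhds 0)"
    using op by (rule eventually_nhds_in_open) simp
  hence ev: "eventually (\<lambda>z. z * mellin_ext z + 1 / 6 = 2 * (2 * z - 1) * Gamma (z + 1) * zeta (2 * z - 1)) (nhds 0)"
    by eventually_elim (use mellin_ext_identity in auto)
  have "((\<lambda>z. z * mellin_ext z + 1 / 6) has_field_derivative
     (4 * zeta (- 1) + 2 * of_real euler_mascheroni * zeta (- 1) - 4 * deriv zeta (- 1))) (at 0)"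
    using DERIV_cong_ev[OF refl ev refl] R by blast
  from DERIV_unique[OF L this] show ?thesis unfolding zeta_minus_1 by (simp add: field_simps)
qed

lemma mellin_ext_Gamma:
  assumes z: "Re z > - 1 / 2" "z \<noteq> 1" "z \<noteq> 0"
  shows "mellin_ext z + 1 / (6 * z) = 2 * (2 * z - 1) * Gamma z * zeta (2 * z - 1)"
proof -
  have "z \<notin> \<int>\<^sub>\<le>\<^sub>0"
  proof
    assume "z \<in> \<int>\<^sub>\<le>\<^sub>0"
    then obtain n :: int where n: "z = of_int n" "n \<le> 0" by (elim nonpos_Ints_cases)
    hence "n \<noteq> 0" using z by auto
    hence "n \<le> - 1" using n by simp
    hence "Re z \<le> - 1" using n by simp
    then show False using z by simp
  qed
  hence "Gamma (z + 1) = z * Gamma z" by (rule Gamma_plus1)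
  hence "z * (mellin_ext z + 1 / (6 * z)) = z * (2 * (2 * z - 1) * Gamma z * zeta (2 * z - 1))"
    using mellin_ext_identity[OF z(1,2)] z(3) by (simp add: distrib_left mult_ac)
  then show ?thesis using z(3) by simp
qed

section \<open>The periodic fluctuation\<close>

lemma series_C1:
  fixes F F' :: "nat \<Rightarrow> real \<Rightarrow> real"
  assumes d: "\<And>j x. (F j has_real_derivative F' j x) (at x)"
    and c: "\<And>j. continuous_on UNIV (F' j)"
    and b: "\<And>K x j. \<bar>x\<bar> \<le> K \<Longrightarrow> \<bar>F' j x\<bar> \<le> M K j"
    and M: "\<And>K. summable (M K)" and s0: "summable (\<lambda>j. F j 0)"
  shows "summable (\<lambda>j. F j x)" "((\<lambda>x. \<Sum>j. F j x) has_real_derivative (\<Sum>j. F' j x)) (at x)"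
    "continuous_on UNIV (\<lambda>x. \<Sum>j. F' j x)"
proof -
  have ul: "uniform_limit {- K..K} (\<lambda>n x. \<Sum>j<n. F' j x) (\<lambda>x. \<Sum>j. F' j x) sequentially" for K
    by (rule Weierstrass_m_test[OF _ M[of K]]) (use b in auto)
  have *: "summable (\<lambda>j. F j x) \<and> ((\<lambda>x. \<Sum>j. F j x) has_real_derivative (\<Sum>j. F' j x)) (at x)" for x
  proof -
    define K where "K = \<bar>x\<bar> + 1"
    have x: "x \<in> interior {- K..K}" by (auto simp: K_def)
    have D: "(F j has_field_derivative F' j x) (at x within {- K..K})" if "x \<in> {- K..K}" for j x
      using d by (rule has_field_derivative_at_within)
    have U: "uniformly_convergent_on {- K..K} (\<lambda>n x. \<Sum>j<n. F' j x)"
      using ul by (auto simp: uniformly_convergent_on_def)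
    have "convex {- K..K}" "0 \<in> {- K..K}" by (auto simp: K_def)
    from has_field_derivative_series'[OF this(1) D U this(2) s0 x] show ?thesis by blast
  qed
  from * show "summable (\<lambda>j. F j x)" "((\<lambda>x. \<Sum>j. F j x) has_real_derivative (\<Sum>j. F' j x)) (at x)" by auto
  have "isCont (\<lambda>x. \<Sum>j. F' j x) x" for x
  proof -
    define K where "K = \<bar>x\<bar> + 1"
    have "continuous_on {- K..K} (\<lambda>x. \<Sum>j. F' j x)"
      by (rule uniform_limit_theorem[OF _ ul])
        (auto intro!: always_eventually continuous_intros continuous_on_subset[OF c])
    moreover have "x \<in> interior {- K..K}" by (auto simp: K_def)
    ultimately show ?thesis by (rule continuous_on_interior)
  qed
  then show "continuous_on UNIV (\<lambda>x. \<Sum>j. F' j x)" by (simp add: continuous_on_eq_continuous_at)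
qed

definition exp2 :: "real \<Rightarrow> real" where "exp2 x = exp (ln 2 * x)"

lemma exp2_pos [simp]: "exp2 x > 0" and exp2_nonneg [simp]: "exp2 x \<ge> 0" and exp2_nz [simp]: "exp2 x \<noteq> 0" by (simp_all add: exp2_def)

lemma ln_4: "ln (4::real) = 2 * ln 2"
  using ln_realpow[of 2 2] by simp

lemma sqrt_exp4: "sqrt (exp4 x) = exp2 x"
proof -
  have "exp4 x = (exp2 x)\<^sup>2" by (simp add: exp4_def exp2_def ln_4 exp_of_nat_mult[symmetric] mult_ac flip: exp_double)
  then show ?thesis by simp
qed

lemma level_right_exp4: "level_right (exp4 x) = level_fun (exp2 x)" "level_left (exp4 x) = level_fun (exp2 x) - 1 / 6"
  by (simp_all add: level_right_def level_left_def sqrt_exp4)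

definition level_slope :: "real \<Rightarrow> real" where "level_slope x = level_fun' (exp2 x) * (exp2 x * ln 2)"

lemma level_fun_exp2_deriv: "((\<lambda>x. level_fun (exp2 x)) has_real_derivative level_slope x) (at x)"
proof -
  have "(exp2 has_real_derivative exp2 x * ln 2) (at x)" unfolding exp2_def[abs_def] by (auto intro!: derivative_eq_intros)
  from DERIV_chain2[OF level_fun_deriv this] show ?thesis by (simp add: level_slope_def)
qed

lemma level_fun_exp2_shift_deriv: "((\<lambda>x. level_fun (exp2 (s - x))) has_real_derivative - level_slope (s - x)) (at x)"
proof -
  have "((\<lambda>x. s - x) has_real_derivative - 1) (at x)" by (auto intro!: derivative_eq_intros)
  from DERIV_chain2[OF level_fun_exp2_deriv this] show ?thesis by simp
qed

lemma continuous_level_slope: "continuous_on UNIV level_slope"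
proof -
  have "isCont (gsum 2 [:0, 12, 0, -8:]) x" if "x > 0" for x using gsum_deriv[OF that] by (rule DERIV_isCont)
  hence c: "continuous_on {0<..} (gsum 2 [:0, 12, 0, -8:])" by (intro continuous_at_imp_continuous_on) auto
  have "continuous_on UNIV exp2" unfolding exp2_def[abs_def] by (intro continuous_intros)
  moreover from this have "continuous_on UNIV (\<lambda>x. gsum 2 [:0, 12, 0, -8:] (exp2 x))"
    by (rule continuous_on_compose2[OF c]) auto
  ultimately show ?thesis unfolding level_slope_def[abs_def] level_fun'_def by (intro continuous_intros) auto
qed

lemma exp2_add: "exp2 (x + y) = exp2 x * exp2 y" by (simp add: exp2_def exp_add ring_distribs)

lemma exp2_mono: "x \<le> y \<Longrightarrow> exp2 x \<le> exp2 y" by (simp add: exp2_def)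

lemma exp2_0 [simp]: "exp2 0 = 1" by (simp add: exp2_def)

lemma exp2_minus: "exp2 (- x) = 1 / exp2 x" by (simp add: exp2_def exp_minus inverse_eq_divide)

lemma exp2_nat: "exp2 (- real j) = (1 / 2) ^ j"
proof -
  have "exp2 (real j) = 2 ^ j" by (simp add: exp2_def mult.commute exp_of_nat_mult)
  then show ?thesis by (simp add: exp2_minus power_one_over)
qed

lemma div_cube_bound: "C \<ge> 0 \<Longrightarrow> (y::real) \<ge> 1 \<Longrightarrow> h \<le> C / y ^ 3 \<Longrightarrow> h * y \<le> C / y"
proof -
  assume a: "C \<ge> 0" "y \<ge> 1" "h \<le> C / y ^ 3"
  have "h * y \<le> C / y ^ 3 * y" using a by (intro mult_right_mono) auto
  also have "\<dots> = C / y ^ 2" using a by (simp add: field_simps eval_nat_numeral)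
  also have "\<dots> \<le> C / y ^ 1" using a by (intro divide_left_mono power_increasing) auto
  finally show ?thesis by simp
qed

text \<open>To the right the cubic decay of \<open>level_fun'\<close> outweighs the factor
  \<open>exp2 x\<close>; to the left \<open>level_fun'\<close> is bounded and \<open>exp2 x\<close>
  itself decays.\<close>

lemma level_slope_bound: "\<exists>C\<ge>0. \<forall>x. \<bar>level_slope x\<bar> \<le> C * exp2 (- \<bar>x\<bar>)"
proof -
  obtain C where C: "C \<ge> 0" "\<And>x. x > 0 \<Longrightarrow> \<bar>level_fun' x\<bar> \<le> C \<and> \<bar>level_fun' x\<bar> \<le> C / x ^ 3" using level_fun'_bound by blast
  have "\<bar>level_slope x\<bar> \<le> ln 2 * C * exp2 (- \<bar>x\<bar>)" for x
  proof -
    have "\<bar>level_fun' (exp2 x)\<bar> * exp2 x \<le> C * exp2 (- \<bar>x\<bar>)"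
    proof (cases "x \<ge> 0")
      case True
      hence "1 \<le> exp2 x" using exp2_mono[of 0 x] by simp
      from div_cube_bound[OF C(1) this, of "\<bar>level_fun' (exp2 x)\<bar>"] show ?thesis using C(2)[of "exp2 x"] True by (simp add: exp2_minus)
    next
      case False
      then show ?thesis using mult_right_mono[of "\<bar>level_fun' (exp2 x)\<bar>" C "exp2 x"] C(2)[of "exp2 x"] by simp
    qed
    hence "ln 2 * (\<bar>level_fun' (exp2 x)\<bar> * exp2 x) \<le> ln 2 * (C * exp2 (- \<bar>x\<bar>))" by (intro mult_left_mono) auto
    then show ?thesis by (simp add: level_slope_def abs_mult mult_ac)
  qed
  moreover have "ln 2 * C \<ge> 0" using C(1) by simp
  ultimately show ?thesis by blast
qed

text \<open>One majorant for the shifts s = j + 1 and s = - j: in both cases s - x has modulus at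
  least j - K.\<close>

lemma level_slope_shift_bound:
  "\<exists>M. (\<forall>K. summable (M K)) \<and> (\<forall>K x j s. \<bar>x\<bar> \<le> K \<longrightarrow> real j \<le> \<bar>s\<bar> \<longrightarrow> \<bar>level_slope (s - x)\<bar> \<le> M K j)"
proof -
  obtain C where C: "C \<ge> 0" "\<And>x. \<bar>level_slope x\<bar> \<le> C * exp2 (- \<bar>x\<bar>)" using level_slope_bound by blast
  have "\<bar>level_slope (s - x)\<bar> \<le> C * exp2 K * (1 / 2) ^ j" if "\<bar>x\<bar> \<le> K" "real j \<le> \<bar>s\<bar>" for x K s j
  proof -
    have "\<bar>level_slope (s - x)\<bar> \<le> C * exp2 (K + - real j)"
      by (rule order_trans[OF C(2)]) (intro mult_left_mono C(1) exp2_mono, use that in linarith)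
    then show ?thesis by (simp only: exp2_add exp2_nat mult.assoc)
  qed
  moreover have "summable (\<lambda>j. C * exp2 K * (1 / 2) ^ j)" for K by (intro summable_mult summable_geometric) simp
  ultimately show ?thesis by (intro exI[of _ "\<lambda>K j. C * exp2 K * (1 / 2) ^ j"]) blast
qed

lemma level_right_unit_bound:
  "\<exists>C\<ge>0. \<forall>j x. 0 \<le> x \<longrightarrow> x \<le> 1 \<longrightarrow> \<bar>level_right (exp4 (real j + 1 - x))\<bar> \<le> C * (1 / 2) ^ j"
proof -
  obtain C where C: "C \<ge> 0" "\<And>x. x > 0 \<Longrightarrow> \<bar>level_fun x\<bar> \<le> C \<and> \<bar>level_fun x\<bar> \<le> C / x ^ 2" using level_fun_bound by blast
  have "\<bar>level_right (exp4 (real j + 1 - x))\<bar> \<le> C * (1 / 2) ^ j" if x: "0 \<le> x" "x \<le> 1" for j x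
  proof -
    define y where "y = exp2 (real j + 1 - x)"
    have y: "y \<ge> exp2 (real j)" "y \<ge> 1" using exp2_mono[of "real j" "real j + 1 - x"] exp2_mono[of 0 "real j + 1 - x"] x by (auto simp: y_def)
    have "\<bar>level_right (exp4 (real j + 1 - x))\<bar> \<le> C / y ^ 2" using C(2)[of y] y by (simp add: level_right_exp4 y_def)
    also have "\<dots> \<le> C / y ^ 1" using y C(1) by (intro divide_left_mono power_increasing) auto
    also have "\<dots> \<le> C / exp2 (real j)" using y C(1) by (simp add: divide_left_mono)
    also have "\<dots> = C * (1 / 2) ^ j" by (simp add: exp2_nat[symmetric] exp2_minus)
    finally show ?thesis .
  qed
  with C(1) show ?thesis by blast
qed

lemma level_left_exp4_bound:
  "\<exists>C\<ge>0. \<forall>j x. 0 \<le> x \<longrightarrow> \<bar>level_left (exp4 (- real j - x))\<bar> \<le> C * exp2 (- x) * (1 / 2) ^ j"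
proof -
  obtain C where C: "C \<ge> 0" "\<And>x. x > 0 \<Longrightarrow> x \<le> 1 \<Longrightarrow> \<bar>level_fun x - 1 / 6\<bar> \<le> C * x" using level_fun_near_0 by blast
  have "\<bar>level_left (exp4 (- real j - x))\<bar> \<le> C * exp2 (- x) * (1 / 2) ^ j" if x: "0 \<le> x" for j x
  proof -
    have "- real j - x = - x + - real j" by simp
    hence e: "exp2 (- real j - x) = exp2 (- x) * (1 / 2) ^ j" by (simp only: exp2_add exp2_nat)
    have "exp2 (- real j - x) \<le> 1" using exp2_mono[of "- real j - x" 0] x by simp
    with C(2)[OF exp2_pos this] show ?thesis by (simp add: level_right_exp4 e mult.assoc)
  qed
  with C(1) show ?thesis by blast
qed

text \<open>The levels are extended to all integers. Those far to the left need \<open>1 / 6\<close> to be subtracted for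
  convergence, which the linear term compensates when the argument is shifted by \<open>1\<close>.\<close>

definition right_part :: "real \<Rightarrow> real" where "right_part x = (\<Sum>j. level_right (exp4 (real j + 1 - x)))"
definition left_part :: "real \<Rightarrow> real" where "left_part x = (\<Sum>j. level_left (exp4 (- real j - x)))"
definition periodic_part :: "real \<Rightarrow> real" where "periodic_part x = right_part x + left_part x - x / 6"
definition periodic_part' :: "real \<Rightarrow> real" where
  "periodic_part' x = (\<Sum>j. - level_slope (real j + 1 - x)) + (\<Sum>j. - level_slope (- real j - x)) - 1 / 6"

lemma summable_geometric_half: "summable (\<lambda>j. C * (1 / 2 :: real) ^ j)"
  by (intro summable_mult summable_geometric) simp

lemma right_part_series:
  shows right_part_sums: "(\<lambda>j. level_right (exp4 (real j + 1 - x))) sums right_part x"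
    and right_part_deriv: "(right_part has_real_derivative (\<Sum>j. - level_slope (real j + 1 - x))) (at x)"
    and right_part_cont: "continuous_on UNIV (\<lambda>x. \<Sum>j. - level_slope (real j + 1 - x))"
proof -
  obtain M where M: "\<And>K. summable (M K)" "\<And>K x j s. \<bar>x\<bar> \<le> K \<Longrightarrow> real j \<le> \<bar>s\<bar> \<Longrightarrow> \<bar>level_slope (s - x)\<bar> \<le> M K j"
    using level_slope_shift_bound by blast
  obtain C where C: "\<And>j x. 0 \<le> x \<Longrightarrow> x \<le> 1 \<Longrightarrow> \<bar>level_right (exp4 (real j + 1 - x))\<bar> \<le> C * (1 / 2) ^ j" using level_right_unit_bound by blast
  have s0: "summable (\<lambda>j. level_right (exp4 (real j + 1 - 0)))"
    by (rule summable_comparison_test'[OF summable_geometric_half[of C], of 0]) (use C[of 0] in simp)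
  have d: "((\<lambda>x. level_right (exp4 (real j + 1 - x))) has_real_derivative - level_slope (real j + 1 - x)) (at x)" for j x
    unfolding level_right_exp4 by (rule level_fun_exp2_shift_deriv)
  have c: "continuous_on UNIV (\<lambda>x. - level_slope (real j + 1 - x))" for j
    by (intro continuous_intros continuous_on_compose2[OF continuous_level_slope]) auto
  have b: "\<bar>- level_slope (real j + 1 - x)\<bar> \<le> M K j" if "\<bar>x\<bar> \<le> K" for K x j
    using M(2)[OF that, of j "real j + 1"] by simp
  note S = series_C1[of "\<lambda>j x. level_right (exp4 (real j + 1 - x))" "\<lambda>j x. - level_slope (real j + 1 - x)", OF d c b M(1) s0]
  show "(\<lambda>j. level_right (exp4 (real j + 1 - x))) sums right_part x" unfolding right_part_def by (rule summable_sums[OF S(1)])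
  show "(right_part has_real_derivative (\<Sum>j. - level_slope (real j + 1 - x))) (at x)" unfolding right_part_def[abs_def] by (rule S(2))
  show "continuous_on UNIV (\<lambda>x. \<Sum>j. - level_slope (real j + 1 - x))" by (rule S(3))
qed

lemma left_part_series:
  shows left_part_sums: "(\<lambda>j. level_left (exp4 (- real j - x))) sums left_part x"
    and left_part_deriv: "(left_part has_real_derivative (\<Sum>j. - level_slope (- real j - x))) (at x)"
    and left_part_cont: "continuous_on UNIV (\<lambda>x. \<Sum>j. - level_slope (- real j - x))"
proof -
  obtain M where M: "\<And>K. summable (M K)" "\<And>K x j s. \<bar>x\<bar> \<le> K \<Longrightarrow> real j \<le> \<bar>s\<bar> \<Longrightarrow> \<bar>level_slope (s - x)\<bar> \<le> M K j"
    using level_slope_shift_bound by blast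
  obtain C where C: "\<And>j x. 0 \<le> x \<Longrightarrow> \<bar>level_left (exp4 (- real j - x))\<bar> \<le> C * exp2 (- x) * (1 / 2) ^ j" using level_left_exp4_bound by blast
  have s0: "summable (\<lambda>j. level_left (exp4 (- real j - 0)))"
    by (rule summable_comparison_test'[OF summable_geometric_half[of C], of 0]) (use C[of 0] in simp)
  have d: "((\<lambda>x. level_left (exp4 (- real j - x))) has_real_derivative - level_slope (- real j - x)) (at x)" for j x
    unfolding level_right_exp4 using DERIV_diff[OF level_fun_exp2_shift_deriv[of "- real j" x] DERIV_const[of "1 / 6"]] by simp
  have c: "continuous_on UNIV (\<lambda>x. - level_slope (- real j - x))" for j
    by (intro continuous_intros continuous_on_compose2[OF continuous_level_slope]) auto
  have b: "\<bar>- level_slope (- real j - x)\<bar> \<le> M K j" if "\<bar>x\<bar> \<le> K" for K x j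
    using M(2)[OF that, of j "- real j"] by simp
  note S = series_C1[of "\<lambda>j x. level_left (exp4 (- real j - x))" "\<lambda>j x. - level_slope (- real j - x)", OF d c b M(1) s0]
  show "(\<lambda>j. level_left (exp4 (- real j - x))) sums left_part x" unfolding left_part_def by (rule summable_sums[OF S(1)])
  show "(left_part has_real_derivative (\<Sum>j. - level_slope (- real j - x))) (at x)" unfolding left_part_def[abs_def] by (rule S(2))
  show "continuous_on UNIV (\<lambda>x. \<Sum>j. - level_slope (- real j - x))" by (rule S(3))
qed

lemma periodic_part_deriv: "(periodic_part has_real_derivative periodic_part' x) (at x)"
  unfolding periodic_part_def[abs_def] periodic_part'_def by (rule derivative_eq_intros right_part_deriv left_part_deriv refl | simp)+

lemma periodic_part'_cont: "continuous_on UNIV periodic_part'"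
  unfolding periodic_part'_def[abs_def] by (intro continuous_intros right_part_cont left_part_cont)

text \<open>Increasing \<open>x\<close> by 1 moves the term \<open>level_right (exp4 (- x))\<close>
  from the left series, where it stands diminished by 1/6, to the right series. The gain of 1/6 is
  the growth of \<open>x / 6\<close>.\<close>

lemma periodic_part_shift: "periodic_part (x + 1) = periodic_part x"
proof -
  have "(\<lambda>j. level_right (exp4 (real (Suc j) - x))) sums right_part x"
    using right_part_sums[of x] by (simp add: add.commute)
  hence "(\<lambda>j. level_right (exp4 (real j - x))) sums (right_part x + level_right (exp4 (- x)))" by (subst (asm) sums_Suc_iff) simp
  moreover have "(\<lambda>j. level_right (exp4 (real j - x))) sums right_part (x + 1)" using right_part_sums[of "x + 1"] by simp
  ultimately have R: "right_part (x + 1) = right_part x + level_right (exp4 (- x))" by (metis sums_unique2)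
  have "(\<lambda>j. level_left (exp4 (- real (Suc j) - x))) sums left_part (x + 1)"
  proof -
    have "- real (Suc j) - x = - real j - (x + 1)" for j by simp
    then show ?thesis using left_part_sums[of "x + 1"] by (simp only:)
  qed
  hence "(\<lambda>j. level_left (exp4 (- real j - x))) sums (left_part (x + 1) + level_left (exp4 (- x)))" by (subst (asm) sums_Suc_iff) simp
  with left_part_sums have L: "left_part x = left_part (x + 1) + level_left (exp4 (- x))" by (metis sums_unique2)
  show ?thesis using L unfolding periodic_part_def R level_right_exp4 by (simp add: add_divide_distrib)
qed

lemma periodic_part_fourier:
  shows "(\<lambda>k. norm (fcoeff (\<lambda>t. of_real (periodic_part t)) k)) summable_on UNIV"
    "((\<lambda>k. fcoeff (\<lambda>t. of_real (periodic_part t)) k * fmode k x) has_sum of_real (periodic_part x)) UNIV"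
  by (rule fourier_series[OF periodic_part_deriv periodic_part'_cont periodic_part_shift])+


lemma fmode_int [simp]: "fmode k (of_int m) = 1"
  using cis_multiple_2pi[of "of_int (k * m)"] by (simp add: fmode_def mult.assoc)

lemma chi_half: "chi k / 2 = of_real (pi * of_int k / ln 2) * \<i>"
  by (simp add: chi_def)

lemma mellin_integrand_fmode: "mellin_integrand f (chi k / 2) (of_int m) x = of_real (f (exp4 (of_int m - x))) * fmode (- k) x"
proof -
  have "exp (chi k / 2 * of_real (ln 4 * (of_int m - x))) = fmode k (of_int m - x)"
  proof -
    have "chi k / 2 * of_real (ln 4 * (of_int m - x)) = \<i> * of_real (2 * pi * of_int k * (of_int m - x))"
      unfolding chi_half ln_4 by simp
    then show ?thesis by (simp only: fmode_def cis_conv_exp)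
  qed
  also have "\<dots> = fmode (- k) x" by (simp add: fmode_diff)
  finally show ?thesis by (simp only: mellin_integrand_def)
qed

text \<open>The geometric bound on the unit interval gives uniform convergence, so the integral
  passes through the series. Since 4 to the power \<open>chi k / 2\<close> is 1, integer shifts
  leave the kernel \<open>fmode (- k)\<close> unchanged.\<close>

lemma fcoeff_mellin_piece_series:
  assumes f: "continuous_on {0<..} f"
    and b: "\<And>j x. 0 \<le> x \<Longrightarrow> x \<le> 1 \<Longrightarrow> \<bar>f (exp4 (of_int (m j) - x))\<bar> \<le> C * (1 / 2) ^ j"
    and s: "\<And>x. (\<lambda>j. f (exp4 (of_int (m j) - x))) sums S x"
  shows "((\<lambda>x. of_real (S x) * fmode (- k) x) has_integral (\<Sum>j. mellin_piece f (of_int (m j)) (chi k / 2))) {0..1}"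
proof -
  let ?z = "chi k / 2"
  have e: "(\<Sum>j. mellin_integrand f ?z (of_int (m j)) x) = of_real (S x) * fmode (- k) x" for x
    unfolding mellin_integrand_fmode by (intro sums_unique[symmetric] sums_mult2 sums_of_real s)
  have ul: "uniform_limit (cbox 0 1) (\<lambda>n x. \<Sum>j<n. mellin_integrand f ?z (of_int (m j)) x) (\<lambda>x. \<Sum>j. mellin_integrand f ?z (of_int (m j)) x) sequentially"
    by (rule Weierstrass_m_test[OF _ summable_geometric_half[of C]]) (use b in \<open>auto simp: mellin_integrand_fmode norm_mult\<close>)
  have ci: "continuous_on (cbox 0 1) (\<lambda>x. \<Sum>j<n. mellin_integrand f ?z (of_int (m j)) x)" for n
    by (intro continuous_intros continuous_on_mellin_integrand f)
  obtain I J where IJ: "\<And>n. ((\<lambda>x. \<Sum>j<n. mellin_integrand f ?z (of_int (m j)) x) has_integral I n) (cbox 0 1)"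
    "((\<lambda>x. \<Sum>j. mellin_integrand f ?z (of_int (m j)) x) has_integral J) (cbox 0 1)" "I \<longlonglongrightarrow> J"
    using uniform_limit_integral_cbox[OF ul ci sequentially_bot] by blast
  have "((\<lambda>x. \<Sum>j<n. mellin_integrand f ?z (of_int (m j)) x) has_integral (\<Sum>j<n. mellin_piece f (of_int (m j)) ?z)) {0..1}" for n
    by (intro has_integral_sum mellin_integrand_has_integral f) auto
  hence "I = (\<lambda>n. \<Sum>j<n. mellin_piece f (of_int (m j)) ?z)"
    using has_integral_unique[OF IJ(1)] by (intro ext) simp
  hence "(\<lambda>j. mellin_piece f (of_int (m j)) ?z) sums J" using IJ(3) by (simp only: sums_def)
  from sums_unique[OF this] IJ(2) show ?thesis by (simp add: e)
qed

lemma fcoeff_id_has_integral: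
  assumes "k \<noteq> 0"
  shows "((\<lambda>x. of_real x * fmode (- k) x) has_integral - 1 / (2 * of_real pi * of_int k * \<i>)) {0..1}"
proof -
  define c where "c = - (2 * complex_of_real pi * of_int k * \<i>)"
  have c: "c \<noteq> 0" using assms by (simp add: c_def)
  define G where "G = (\<lambda>x. (of_real x - 1 / c) * fmode (- k) x / c)"
  have "((\<lambda>x. of_real x * fmode (- k) x) has_integral (G 1 - G 0)) {0..1}"
  proof (rule fundamental_theorem_of_calculus)
    fix x :: real
    have e: "(fmode (- k) has_vector_derivative c * fmode (- k) x) (at x within {0..1})"
      using fmode_deriv[of "- k"] by (simp add: c_def)
    have o: "((\<lambda>x. of_real x - 1 / c) has_vector_derivative 1) (at x within {0..1})"
      by (auto intro!: derivative_eq_intros)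
    have "(G has_vector_derivative ((of_real x - 1 / c) * (c * fmode (- k) x) + 1 * fmode (- k) x) / c) (at x within {0..1})"
      unfolding G_def by (intro has_vector_derivative_divide has_vector_derivative_mult e o)
    moreover have "((of_real x - 1 / c) * (c * fmode (- k) x) + 1 * fmode (- k) x) / c = of_real x * fmode (- k) x"
      using c by (simp add: field_simps)
    ultimately show "(G has_vector_derivative of_real x * fmode (- k) x) (at x within {0..1})" by (simp only:)
  qed simp
  moreover have "G 1 - G 0 = 1 / c" using c by (simp add: G_def field_simps)
  moreover have "1 / c = - 1 / (2 * of_real pi * of_int k * \<i>)" by (simp add: c_def)
  ultimately show ?thesis by (simp only:)
qed

text \<open>The coefficient \<open>e\<close> of the identity function remains a parameter: it is 1/2
  for \<open>k = 0\<close> and has another form for \<open>k \<noteq> 0\<close>.\<close>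

lemma fcoeff_periodic_part_aux:
  assumes "((\<lambda>x. of_real x * fmode (- k) x) has_integral e) {0..1}"
  shows "((\<lambda>x. of_real (periodic_part x) * fmode (- k) x) has_integral
    (rmellin level_right (chi k / 2) + lmellin level_left (chi k / 2) - e / 6)) {0..1}"
proof -
  obtain C where C: "C \<ge> 0" "\<And>j x. 0 \<le> x \<Longrightarrow> x \<le> 1 \<Longrightarrow> \<bar>level_right (exp4 (real j + 1 - x))\<bar> \<le> C * (1 / 2) ^ j" using level_right_unit_bound by blast
  obtain D where D: "D \<ge> 0" "\<And>j x. 0 \<le> x \<Longrightarrow> \<bar>level_left (exp4 (- real j - x))\<bar> \<le> D * exp2 (- x) * (1 / 2) ^ j" using level_left_exp4_bound by blast
  have R: "((\<lambda>x. of_real (right_part x) * fmode (- k) x) has_integral rmellin level_right (chi k / 2)) {0..1}"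
    using fcoeff_mellin_piece_series[OF continuous_level_right, of "\<lambda>j. int j + 1" C right_part k] C(2) right_part_sums by (simp add: rmellin_def)
  have "\<bar>level_left (exp4 (- real j - x))\<bar> \<le> D * (1 / 2) ^ j" if "0 \<le> x" for j x
  proof -
    have "D * exp2 (- x) * (1 / 2) ^ j \<le> D * 1 * (1 / 2) ^ j"
      using exp2_mono[of "- x" 0] that D(1) by (intro mult_right_mono mult_left_mono) auto
    with D(2)[OF that, of j] show ?thesis by simp
  qed
  hence L: "((\<lambda>x. of_real (left_part x) * fmode (- k) x) has_integral lmellin level_left (chi k / 2)) {0..1}"
    using fcoeff_mellin_piece_series[OF continuous_level_left, of "\<lambda>j. - int j" D left_part k] left_part_sums by (simp add: lmellin_def)
  have "((\<lambda>x. of_real (right_part x) * fmode (- k) x + of_real (left_part x) * fmode (- k) x - of_real x * fmode (- k) x / 6) has_integral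
    (rmellin level_right (chi k / 2) + lmellin level_left (chi k / 2) - e / 6)) {0..1}"
    by (intro has_integral_add has_integral_diff has_integral_divide R L assms)
  then show ?thesis by (simp add: periodic_part_def algebra_simps)
qed

text \<open>After multiplication by ln 4 the linear term of \<open>periodic_part\<close> contributes
  1 / (6 z), exactly the polar term by which \<open>mellin_ext\<close> falls short of the product of
  Gamma and zeta. The factor 2 disappears in ln 4 = 2 ln 2.\<close>

lemma fcoeff_periodic_part: "k \<noteq> 0 \<Longrightarrow> fcoeff (\<lambda>t. of_real (periodic_part t)) k = 1 / of_real (ln 2) * ((- 1 + chi k) * Gamma (chi k / 2) * zeta (- 1 + chi k))"
proof -
  assume k: "k \<noteq> 0"
  define z where "z = chi k / 2"
  have zi: "z = of_real (pi * of_int k / ln 2) * \<i>" unfolding z_def by (rule chi_half)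
  have z: "Re z = 0" "z \<noteq> 0" unfolding zi using k by auto
  have z1: "z - 1 \<noteq> 0" using z(1) by (auto simp: complex_eq_iff)
  have l2: "complex_of_real (ln 2) \<noteq> 0" by simp
  define E where "E = - 1 / (2 * complex_of_real pi * of_int k * \<i>)"
  have E: "of_real (ln 4) * E = - 1 / z" unfolding E_def zi ln_4 using k by (simp add: field_simps)
  have *: "c * (R + 1 / (w * c) + L - E / 6) = c * (R + L) + 1 / w - c * E / 6" if "c \<noteq> 0" for c R w L :: complex
    using that by (simp add: distrib_left right_diff_distrib)
  have "complex_of_real (ln 4) \<noteq> 0" unfolding ln_4 using l2 by simp
  note * = *[OF this]
  have "fcoeff (\<lambda>t. of_real (periodic_part t)) k = rmellin level_right z + lmellin level_left z - E / 6"
    unfolding fcoeff_def z_def E_def by (rule integral_unique[OF fcoeff_periodic_part_aux[OF fcoeff_id_has_integral[OF k]]])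
  also have "rmellin level_right z = rmellin level_series z + 1 / ((z - 1) * of_real (ln 4))" by (rule rmellin_level_right) (use z in simp)
  finally have "of_real (ln 4) * fcoeff (\<lambda>t. of_real (periodic_part t)) k = mellin_ext z - (of_real (ln 4) * E) / 6"
    unfolding mellin_ext_def by (simp only: *)
  also have "\<dots> = mellin_ext z + 1 / (6 * z)" unfolding E by simp
  also have "\<dots> = 2 * (2 * z - 1) * Gamma z * zeta (2 * z - 1)"
    by (rule mellin_ext_Gamma) (use z z1 in auto)
  finally have q: "of_real (ln 4) * fcoeff (\<lambda>t. of_real (periodic_part t)) k = 2 * (2 * z - 1) * Gamma z * zeta (2 * z - 1)" .
  have "2 * z - 1 = - 1 + chi k" by (simp add: z_def)
  hence "2 * (of_real (ln 2) * fcoeff (\<lambda>t. of_real (periodic_part t)) k) = 2 * ((- 1 + chi k) * Gamma z * zeta (- 1 + chi k))"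
    using q unfolding ln_4 of_real_mult of_real_numeral by (simp only: mult.assoc)
  hence "of_real (ln 2) * fcoeff (\<lambda>t. of_real (periodic_part t)) k = (- 1 + chi k) * Gamma z * zeta (- 1 + chi k)"
    by (simp only: mult_cancel_left) simp
  hence "fcoeff (\<lambda>t. of_real (periodic_part t)) k = ((- 1 + chi k) * Gamma z * zeta (- 1 + chi k)) / of_real (ln 2)"
    using l2 by (simp add: nonzero_eq_divide_eq mult.commute)
  then show ?thesis by (simp add: z_def)
qed

section \<open>The mean, the fluctuation and the final estimate\<close>

definition periodic_mean :: complex where
  "periodic_mean = - (of_real euler_mascheroni + of_real (ln 2) + 24 * deriv zeta (- 1) + 2) / (12 * of_real (ln 2))"

text \<open>The mean is mellin_ext 0 / ln 4 - 1/12. The last term, from the mean 1/2 of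
  \<open>x\<close> in \<open>x / 6\<close>, puts ln 2 into the numerator of
  \<open>periodic_mean\<close>.\<close>

lemma periodic_part_has_integral: "((\<lambda>x. complex_of_real (periodic_part x)) has_integral periodic_mean) {0..1}"
proof -
  have c0: "chi 0 / 2 = 0" by (simp add: chi_def)
  have l2: "complex_of_real (ln 2) \<noteq> 0" by simp
  have "((\<lambda>x::real. x) has_integral (1\<^sup>2 / 2 - 0\<^sup>2 / 2)) {0..1}"
    by (rule fundamental_theorem_of_calculus)
      (auto intro!: derivative_eq_intros simp: has_real_derivative_iff_has_vector_derivative[symmetric])
  hence "((\<lambda>x. complex_of_real x) has_integral of_real (1\<^sup>2 / 2 - 0\<^sup>2 / 2)) {0..1}"
    by (rule has_integral_of_real)
  hence "((\<lambda>x. complex_of_real x * fmode (- 0) x) has_integral of_real (1 / 2)) {0..1}" by simp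
  from fcoeff_periodic_part_aux[OF this]
  have "((\<lambda>x. complex_of_real (periodic_part x)) has_integral (rmellin level_right 0 + lmellin level_left 0 - of_real (1 / 2) / 6)) {0..1}"
    unfolding c0 by simp
  moreover have "rmellin level_right 0 + lmellin level_left 0 - of_real (1 / 2) / 6 = periodic_mean"
  proof -
    have "rmellin level_right 0 = rmellin level_series 0 - 1 / of_real (ln 4)" using rmellin_level_right(2)[of 0] by simp
    moreover have "of_real (ln 4) * (rmellin level_series 0 + lmellin level_left 0) = mellin_ext 0 + 1" by (simp add: mellin_ext_def)
    moreover have "c * (p + l) = a" if "p = r - 1 / c" "c * (r + l) = a + 1" "c \<noteq> 0" for a c p l r :: complex
    proof -
      have "c * (p + l) = c * (r + l) - c * (1 / c)" unfolding that(1) by (simp only: distrib_left right_diff_distrib) simp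
      then show ?thesis using that(2,3) by simp
    qed
    moreover have "complex_of_real (ln 4) \<noteq> 0" unfolding ln_4 using l2 by simp
    ultimately have "of_real (ln 4) * (rmellin level_right 0 + lmellin level_left 0) = mellin_ext 0" by blast
    hence "rmellin level_right 0 + lmellin level_left 0 = mellin_ext 0 / (2 * of_real (ln 2))"
      using l2 unfolding ln_4 by (simp add: nonzero_eq_divide_eq mult.commute)
    moreover have "s - of_real (1 / 2) / 6 = - (g + c + 24 * d + 2) / (12 * c)"
      if "s = (- 1 / 3 - g / 6 - 4 * d) / (2 * c)" "c \<noteq> 0" for s g c d :: complex
      using that(2) unfolding that(1) by (simp add: field_simps)
    ultimately show ?thesis using l2 unfolding mellin_ext_0 periodic_mean_def by blast
  qed
  ultimately show ?thesis by simp
qed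

lemma fcoeff_periodic_part_0: "fcoeff (\<lambda>t. of_real (periodic_part t)) 0 = periodic_mean"
  unfolding fcoeff_def using integral_unique[OF periodic_part_has_integral] by simp

lemma delta_term_fcoeff: "k \<noteq> 0 \<Longrightarrow> delta_term x k = of_real (ln 2) * (fcoeff (\<lambda>t. of_real (periodic_part t)) k * fmode k x)"
proof -
  assume k: "k \<noteq> 0"
  have "fmode k x = exp (2 * of_int k * of_real pi * \<i> * of_real x)"
    unfolding fmode_def cis_conv_exp by (simp add: mult_ac)
  then show ?thesis by (simp add: delta_term_def fcoeff_periodic_part[OF k])
qed

lemma delta_term_has_sum: "(delta_term x has_sum of_real (ln 2) * (of_real (periodic_part x) - periodic_mean)) (UNIV - {0})"
proof -
  let ?f = "\<lambda>k. fcoeff (\<lambda>t. of_real (periodic_part t)) k * fmode k x"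
  have "(?f has_sum (of_real (periodic_part x) - periodic_mean)) (UNIV - {0})"
    by (rule has_sum_Diff[OF periodic_part_fourier(2)]) (use has_sum_finite[of "{0}" ?f] in \<open>simp_all add: fcoeff_periodic_part_0\<close>)
  hence "((\<lambda>k. of_real (ln 2) * ?f k) has_sum of_real (ln 2) * (of_real (periodic_part x) - periodic_mean)) (UNIV - {0})"
    by (rule has_sum_cmult_right)
  then show ?thesis by (subst has_sum_cong) (auto simp: delta_term_fcoeff)
qed

lemma delta_eq: "delta x = of_real (periodic_part x) - periodic_mean"
  unfolding delta_def infsumI[OF delta_term_has_sum] by simp

lemma delta_integral: "(delta has_integral 0) {0..1}"
proof -
  have "((\<lambda>x. of_real (periodic_part x) - periodic_mean) has_integral (periodic_mean - periodic_mean)) {0..1}"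
    using has_integral_diff[OF periodic_part_has_integral has_integral_const_real[of periodic_mean 0 1]] by simp
  then show ?thesis by (simp add: delta_eq[abs_def])
qed

text \<open>Only the levels r \<ge> 0 occur, and they form \<open>right_part\<close>. Completing
  them to all integers costs \<open>left_part\<close>, which is of order 2^(- log 4 n) = 1 / sqrt
  n.\<close>

lemma level_fun_sum:
  assumes n: "n \<ge> 1"
  shows "(\<Sum>r. level_fun (2 ^ Suc r * (1 / sqrt (real n)))) = periodic_part (log 4 (real n)) + log 4 (real n) / 6 - left_part (log 4 (real n))"
proof -
  define x where "x = log 4 (real n)"
  have x: "ln 2 * x = ln (real n) / 2" by (simp add: x_def log_def ln_4)
  have ex: "exp2 (- x) = 1 / sqrt (real n)"
  proof -
    have "(exp2 x)\<^sup>2 = exp (2 * (ln 2 * x))" by (simp add: exp2_def exp_double)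
    also have "\<dots> = real n" using n by (simp add: x)
    finally have "exp2 x = sqrt (real n)" by (metis exp2_nonneg real_sqrt_unique)
    then show ?thesis by (simp add: exp2_minus)
  qed
  have "level_fun (2 ^ Suc r * (1 / sqrt (real n))) = level_right (exp4 (real r + 1 - x))" for r
  proof -
    have "exp2 (real (Suc r)) = 2 ^ Suc r" unfolding exp2_def by (subst mult.commute, subst exp_of_nat_mult) simp
    hence "exp2 (real (Suc r) + - x) = 2 ^ Suc r * (1 / sqrt (real n))" unfolding exp2_add ex by (simp only:)
    then show ?thesis by (simp add: level_right_exp4 add.commute)
  qed
  hence "(\<Sum>r. level_fun (2 ^ Suc r * (1 / sqrt (real n)))) = right_part x" by (simp only: right_part_def)
  then show ?thesis by (simp add: periodic_part_def x_def)
qed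

lemma left_part_bound: "\<exists>C\<ge>0. \<forall>n\<ge>1. \<bar>left_part (log 4 (real n))\<bar> \<le> C * sqrt (1 / sqrt (real n))"
proof -
  obtain D where D: "D \<ge> 0" "\<And>j x. 0 \<le> x \<Longrightarrow> \<bar>level_left (exp4 (- real j - x))\<bar> \<le> D * exp2 (- x) * (1 / 2) ^ j" using level_left_exp4_bound by blast
  have "\<bar>left_part (log 4 (real n))\<bar> \<le> 2 * D * sqrt (1 / sqrt (real n))" if n: "n \<ge> 1" for n
  proof -
    define x where "x = log 4 (real n)"
    have x: "x \<ge> 0" using n by (simp add: x_def)
    have g: "(\<lambda>j. D * exp2 (- x) * (1 / 2) ^ j) sums (D * exp2 (- x) * 2)"
      using geometric_sums[of "1 / 2 :: real"] by (intro sums_mult) simp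
    have 1: "\<bar>left_part x\<bar> \<le> D * exp2 (- x) * 2"
      unfolding left_part_def sums_unique[OF g] real_norm_def[symmetric]
      by (rule norm_suminf_le[OF _ sums_summable[OF g]]) (use D(2)[OF x] in simp)
    have "exp2 (- x) \<le> sqrt (1 / sqrt (real n))"
    proof -
      have "exp2 (- x) = exp (- (ln (real n) / 2))" by (simp add: exp2_def x_def log_def ln_4)
      \<comment> \<open>The true size 1 / sqrt n is weakened here to the order of the other
        errors.\<close>
      also have "\<dots> \<le> exp (- (ln (real n) / 4))" using n by simp
      also have "\<dots> = real n powr (- 1 / 4)" using n by (simp add: powr_def)
      also have "\<dots> = sqrt (1 / sqrt (real n))" using n by (simp add: powr_half_sqrt[symmetric] powr_divide powr_powr powr_minus_divide)
      finally show ?thesis .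
    qed
    hence "D * exp2 (- x) * 2 \<le> D * sqrt (1 / sqrt (real n)) * 2" using D(1) by (intro mult_right_mono mult_left_mono) auto
    with 1 show ?thesis by (simp add: x_def mult_ac)
  qed
  moreover have "2 * D \<ge> 0" using D(1) by simp
  ultimately show ?thesis by blast
qed


theorem theorem4:
  shows "(\<lambda>n::nat. complex_of_real (expected_paths n) -
            (of_real ((alpha - 1) * real n) + of_real (1 / 6 * log 4 (real n))
             - (of_real euler_mascheroni + 4 * (of_real alpha - 1) * of_real (ln 2)
                + of_real (ln 2) + 24 * deriv zeta (- 1) + 2) / (12 * of_real (ln 2))
             + delta (log 4 (real n))))
          \<in> O(\<lambda>n. complex_of_real (real n powr (- 1 / 4)))
         \<and> (\<forall>x. delta_term x summable_on (UNIV - {0}))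
         \<and> (\<forall>x. delta (x + 1) = delta x)
         \<and> (delta has_integral 0) {0..1}"
    (is "?f \<in> _ \<and> _")
proof (intro conjI allI)
  show "delta_term x summable_on (UNIV - {0})" for x
    using delta_term_has_sum by (auto simp: summable_on_def)
  show "delta (x + 1) = delta x" for x by (simp add: delta_eq periodic_part_shift)
  show "(delta has_integral 0) {0..1}" by (rule delta_integral)
  obtain C where C: "C \<ge> 0" "\<And>n. n \<ge> 2 \<Longrightarrow>
      \<bar>expected_paths n - ((alpha - 1) * real n - (alpha - 1) / 3 + (\<Sum>r. level_fun (2 ^ Suc r * (1 / sqrt (real n)))))\<bar>
      \<le> C * sqrt (1 / sqrt (real n))" using expected_main by blast
  obtain D where D: "D \<ge> 0" "\<And>n. n \<ge> 1 \<Longrightarrow> \<bar>left_part (log 4 (real n))\<bar> \<le> D * sqrt (1 / sqrt (real n))" using left_part_bound by blast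
  have "norm (?f n) \<le> (C + D) * norm (complex_of_real (real n powr (- 1 / 4)))" if n: "n \<ge> 2" for n
  proof -
    define x where "x = log 4 (real n)"
    have l2: "complex_of_real (ln 2) \<noteq> 0" by simp
    \<comment> \<open>The constant combines (alpha - 1) / 3 from the levels with the mean that
      \<open>delta\<close> has lost.\<close>
    have K: "(of_real euler_mascheroni + 4 * (of_real alpha - 1) * of_real (ln 2)
                + of_real (ln 2) + 24 * deriv zeta (- 1) + 2) / (12 * of_real (ln 2))
        = of_real ((alpha - 1) / 3) - periodic_mean"
      unfolding periodic_mean_def using l2 by (simp add: field_simps)
    have "?f n = of_real (expected_paths n - ((alpha - 1) * real n - (alpha - 1) / 3 + (periodic_part x + x / 6)))"
      unfolding K delta_eq x_def[symmetric] by simp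
    also have "norm \<dots> = \<bar>expected_paths n - ((alpha - 1) * real n - (alpha - 1) / 3 + (periodic_part x + x / 6))\<bar>"
      by (rule norm_of_real)
    also have "\<dots> \<le> C * sqrt (1 / sqrt (real n)) + D * sqrt (1 / sqrt (real n))"
    proof -
      have H: "(\<Sum>r. level_fun (2 ^ Suc r * (1 / sqrt (real n)))) = periodic_part x + x / 6 - left_part x"
        unfolding x_def by (rule level_fun_sum) (use n in simp)
      have t: "\<bar>e - (a + b)\<bar> \<le> u + v" if "\<bar>e - (a + (b - l))\<bar> \<le> u" "\<bar>l\<bar> \<le> v" for a b e l u v :: real
        using that by linarith
      show ?thesis by (rule t[OF C(2)[OF n, unfolded H]]) (use D(2)[of n] n in \<open>simp add: x_def\<close>)
    qed
    also have "\<dots> = (C + D) * (real n powr (- 1 / 4))"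
    proof -
      have "sqrt (1 / sqrt (real n)) = real n powr (- 1 / 4)"
        using n by (simp add: powr_half_sqrt[symmetric] powr_divide powr_powr powr_minus_divide)
      then show ?thesis by (simp only: distrib_right)
    qed
    finally show ?thesis by simp
  qed
  then show "?f \<in> O(\<lambda>n. complex_of_real (real n powr (- 1 / 4)))"
    by (intro bigoI[of _ "C + D"] eventually_at_top_linorderI[of 2]) blast
qed

end
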